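(* Let $\mathcal{E}=(L|K,v)$ be a Galois defect extension of prime degree $p=\operatorname{char}Kv$, and if $\operatorname{char}K=0$, assume that $K$ contains all $p$-th roots of unity. Then the following assertions are equivalent: a) $\mathcal{E}$ has independent defect; b) the ramification ideal $I_{\mathcal{E}}$ of $\mathcal{E}$ is equal to $\mathcal{M}_{v_H}$ for some strongly convex subgroup $H$ of $vL$; c) $I_{\mathcal{E}}^p=I_{\mathcal{E}}$; d) $\Omega_{\mathcal{O}_L|\mathcal{O}_K}=0$; e) $\operatorname{Tr}_{L|K}(\mathcal{M}_L)=\mathcal{M}_{v_H}\cap K$ for some strongly convex subgroup $H$ of $vK$. If assertion b) or e) holds, then $H=H_{\mathcal{E}}$, and the valuation ring of $v_H$ is the localization of $\mathcal{O}_L$ with respect to the ramification ideal $I_{\mathcal{E}}$. The value group of the corresponding coarsening of $v$ does not have a smallest positive element. If $vK$ is archimedean, or more generally, if $(vK)_{vp}$ is archimedean, then $H_{\mathcal{E}}$ can only be equal to $\{0\}$ (when $\mathcal{E}$ has independent defect), and if the ramification ideal is a prime ideal, then it can only be equal to $\mathcal{M}_L$. If $\Omega_{\mathcal{O}_L|\mathcal{O}_K}$ is annihilated by $\mathcal{M}_L$, then $\Omega_{\mathcal{O}_L|\mathcal{O}_K}=0$.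
   Context: $(L|K,v)$ denotes a field extension $L|K$ with a (Krull) valuation $v$ on $L$ of arbitrary rank (written additively, $v0=\infty$), $K$ being endowed with the restriction of $v$. $\mathcal{O}_L,\mathcal{O}_K$ are the valuation rings, $\mathcal{M}_L,\mathcal{M}_K$ their maximal ideals, $vL,vK$ the value groups, $Lv,Kv$ the residue fields. $\Omega_{B|A}$ is the module of Kähler differentials; $\operatorname{Tr}_{L|K}$ is the trace. $(L|K,v)$ is unibranched if the extension of $v$ from $K$ to $L$ is unique. For a finite unibranched extension, $[L:K]=\tilde p^{\,\nu}(vL:vK)[Lv:Kv]$ with an integer $\nu\ge0$, where $\tilde p=\operatorname{char}Kv$ if this is positive and $\tilde p=1$ otherwise; it is a defect extension if $\tilde p^{\,\nu}>1$. A defect extension of prime degree is always tacitly assumed to be unibranched; hence its degree is $p=\operatorname{char}Kv$, $vL=vK$ and $Lv=Kv$. For $\mathcal{E}=(L|K,v)$ a Galois defect extension of prime degree $p$ and $\mathrm{id}\neq\sigma\in\operatorname{Gal}(L|K)$, the set $\Sigma_{\mathcal{E}}=\{v(\frac{\sigma b-b}{b})\mid b\in L^\times,\ \sigma b\ne b\}$ is a final segment of $vL^{>0}$ and does not depend on the choice of $\sigma$. The ramification ideal of $\mathcal{E}$ is the $\mathcal{O}_L$-ideal $I_{\mathcal{E}}=\{a\in L\mid va\in\Sigma_{\mathcal{E}}\}\cup\{0\}$. A strongly convex subgroup of an ordered abelian group $\Gamma$ is a proper convex subgroup $H$ such that $\Gamma/H$ has no smallest positive element. $\alpha>H$ means $\alpha>h$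 for all $h\in H$. $\mathcal{E}$ has independent defect if $\Sigma_{\mathcal{E}}=\{\alpha\in vL\mid\alpha>H\}$ for some strongly convex subgroup $H$ of $vL$; in this case this $H$ is denoted by $H_{\mathcal{E}}$. For a convex subgroup $H$ of $vL$, $v_H$ is the corresponding coarsening of $v$ on $L$, with value group $vL/H$ and with valuation ring having maximal ideal $\mathcal{M}_{v_H}=\{a\in L\mid va>H\}$. If $\operatorname{char}K=0$, $(vK)_{vp}$ is the smallest convex subgroup of $vK$ containing $vp$; if $\operatorname{char}K>0$, $(vK)_{vp}=vK$. An ordered abelian group is archimedean if it is order isomorphic to a subgroup of $\mathbb{R}$. *)

theory Defs
  imports Complex_Main "HOL-Algebra.Algebra"
begin

section \<open>Ordered abelian groups\<close>

text \<open>
  The ordered abelian groups that occur are subgroups, given as sets, of an ambient linearly ordered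
  abelian group \<open>'g\<close>.  An element of a quotient by a convex subgroup \<open>H\<close> is a coset, and \<open>H\<close>
  itself is the zero of the quotient.
\<close>

definition convex_subgroup :: "'g::linordered_ab_group_add set \<Rightarrow> 'g set \<Rightarrow> bool" where
  "convex_subgroup \<Gamma> H \<longleftrightarrow> H \<subseteq> \<Gamma> \<and> 0 \<in> H \<and> (\<forall>x\<in>H. \<forall>y\<in>H. x + y \<in> H) \<and> (\<forall>x\<in>H. - x \<in> H) \<and>
     (\<forall>x\<in>H. \<forall>y\<in>H. \<forall>g\<in>\<Gamma>. x \<le> g \<and> g \<le> y \<longrightarrow> g \<in> H)"

definition coset_of :: "'g::linordered_ab_group_add set \<Rightarrow> 'g \<Rightarrow> 'g set" where
  "coset_of H \<alpha> = (\<lambda>h. \<alpha> + h) ` H"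

definition coset_group :: "'g::linordered_ab_group_add set \<Rightarrow> 'g set \<Rightarrow> 'g set set" where
  "coset_group \<Gamma> H = coset_of H ` \<Gamma>"

definition coset_le :: "'g::linordered_ab_group_add set \<Rightarrow> 'g set \<Rightarrow> bool" where
  "coset_le C D \<longleftrightarrow> (\<exists>x\<in>C. \<exists>y\<in>D. x \<le> y)"

text \<open>Here \<open>Q\<close> is a set of cosets of \<open>H\<close>, so that \<open>H\<close> is its zero.\<close>

definition has_least_positive :: "'g::linordered_ab_group_add set set \<Rightarrow> 'g set \<Rightarrow> bool" where
  "has_least_positive Q H \<longleftrightarrow>
     (\<exists>C\<in>Q. C \<noteq> H \<and> coset_le H C \<and> (\<forall>D\<in>Q. D \<noteq> H \<and> coset_le H D \<longrightarrow> coset_le C D))"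

definition strongly_convex :: "'g::linordered_ab_group_add set \<Rightarrow> 'g set \<Rightarrow> bool" where
  "strongly_convex \<Gamma> H \<longleftrightarrow>
     convex_subgroup \<Gamma> H \<and> H \<noteq> \<Gamma> \<and> \<not> has_least_positive (coset_group \<Gamma> H) H"

definition archimedean_group :: "'g::linordered_ab_group_add set \<Rightarrow> bool" where
  "archimedean_group \<Gamma> \<longleftrightarrow> (\<exists>\<phi> :: 'g \<Rightarrow> real.
     (\<forall>x\<in>\<Gamma>. \<forall>y\<in>\<Gamma>. \<phi> (x + y) = \<phi> x + \<phi> y) \<and> strict_mono_on \<Gamma> \<phi>)"


section \<open>Fields and field extensions\<close>

definition ring_char :: "('a, 'm) ring_scheme \<Rightarrow> nat" where
  "ring_char R = group.ord (add_monoid R) \<one>\<^bsub>R\<^esub>"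

definition field_degree :: "('a, 'm) ring_scheme \<Rightarrow> 'a set \<Rightarrow> nat" where
  "field_degree L K = ring.dim L K (carrier L)"

text \<open>
  Automorphisms are made extensional, so that two of them are equal as soon as they agree on \<open>L\<close>.
\<close>

definition Gal :: "('a, 'm) ring_scheme \<Rightarrow> 'a set \<Rightarrow> ('a \<Rightarrow> 'a) set" where
  "Gal L K = {\<sigma> \<in> ring_iso L L \<inter> extensional (carrier L). \<forall>x\<in>K. \<sigma> x = x}"

definition galois_extension :: "('a, 'm) ring_scheme \<Rightarrow> 'a set \<Rightarrow> bool" where
  "galois_extension L K \<longleftrightarrow> field L \<and> subfield K L \<and> ring.finite_dimension L K (carrier L) \<and>
     {x \<in> carrier L. \<forall>\<sigma>\<in>Gal L K. \<sigma> x = x} = K"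

text \<open>
  The trace of the \<open>K\<close>-linear map \<open>x \<mapsto> a x\<close> on \<open>L\<close>: the sum of the diagonal entries of its matrix
  \<open>M\<close> with respect to a basis \<open>us\<close>.  The value does not depend on the basis.
\<close>

definition field_trace :: "('a, 'm) ring_scheme \<Rightarrow> 'a set \<Rightarrow> 'a \<Rightarrow> 'a" where
  "field_trace L K a = (THE t. \<exists>us M.
     ring.independent L K us \<and> ring.Span L K us = carrier L \<and>
     (\<forall>i<length us. \<forall>j<length us. M i j \<in> K) \<and>
     (\<forall>j<length us. a \<otimes>\<^bsub>L\<^esub> us ! j = (\<Oplus>\<^bsub>L\<^esub>i\<in>{..<length us}. M i j \<otimes>\<^bsub>L\<^esub> us ! i)) \<and>
     t = (\<Oplus>\<^bsub>L\<^esub>i\<in>{..<length us}. M i i))"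

text \<open>The localization of a subring \<open>R\<close> of the field \<open>L\<close> at a prime ideal \<open>P\<close>, taken inside \<open>L\<close>.\<close>

definition localization_at :: "('a, 'm) ring_scheme \<Rightarrow> 'a set \<Rightarrow> 'a set \<Rightarrow> 'a set" where
  "localization_at L R P = {a \<otimes>\<^bsub>L\<^esub> inv\<^bsub>L\<^esub> s | a s. a \<in> R \<and> s \<in> R - P}"


section \<open>Kaehler differentials\<close>

text \<open>
  For a subring \<open>A\<close> of a commutative ring \<open>B\<close>, the module of differentials is the free \<open>B\<close>-module
  on the symbols \<open>d b\<close> with \<open>b \<in> B\<close>, modulo the relations of an \<open>A\<close>-derivation.
  The multiplicative fields of the module records carry no meaning.
\<close>

definition free_on_self :: "('a, 'm) ring_scheme \<Rightarrow> ('a, 'a \<Rightarrow> 'a) module" where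
  "free_on_self B =
     \<lparr>carrier = {f \<in> carrier B \<rightarrow>\<^sub>E carrier B. finite {b \<in> carrier B. f b \<noteq> \<zero>\<^bsub>B\<^esub>}},
      monoid.mult = undefined, one = undefined,
      ring.zero = (\<lambda>b\<in>carrier B. \<zero>\<^bsub>B\<^esub>), ring.add = (\<lambda>f g. \<lambda>b\<in>carrier B. f b \<oplus>\<^bsub>B\<^esub> g b),
      smult = (\<lambda>c f. \<lambda>b\<in>carrier B. c \<otimes>\<^bsub>B\<^esub> f b)\<rparr>"

definition diff_symbol :: "('a, 'm) ring_scheme \<Rightarrow> 'a \<Rightarrow> ('a \<Rightarrow> 'a)" where
  "diff_symbol B b = (\<lambda>x\<in>carrier B. if x = b then \<one>\<^bsub>B\<^esub> else \<zero>\<^bsub>B\<^esub>)"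

definition kaehler_relations :: "('a, 'm) ring_scheme \<Rightarrow> 'a set \<Rightarrow> ('a \<Rightarrow> 'a) set" where
  "kaehler_relations B A = (let F = free_on_self B; d = diff_symbol B in
     {d (b \<oplus>\<^bsub>B\<^esub> c) \<ominus>\<^bsub>F\<^esub> (d b \<oplus>\<^bsub>F\<^esub> d c) | b c. b \<in> carrier B \<and> c \<in> carrier B} \<union>
     {d (b \<otimes>\<^bsub>B\<^esub> c) \<ominus>\<^bsub>F\<^esub> (b \<odot>\<^bsub>F\<^esub> d c \<oplus>\<^bsub>F\<^esub> c \<odot>\<^bsub>F\<^esub> d b) | b c. b \<in> carrier B \<and> c \<in> carrier B} \<union>
     d ` A)"

definition submodule_generated ::
    "('b, 'm) ring_scheme \<Rightarrow> ('b, 'c, 'n) module_scheme \<Rightarrow> 'c set \<Rightarrow> 'c set" where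
  "submodule_generated R M S = \<Inter>{N. submodule N R M \<and> S \<subseteq> N}"

definition quotient_module :: "('b, 'c, 'n) module_scheme \<Rightarrow> 'c set \<Rightarrow> ('b, 'c set) module" where
  "quotient_module M N =
     \<lparr>carrier = a_rcosets\<^bsub>M\<^esub> N, monoid.mult = undefined, one = undefined, ring.zero = N, ring.add = set_add M,
      smult = (\<lambda>r C. \<Union>x\<in>C. N +>\<^bsub>M\<^esub> (r \<odot>\<^bsub>M\<^esub> x))\<rparr>"

definition kaehler :: "('a, 'm) ring_scheme \<Rightarrow> 'a set \<Rightarrow> ('a, ('a \<Rightarrow> 'a) set) module" where
  "kaehler B A = quotient_module (free_on_self B)
     (submodule_generated B (free_on_self B) (kaehler_relations B A))"


section \<open>Valued fields\<close>

text \<open>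
  A Krull valuation is given by its values on the nonzero elements; the value at \<open>0\<close> is irrelevant
  and the convention \<open>v 0 = \<infinity>\<close> is made explicit wherever it is used.
  The value group is the image of \<open>L\<^sup>\<times>\<close>, which need not be all of \<open>'g\<close>.
  A subfield \<open>F\<close> carries the restriction of \<open>v\<close>.
\<close>

definition krull_valuation ::
    "('a, 'm) ring_scheme \<Rightarrow> ('a \<Rightarrow> 'g::linordered_ab_group_add) \<Rightarrow> bool" where
  "krull_valuation L v \<longleftrightarrow>
     (\<forall>a\<in>carrier L - {\<zero>\<^bsub>L\<^esub>}. \<forall>b\<in>carrier L - {\<zero>\<^bsub>L\<^esub>}.
        v (a \<otimes>\<^bsub>L\<^esub> b) = v a + v b \<and> (a \<oplus>\<^bsub>L\<^esub> b \<noteq> \<zero>\<^bsub>L\<^esub> \<longrightarrow> min (v a) (v b) \<le> v (a \<oplus>\<^bsub>L\<^esub> b)))"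

definition value_group ::
    "('a, 'm) ring_scheme \<Rightarrow> ('a \<Rightarrow> 'g::linordered_ab_group_add) \<Rightarrow> 'a set \<Rightarrow> 'g set" where
  "value_group L v F = v ` (F - {\<zero>\<^bsub>L\<^esub>})"

definition val_ring ::
    "('a, 'm) ring_scheme \<Rightarrow> ('a \<Rightarrow> 'g::linordered_ab_group_add) \<Rightarrow> 'a set \<Rightarrow> 'a set" where
  "val_ring L v F = {x \<in> F. x = \<zero>\<^bsub>L\<^esub> \<or> 0 \<le> v x}"

definition val_ideal ::
    "('a, 'm) ring_scheme \<Rightarrow> ('a \<Rightarrow> 'g::linordered_ab_group_add) \<Rightarrow> 'a set \<Rightarrow> 'a set" where
  "val_ideal L v F = {x \<in> F. x = \<zero>\<^bsub>L\<^esub> \<or> 0 < v x}"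

abbreviation val_ring_of ::
    "('a, 'm) ring_scheme \<Rightarrow> ('a \<Rightarrow> 'g::linordered_ab_group_add) \<Rightarrow> ('a, 'm) ring_scheme" where
  "val_ring_of L v \<equiv> L\<lparr>carrier := val_ring L v (carrier L)\<rparr>"

definition residue_field ::
    "('a, 'm) ring_scheme \<Rightarrow> ('a \<Rightarrow> 'g::linordered_ab_group_add) \<Rightarrow> 'a set ring" where
  "residue_field L v = val_ring_of L v Quot val_ideal L v (carrier L)"

text \<open>The residue field of a subfield, canonically embedded in the residue field of \<open>L\<close>.\<close>

definition residue_subfield ::
    "('a, 'm) ring_scheme \<Rightarrow> ('a \<Rightarrow> 'g::linordered_ab_group_add) \<Rightarrow> 'a set \<Rightarrow> 'a set set" where
  "residue_subfield L v F =
     (\<lambda>x. val_ideal L v (carrier L) +>\<^bsub>val_ring_of L v\<^esub> x) ` val_ring L v F"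

definition residue_char ::
    "('a, 'm) ring_scheme \<Rightarrow> ('a \<Rightarrow> 'g::linordered_ab_group_add) \<Rightarrow> 'a set \<Rightarrow> nat" where
  "residue_char L v F = ring_char ((residue_field L v)\<lparr>carrier := residue_subfield L v F\<rparr>)"

definition ramification_index ::
    "('a, 'm) ring_scheme \<Rightarrow> ('a \<Rightarrow> 'g::linordered_ab_group_add) \<Rightarrow> 'a set \<Rightarrow> nat" where
  "ramification_index L v K = card (coset_group (value_group L v (carrier L)) (value_group L v K))"

definition inertia_degree ::
    "('a, 'm) ring_scheme \<Rightarrow> ('a \<Rightarrow> 'g::linordered_ab_group_add) \<Rightarrow> 'a set \<Rightarrow> nat" where
  "inertia_degree L v K = field_degree (residue_field L v) (residue_subfield L v K)"

text \<open>
  Valuations on \<open>L\<close> are considered up to equivalence, that is, through their valuation rings; the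
  extensions of \<open>v\<close> from \<open>K\<close> to \<open>L\<close> are the valuation rings of \<open>L\<close> lying over that of \<open>(K, v)\<close>.
\<close>

definition valuation_subring :: "('a, 'm) ring_scheme \<Rightarrow> 'a set \<Rightarrow> bool" where
  "valuation_subring L R \<longleftrightarrow> subring R L \<and> (\<forall>x\<in>carrier L - {\<zero>\<^bsub>L\<^esub>}. x \<in> R \<or> inv\<^bsub>L\<^esub> x \<in> R)"

definition unibranched ::
    "('a, 'm) ring_scheme \<Rightarrow> 'a set \<Rightarrow> ('a \<Rightarrow> 'g::linordered_ab_group_add) \<Rightarrow> bool" where
  "unibranched L K v \<longleftrightarrow>
     (\<forall>R. valuation_subring L R \<and> R \<inter> K = val_ring L v K \<longrightarrow> R = val_ring L v (carrier L))"

definition char_exponent ::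
    "('a, 'm) ring_scheme \<Rightarrow> ('a \<Rightarrow> 'g::linordered_ab_group_add) \<Rightarrow> 'a set \<Rightarrow> nat" where
  "char_exponent L v K = (if residue_char L v K > 0 then residue_char L v K else 1)"

definition defect_extension ::
    "('a, 'm) ring_scheme \<Rightarrow> 'a set \<Rightarrow> ('a \<Rightarrow> 'g::linordered_ab_group_add) \<Rightarrow> bool" where
  "defect_extension L K v \<longleftrightarrow>
     field L \<and> subfield K L \<and> krull_valuation L v \<and> ring.finite_dimension L K (carrier L) \<and>
     unibranched L K v \<and>
     (\<exists>\<nu>::nat. field_degree L K =
         char_exponent L v K ^ \<nu> * ramification_index L v K * inertia_degree L v K \<and>
       char_exponent L v K ^ \<nu> > 1)"

definition galois_defect_extension ::
    "('a, 'm) ring_scheme \<Rightarrow> 'a set \<Rightarrow> ('a \<Rightarrow> 'g::linordered_ab_group_add) \<Rightarrow> nat \<Rightarrow> bool" where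
  "galois_defect_extension L K v p \<longleftrightarrow>
     defect_extension L K v \<and> galois_extension L K \<and> Factorial_Ring.prime p \<and> field_degree L K = p \<and>
     residue_char L v K = p"

text \<open>
  For a Galois defect extension of prime degree this set is the same for all \<open>\<sigma> \<noteq> id\<close> in the
  Galois group.
\<close>

definition Sigma_set ::
    "('a, 'm) ring_scheme \<Rightarrow> ('a \<Rightarrow> 'g::linordered_ab_group_add) \<Rightarrow> ('a \<Rightarrow> 'a) \<Rightarrow> 'g set" where
  "Sigma_set L v \<sigma> =
     {v ((\<sigma> b \<ominus>\<^bsub>L\<^esub> b) \<otimes>\<^bsub>L\<^esub> inv\<^bsub>L\<^esub> b) | b. b \<in> carrier L - {\<zero>\<^bsub>L\<^esub>} \<and> \<sigma> b \<noteq> b}"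

definition ramification_ideal ::
    "('a, 'm) ring_scheme \<Rightarrow> ('a \<Rightarrow> 'g::linordered_ab_group_add) \<Rightarrow> ('a \<Rightarrow> 'a) \<Rightarrow> 'a set" where
  "ramification_ideal L v \<sigma> = {a \<in> carrier L - {\<zero>\<^bsub>L\<^esub>}. v a \<in> Sigma_set L v \<sigma>} \<union> {\<zero>\<^bsub>L\<^esub>}"

text \<open>\<open>H\<close> is a strongly convex subgroup witnessing independent defect; it is unique if it exists.\<close>

definition indep_defect_witness ::
    "('a, 'm) ring_scheme \<Rightarrow> ('a \<Rightarrow> 'g::linordered_ab_group_add) \<Rightarrow> ('a \<Rightarrow> 'a) \<Rightarrow> 'g set \<Rightarrow> bool" where
  "indep_defect_witness L v \<sigma> H \<longleftrightarrow> strongly_convex (value_group L v (carrier L)) H \<and>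
     Sigma_set L v \<sigma> = {\<alpha> \<in> value_group L v (carrier L). \<forall>h\<in>H. \<alpha> > h}"

definition independent_defect ::
    "('a, 'm) ring_scheme \<Rightarrow> ('a \<Rightarrow> 'g::linordered_ab_group_add) \<Rightarrow> ('a \<Rightarrow> 'a) \<Rightarrow> bool" where
  "independent_defect L v \<sigma> \<longleftrightarrow> (\<exists>H. indep_defect_witness L v \<sigma> H)"

definition defect_subgroup ::
    "('a, 'm) ring_scheme \<Rightarrow> ('a \<Rightarrow> 'g::linordered_ab_group_add) \<Rightarrow> ('a \<Rightarrow> 'a) \<Rightarrow> 'g set" where
  "defect_subgroup L v \<sigma> = (THE H. indep_defect_witness L v \<sigma> H)"

definition coarsening ::
    "('a \<Rightarrow> 'g::linordered_ab_group_add) \<Rightarrow> 'g set \<Rightarrow> 'a \<Rightarrow> 'g set" where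
  "coarsening v H a = coset_of H (v a)"

definition coarse_value_group ::
    "('a, 'm) ring_scheme \<Rightarrow> ('a \<Rightarrow> 'g::linordered_ab_group_add) \<Rightarrow> 'g set \<Rightarrow> 'g set set" where
  "coarse_value_group L v H = coarsening v H ` (carrier L - {\<zero>\<^bsub>L\<^esub>})"

definition coarse_val_ring ::
    "('a, 'm) ring_scheme \<Rightarrow> ('a \<Rightarrow> 'g::linordered_ab_group_add) \<Rightarrow> 'g set \<Rightarrow> 'a set" where
  "coarse_val_ring L v H = {a \<in> carrier L. a = \<zero>\<^bsub>L\<^esub> \<or> coset_le H (coarsening v H a)}"

definition coarse_val_ideal ::
    "('a, 'm) ring_scheme \<Rightarrow> ('a \<Rightarrow> 'g::linordered_ab_group_add) \<Rightarrow> 'g set \<Rightarrow> 'a set" where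
  "coarse_val_ideal L v H = {a \<in> carrier L. a = \<zero>\<^bsub>L\<^esub> \<or> (\<forall>h\<in>H. v a > h)}"

text \<open>
  Usually written \<open>(vK)\<^sub>v\<^sub>p\<close>; the element \<open>[p] \<cdot> \<one>\<close> is nonzero in characteristic \<open>0\<close>.
\<close>

definition vp_subgroup ::
    "('a, 'm) ring_scheme \<Rightarrow> 'a set \<Rightarrow> ('a \<Rightarrow> 'g::linordered_ab_group_add) \<Rightarrow> nat \<Rightarrow> 'g set" where
  "vp_subgroup L K v p =
     (if ring_char (L\<lparr>carrier := K\<rparr>) = 0
      then \<Inter>{H. convex_subgroup (value_group L v K) H \<and> v ([p] \<cdot>\<^bsub>L\<^esub> \<one>\<^bsub>L\<^esub>) \<in> H}
      else value_group L v K)"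

end

theory Submission
  imports Defs
begin

text \<open>
  Let \<open>D = \<sigma> - id\<close>.  A defect extension of prime degree is immediate, \<open>\<sigma>\<close> preserves values, and its fixed
  field is \<open>K\<close>.  Hence \<open>\<Sigma>\<close> consists of the values \<open>v (D x)\<close> with \<open>x \<in> \<O>\<^sub>L - K\<close>, is closed upwards in \<open>vL = vK\<close>
  and has no least element.  A purely order theoretic argument shows that the defect is independent if
  and only if every \<open>\<alpha> \<in> \<Sigma>\<close> admits a \<open>\<beta> \<in> \<Sigma>\<close> with \<open>2 \<beta> \<le> \<alpha>\<close> (\<open>halving\<close>); each of the other
  assertions is compared with this condition.  For the ideal \<open>I\<close> it says \<open>I\<^sup>2 = I\<close>, which is equivalent to
  \<open>I\<^sup>p = I\<close>.

  The algebraic input is a system of Galois coordinates (\<open>galois_coordinates\<close>).  For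
  \<open>x \<in> \<O>\<^sub>L - K\<close> with \<open>v (D x) = \<beta>\<close> the product of the factors \<open>(\<sigma>\<^sup>k x - X) / (\<sigma>\<^sup>k x - x)\<close> with \<open>0 < k < p\<close> has
  coefficients \<open>a\<^sub>j\<close> of value at least \<open>-(p-1) \<beta>\<close>, and \<open>\<Sum> a\<^sub>j \<sigma>\<^sup>k (x\<^sup>j)\<close> is \<open>1\<close> for \<open>k = 0\<close> and \<open>0\<close> for
  \<open>0 < k < p\<close>; so \<open>z = \<Sum> a\<^sub>j Tr (x\<^sup>j z)\<close> for all \<open>z\<close>.  This has four consequences: the trace of
  multiplication by \<open>z\<close> is \<open>\<Sum> \<sigma>\<^sup>k z\<close>; there is a \<open>y\<close> with \<open>Tr y = 1\<close> and \<open>v y \<ge> -(p-1) \<beta>\<close>; every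
  \<open>b \<in> L - K\<close> is approximated by \<open>Tr (b y) \<in> K\<close> up to value \<open>v (D b) - (p-1) \<beta>\<close>; and every differential of
  \<open>\<O>\<^sub>L\<close> over \<open>\<O>\<^sub>K\<close> is annihilated by \<open>e\<^sup>2\<close> if \<open>e \<in> K\<close> has value \<open>(p-1) \<beta>\<close>.

  Under \<open>halving\<close> one may choose \<open>\<beta>\<close> with \<open>3 (p-1) \<beta> \<le> v (D b)\<close>.  Then \<open>b = c + e\<^sup>2 b'\<close> with \<open>c \<in> \<O>\<^sub>K\<close> and
  \<open>b' \<in> \<O>\<^sub>L\<close>, so that \<open>db = e\<^sup>2 db' = 0\<close> and \<open>\<Omega> = 0\<close>.  Conversely \<open>D\<close> induces an
  \<open>\<O>\<^sub>K\<close>-derivation \<open>\<O>\<^sub>L \<rightarrow> I / I\<^sup>2\<close> whose image generates \<open>I / I\<^sup>2\<close>.  If \<open>\<M>\<^sub>L\<close> annihilates \<open>\<Omega>\<close>, it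
  follows that \<open>I = \<M>\<^sub>L I \<subseteq> I\<^sup>2\<close>, where the first equality holds because \<open>\<Sigma>\<close> has no least element.

  For the trace, \<open>Tr z = p z + \<Sum> (\<sigma>\<^sup>k z - z)\<close> lies in \<open>I\<close> for \<open>z \<in> \<M>\<^sub>L\<close>, since \<open>p = 0\<close> or \<open>v p \<in> \<Sigma>\<close>; the latter
  comes from a Lagrange resolvent.  In the other direction \<open>c = Tr (c y)\<close> realises every \<open>c \<in> K\<close> of value greater
  than \<open>(p-1) \<beta>\<close>.  Comparing with the elements above a convex subgroup \<open>H\<close> gives the equivalence with
  the assertion on the trace, and \<open>H\<close> is determined by \<open>\<Sigma>\<close>.
\<close>

section \<open>Final segments of ordered abelian groups\<close>

text \<open>A multiple in the group itself; the group is merely ordered and carries no scalar multiplication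
  by natural numbers.\<close>

primrec nmul :: "nat \<Rightarrow> 'g::linordered_ab_group_add \<Rightarrow> 'g" where
  "nmul 0 \<alpha> = 0"
| "nmul (Suc n) \<alpha> = \<alpha> + nmul n \<alpha>"

lemma nmul_add: "nmul (m + n) \<alpha> = nmul m \<alpha> + nmul n \<alpha>"
  by (induction m) (auto simp: add.assoc)

lemma nmul_double: "nmul n (\<alpha> + \<alpha>) = nmul (2 * n) \<alpha>"
  by (induction n) (auto simp: algebra_simps)

lemma nmul_nonneg: "0 \<le> \<alpha> \<Longrightarrow> 0 \<le> nmul n \<alpha>"
  by (induction n) auto

lemma nmul_mono_right: "\<alpha> \<le> \<beta> \<Longrightarrow> nmul n \<alpha> \<le> nmul n \<beta>"
  by (induction n) (auto intro: add_mono)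

lemma nmul_mono_left: "0 \<le> \<alpha> \<Longrightarrow> m \<le> n \<Longrightarrow> nmul m \<alpha> \<le> nmul n \<alpha>"
  using nmul_nonneg[of \<alpha> "n - m"] nmul_add[of m "n - m" \<alpha>] by simp

lemma nmul_zero: "nmul n 0 = 0"
  by (induction n) auto

lemma nmul_strict_mono: "\<alpha> < \<beta> \<Longrightarrow> 0 < n \<Longrightarrow> nmul n \<alpha> < nmul n \<beta>"
proof (induction n)
  case (Suc n)
  show ?case using add_less_le_mono[OF Suc.prems(1) nmul_mono_right[of \<alpha> \<beta> n]] Suc.prems(1) by simp
qed simp

lemma convex_subgroupD:
  assumes "convex_subgroup \<Gamma> H"
  shows "H \<subseteq> \<Gamma>" "0 \<in> H" "x \<in> H \<Longrightarrow> y \<in> H \<Longrightarrow> x + y \<in> H" "x \<in> H \<Longrightarrow> - x \<in> H"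
    "x \<in> H \<Longrightarrow> y \<in> H \<Longrightarrow> x - y \<in> H"
    "x \<in> H \<Longrightarrow> y \<in> H \<Longrightarrow> g \<in> \<Gamma> \<Longrightarrow> x \<le> g \<Longrightarrow> g \<le> y \<Longrightarrow> g \<in> H"
proof -
  note H = assms[unfolded convex_subgroup_def]
  note H' = H[THEN conjunct2, THEN conjunct2]
  show "H \<subseteq> \<Gamma>" by (rule H[THEN conjunct1])
  show "0 \<in> H" by (rule H[THEN conjunct2, THEN conjunct1])
  show add: "x + y \<in> H" if "x \<in> H" "y \<in> H" for x y
    by (rule H'[THEN conjunct1, rule_format, OF that])
  show neg: "- x \<in> H" if "x \<in> H" for x
    by (rule H'[THEN conjunct2, THEN conjunct1, rule_format, OF that])
  show "g \<in> H" if "x \<in> H" "y \<in> H" "g \<in> \<Gamma>" "x \<le> g" "g \<le> y"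
    using H'[THEN conjunct2, THEN conjunct2, rule_format, OF that(1,2,3)] that(4,5) by blast
  show "x \<in> H \<Longrightarrow> y \<in> H \<Longrightarrow> x - y \<in> H"
    using add[OF _ neg, of x y] by simp
qed

lemma nmul_in_subgroup: "convex_subgroup \<Gamma> H \<Longrightarrow> \<alpha> \<in> H \<Longrightarrow> nmul n \<alpha> \<in> H"
  by (induction n) (auto intro: convex_subgroupD(2,3))

lemma coset_of_eq_subgroup_iff:
  assumes H: "convex_subgroup \<Gamma> H"
  shows "coset_of H \<alpha> = H \<longleftrightarrow> \<alpha> \<in> H"
proof
  assume "coset_of H \<alpha> = H"
  then show "\<alpha> \<in> H"
    using convex_subgroupD(2)[OF H] unfolding coset_of_def by force
next
  assume a: "\<alpha> \<in> H"
  show "coset_of H \<alpha> = H"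
    unfolding coset_of_def
  proof (intro Set.set_eqI iffI)
    fix x assume "x \<in> H"
    then show "x \<in> (+) \<alpha> ` H"
      using convex_subgroupD(5)[OF H, of x \<alpha>] a by (intro image_eqI[of _ _ "x - \<alpha>"]) auto
  qed (use convex_subgroupD(3)[OF H] a in auto)
qed

lemma coset_le_iff:
  assumes H: "convex_subgroup \<Gamma> H"
  shows "coset_le (coset_of H \<alpha>) (coset_of H \<beta>) \<longleftrightarrow> (\<exists>h\<in>H. \<alpha> \<le> \<beta> + h)"
proof
  assume "coset_le (coset_of H \<alpha>) (coset_of H \<beta>)"
  then obtain h h' where h: "h \<in> H" "h' \<in> H" "\<alpha> + h \<le> \<beta> + h'"
    unfolding coset_le_def coset_of_def by auto
  then have "\<alpha> \<le> \<beta> + (h' - h)" by (simp add: algebra_simps)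
  then show "\<exists>h\<in>H. \<alpha> \<le> \<beta> + h" using convex_subgroupD(5)[OF H h(2,1)] by blast
next
  assume "\<exists>h\<in>H. \<alpha> \<le> \<beta> + h"
  then show "coset_le (coset_of H \<alpha>) (coset_of H \<beta>)"
    unfolding coset_le_def coset_of_def using convex_subgroupD(2)[OF H] by force
qed

lemma coset_le_subgroup_iff:
  assumes H: "convex_subgroup \<Gamma> H"
  shows "coset_le H (coset_of H \<beta>) \<longleftrightarrow> (\<exists>h\<in>H. h \<le> \<beta>)"
proof -
  have "coset_of H 0 = H" using coset_of_eq_subgroup_iff[OF H] convex_subgroupD(2)[OF H] by simp
  then have "coset_le H (coset_of H \<beta>) \<longleftrightarrow> (\<exists>h\<in>H. 0 \<le> \<beta> + h)"
    using coset_le_iff[OF H, of 0 \<beta>] by simp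
  also have "\<dots> \<longleftrightarrow> (\<exists>h\<in>H. h \<le> \<beta>)"
  proof
    assume "\<exists>h\<in>H. 0 \<le> \<beta> + h"
    then obtain h where "h \<in> H" "- h \<le> \<beta>" using add_right_mono[of 0 "\<beta> + h" "- h" for h] by force
    then show "\<exists>h\<in>H. h \<le> \<beta>" using convex_subgroupD(4)[OF H] by blast
  next
    assume "\<exists>h\<in>H. h \<le> \<beta>"
    then obtain h where "h \<in> H" "0 \<le> \<beta> + - h" by (auto simp: le_diff_eq)
    then show "\<exists>h\<in>H. 0 \<le> \<beta> + h" using convex_subgroupD(4)[OF H] by blast
  qed
  finally show ?thesis .
qed

lemma positive_coset_iff:
  assumes H: "convex_subgroup \<Gamma> H" and b: "\<beta> \<in> \<Gamma>"
  shows "coset_of H \<beta> \<noteq> H \<and> coset_le H (coset_of H \<beta>) \<longleftrightarrow> (\<forall>h\<in>H. h < \<beta>)"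
  unfolding coset_of_eq_subgroup_iff[OF H] coset_le_subgroup_iff[OF H]
proof
  assume a: "\<beta> \<notin> H \<and> (\<exists>h\<in>H. h \<le> \<beta>)"
  show "\<forall>h\<in>H. h < \<beta>"
  proof
    fix h assume h: "h \<in> H"
    show "h < \<beta>"
    proof (rule ccontr)
      assume "\<not> h < \<beta>"
      then show False using a h convex_subgroupD(6)[OF H _ h b] by force
    qed
  qed
next
  assume a: "\<forall>h\<in>H. h < \<beta>"
  then show "\<beta> \<notin> H \<and> (\<exists>h\<in>H. h \<le> \<beta>)"
    using convex_subgroupD(2)[OF H] by (auto intro: less_imp_le)
qed

lemma has_least_positive_iff:
  assumes H: "convex_subgroup \<Gamma> H"
  shows "has_least_positive (coset_group \<Gamma> H) H \<longleftrightarrow>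
    (\<exists>\<gamma>\<in>\<Gamma>. (\<forall>h\<in>H. h < \<gamma>) \<and> (\<forall>\<beta>\<in>\<Gamma>. (\<forall>h\<in>H. h < \<beta>) \<longrightarrow> (\<exists>h\<in>H. \<gamma> \<le> \<beta> + h)))"
proof -
  have "has_least_positive (coset_group \<Gamma> H) H \<longleftrightarrow>
    (\<exists>\<gamma>\<in>\<Gamma>. (coset_of H \<gamma> \<noteq> H \<and> coset_le H (coset_of H \<gamma>)) \<and>
      (\<forall>\<beta>\<in>\<Gamma>. coset_of H \<beta> \<noteq> H \<and> coset_le H (coset_of H \<beta>) \<longrightarrow> coset_le (coset_of H \<gamma>) (coset_of H \<beta>)))"
    unfolding has_least_positive_def coset_group_def by auto
  also have "\<dots> \<longleftrightarrow> (\<exists>\<gamma>\<in>\<Gamma>. (\<forall>h\<in>H. h < \<gamma>) \<and> (\<forall>\<beta>\<in>\<Gamma>. (\<forall>h\<in>H. h < \<beta>) \<longrightarrow> (\<exists>h\<in>H. \<gamma> \<le> \<beta> + h)))"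
    using positive_coset_iff[OF H] coset_le_iff[OF H] by simp
  finally show ?thesis .
qed

text \<open>For a final segment \<open>S\<close> of positive elements this is independence of the defect without
  reference to a convex subgroup.\<close>

definition halving :: "'g::linordered_ab_group_add set \<Rightarrow> bool" where
  "halving S \<longleftrightarrow> (\<forall>\<alpha>\<in>S. \<exists>\<beta>\<in>S. \<beta> + \<beta> \<le> \<alpha>)"

lemma halving_nmul:
  assumes "halving S" and pos: "\<And>\<alpha>. \<alpha> \<in> S \<Longrightarrow> 0 < \<alpha>" and "\<alpha> \<in> S"
  shows "\<exists>\<beta>\<in>S. nmul n \<beta> \<le> \<alpha>"
proof -
  have "\<exists>\<beta>\<in>S. nmul (2 ^ k) \<beta> \<le> \<alpha>" for k
  proof (induction k)
    case 0
    then show ?case using assms(3) by auto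
  next
    case (Suc k)
    then obtain \<beta> where b: "\<beta> \<in> S" "nmul (2 ^ k) \<beta> \<le> \<alpha>" by blast
    then obtain \<gamma> where g: "\<gamma> \<in> S" "\<gamma> + \<gamma> \<le> \<beta>" using assms(1) unfolding halving_def by blast
    have "nmul (2 ^ Suc k) \<gamma> \<le> nmul (2 ^ k) \<beta>"
      using nmul_mono_right[OF g(2), of "2 ^ k"] unfolding nmul_double by simp
    then show ?case using g b by force
  qed
  then obtain \<beta> where b: "\<beta> \<in> S" "nmul (2 ^ n) \<beta> \<le> \<alpha>" by blast
  have "nmul n \<beta> \<le> nmul (2 ^ n) \<beta>"
    using pos[OF b(1)] by (intro nmul_mono_left) (auto intro: less_imp_le)
  then show ?thesis using b by force
qed

text \<open>If \<open>S\<close> can be halved, the elements of absolute value below all of \<open>S\<close> are closed under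
  addition and form the subgroup \<open>H\<close>.  Conversely, a least element of \<open>S\<close> modulo \<open>H\<close> is the only
  obstruction to halving.  As \<open>\<Gamma>\<close> may be a proper subset of its type, that it is a subgroup is
  expressed by its being convex in itself.\<close>

lemma halving_iff_strongly_convex:
  assumes G: "convex_subgroup \<Gamma> \<Gamma>" and sub: "S \<subseteq> \<Gamma>" and ne: "S \<noteq> {}"
    and pos: "\<And>\<alpha>. \<alpha> \<in> S \<Longrightarrow> 0 < \<alpha>"
    and up: "\<And>\<alpha> \<beta>. \<alpha> \<in> S \<Longrightarrow> \<beta> \<in> \<Gamma> \<Longrightarrow> \<alpha> \<le> \<beta> \<Longrightarrow> \<beta> \<in> S"
  shows "halving S \<longleftrightarrow> (\<exists>H. strongly_convex \<Gamma> H \<and> S = {\<alpha> \<in> \<Gamma>. \<forall>h\<in>H. \<alpha> > h})"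
proof
  assume half: "halving S"
  define H where "H = {h \<in> \<Gamma>. \<forall>\<alpha>\<in>S. h < \<alpha> \<and> - h < \<alpha>}"
  have sum: "x + y < \<alpha>" if "\<And>\<alpha>. \<alpha> \<in> S \<Longrightarrow> x < \<alpha>" "\<And>\<alpha>. \<alpha> \<in> S \<Longrightarrow> y < \<alpha>" "\<alpha> \<in> S" for x y \<alpha>
  proof -
    obtain \<beta> where "\<beta> \<in> S" "\<beta> + \<beta> \<le> \<alpha>" using half \<open>\<alpha> \<in> S\<close> unfolding halving_def by blast
    then show ?thesis using add_strict_mono[OF that(1) that(2), of \<beta> \<beta>] by force
  qed
  have H: "convex_subgroup \<Gamma> H"
    unfolding convex_subgroup_def
  proof (intro conjI ballI impI)
    show "H \<subseteq> \<Gamma>" unfolding H_def by blast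
    show "0 \<in> H" unfolding H_def using convex_subgroupD(2)[OF G] pos by auto
  next
    fix x y assume x: "x \<in> H" and y: "y \<in> H"
    have "x + y < \<alpha>" if "\<alpha> \<in> S" for \<alpha>
      using sum[of x y] x y that unfolding H_def by blast
    moreover have "- x + - y < \<alpha>" if "\<alpha> \<in> S" for \<alpha>
      using sum[of "- x" "- y"] x y that unfolding H_def by blast
    moreover have "x + y \<in> \<Gamma>"
      using convex_subgroupD(3)[OF G] x y unfolding H_def by blast
    ultimately show "x + y \<in> H"
      unfolding H_def by simp
  next
    fix x assume "x \<in> H"
    then show "- x \<in> H" unfolding H_def using convex_subgroupD(4)[OF G, of x] by simp
  next
    fix x y g assume a: "x \<in> H" "y \<in> H" "g \<in> \<Gamma>" "x \<le> g \<and> g \<le> y"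
    have "g < \<alpha> \<and> - g < \<alpha>" if "\<alpha> \<in> S" for \<alpha>
    proof -
      have "y < \<alpha>" "- x < \<alpha>" using a(1,2) that unfolding H_def by blast+
      moreover have "- g \<le> - x" using a(4) by simp
      ultimately show ?thesis using a(4) by (meson order.strict_trans1)
    qed
    then show "g \<in> H" unfolding H_def using a(3) by blast
  qed
  have S: "S = {\<alpha> \<in> \<Gamma>. \<forall>h\<in>H. \<alpha> > h}"
  proof (intro Set.set_eqI iffI)
    fix \<alpha> assume "\<alpha> \<in> {\<alpha> \<in> \<Gamma>. \<forall>h\<in>H. \<alpha> > h}"
    then have a: "\<alpha> \<in> \<Gamma>" "\<alpha> \<notin> H" "0 < \<alpha>" using convex_subgroupD(2)[OF H] by auto
    show "\<alpha> \<in> S"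
    proof (rule ccontr)
      assume "\<alpha> \<notin> S"
      then have "\<alpha> < \<beta>" if "\<beta> \<in> S" for \<beta> using up[OF that a(1)] by force
      moreover have "- \<alpha> < \<beta>" if "\<beta> \<in> S" for \<beta>
        using order.strict_trans[OF _ pos[OF that], of "- \<alpha>"] a(3) by simp
      ultimately show False using a(1,2) unfolding H_def by blast
    qed
  qed (use sub in \<open>auto simp: H_def\<close>)
  have "\<not> has_least_positive (coset_group \<Gamma> H) H"
  proof
    assume "has_least_positive (coset_group \<Gamma> H) H"
    then obtain \<gamma> where g: "\<gamma> \<in> S" "\<And>\<beta>. \<beta> \<in> S \<Longrightarrow> \<exists>h\<in>H. \<gamma> \<le> \<beta> + h"
      unfolding has_least_positive_iff[OF H] S by blast
    obtain \<beta> where b: "\<beta> \<in> S" "\<beta> + \<beta> \<le> \<gamma>" using half g(1) unfolding halving_def by blast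
    obtain h where h: "h \<in> H" "\<gamma> \<le> \<beta> + h" using g(2)[OF b(1)] by blast
    then have "\<beta> \<le> h" using order_trans[OF b(2) h(2)] by simp
    then show False using h(1) b(1) unfolding S by force
  qed
  moreover have "H \<noteq> \<Gamma>" using S ne sub by auto
  ultimately show "\<exists>H. strongly_convex \<Gamma> H \<and> S = {\<alpha> \<in> \<Gamma>. \<forall>h\<in>H. \<alpha> > h}"
    using H S unfolding strongly_convex_def by blast
next
  assume "\<exists>H. strongly_convex \<Gamma> H \<and> S = {\<alpha> \<in> \<Gamma>. \<forall>h\<in>H. \<alpha> > h}"
  then obtain H where H: "convex_subgroup \<Gamma> H" "\<not> has_least_positive (coset_group \<Gamma> H) H"
    and S: "S = {\<alpha> \<in> \<Gamma>. \<forall>h\<in>H. \<alpha> > h}" unfolding strongly_convex_def by blast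
  show "halving S"
    unfolding halving_def
  proof
    fix \<alpha> assume a: "\<alpha> \<in> S"
    \<comment> \<open>As \<open>\<alpha> + H\<close> is not least positive, \<open>\<alpha> = \<beta> + (\<alpha> - \<beta>)\<close> with both summands above \<open>H\<close>.\<close>
    then obtain \<beta> where b: "\<beta> \<in> S" "\<And>h. h \<in> H \<Longrightarrow> \<beta> + h < \<alpha>"
      using H(2) unfolding has_least_positive_iff[OF H(1)] S by (auto simp: not_le)
    then have "\<alpha> - \<beta> \<in> S"
      using convex_subgroupD(5)[OF G, of \<alpha> \<beta>] a unfolding S by (auto simp: less_diff_eq add.commute)
    moreover have "\<alpha> - \<beta> + (\<alpha> - \<beta>) \<le> \<alpha>" if "\<alpha> - \<beta> \<le> \<beta>"
      using add_left_mono[OF that, of "\<alpha> - \<beta>"] by simp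
    moreover have "\<beta> + \<beta> \<le> \<alpha>" if "\<beta> \<le> \<alpha> - \<beta>"
      using add_left_mono[OF that, of \<beta>] by simp
    ultimately show "\<exists>\<beta>\<in>S. \<beta> + \<beta> \<le> \<alpha>"
      using b(1) linear[of \<beta> "\<alpha> - \<beta>"] by blast
  qed
qed

lemma convex_subgroup_eqI:
  assumes H: "convex_subgroup \<Gamma> H" and H': "convex_subgroup \<Gamma> H'"
    and eq: "{\<alpha> \<in> \<Gamma>. \<forall>h\<in>H. \<alpha> > h} = {\<alpha> \<in> \<Gamma>. \<forall>h\<in>H'. \<alpha> > h}"
  shows "H = H'"
proof -
  have "H \<subseteq> H'" if H: "convex_subgroup \<Gamma> H" and H': "convex_subgroup \<Gamma> H'"
    and eq: "{\<alpha> \<in> \<Gamma>. \<forall>h\<in>H. \<alpha> > h} = {\<alpha> \<in> \<Gamma>. \<forall>h\<in>H'. \<alpha> > h}" for H H'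
  proof
    have nonneg: "k \<in> H'" if k: "k \<in> H" "0 \<le> k" for k
    proof -
      have "k \<in> \<Gamma>" "\<not> (\<forall>h\<in>H. k > h)" using convex_subgroupD(1)[OF H] k(1) by auto
      then obtain h' where h': "h' \<in> H'" "\<not> h' < k" using eq by blast
      show ?thesis
        using convex_subgroupD(6)[OF H' convex_subgroupD(2)[OF H'] h'(1) \<open>k \<in> \<Gamma>\<close> k(2)] h'(2) by simp
    qed
    fix h assume h: "h \<in> H"
    show "h \<in> H'"
    proof (cases "0 \<le> h")
      case False
      then have "- h \<in> H'" using nonneg[of "- h"] convex_subgroupD(4)[OF H h] by simp
      then show ?thesis using convex_subgroupD(4)[OF H', of "- h"] by simp
    qed (use nonneg h in blast)
  qed
  then show ?thesis using assms by blast
qed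

lemma strongly_convexD: "strongly_convex \<Gamma> H \<Longrightarrow> convex_subgroup \<Gamma> H"
  unfolding strongly_convex_def by blast

lemma convex_subgroup_Inter:
  assumes "\<And>H. H \<in> \<C> \<Longrightarrow> convex_subgroup \<Gamma> H" and "\<C> \<noteq> {}"
  shows "convex_subgroup \<Gamma> (\<Inter>\<C>)"
  unfolding convex_subgroup_def
proof (intro conjI ballI impI)
  obtain H where "H \<in> \<C>" using assms(2) by blast
  then show "\<Inter>\<C> \<subseteq> \<Gamma>" using convex_subgroupD(1)[OF assms(1)] by blast
  show "0 \<in> \<Inter>\<C>" using convex_subgroupD(2)[OF assms(1)] by blast
  fix x assume x: "x \<in> \<Inter>\<C>"
  show "- x \<in> \<Inter>\<C>" using convex_subgroupD(4)[OF assms(1)] x by blast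
  fix y assume y: "y \<in> \<Inter>\<C>"
  show "x + y \<in> \<Inter>\<C>" using convex_subgroupD(3)[OF assms(1)] x y by blast
  fix g assume g: "g \<in> \<Gamma>" "x \<le> g \<and> g \<le> y"
  show "g \<in> \<Inter>\<C>"
  proof
    fix H assume H: "H \<in> \<C>"
    show "g \<in> H" using convex_subgroupD(6)[OF assms(1)[OF H] _ _ g(1)] g(2) x y H by blast
  qed
qed

lemma archimedean_multiple:
  assumes "archimedean_group H" and H: "convex_subgroup \<Gamma> H" and "\<alpha> \<in> H" "0 < \<alpha>" "\<gamma> \<in> H"
  shows "\<exists>n. \<gamma> \<le> nmul n \<alpha>"
proof -
  obtain \<phi> :: "'a \<Rightarrow> real" where add: "\<And>x y. x \<in> H \<Longrightarrow> y \<in> H \<Longrightarrow> \<phi> (x + y) = \<phi> x + \<phi> y"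
    and mono: "strict_mono_on H \<phi>"
    using assms(1) unfolding archimedean_group_def by blast
  have zero: "0 \<in> H" using convex_subgroupD(2)[OF H] .
  have phi0: "\<phi> 0 = 0" using add[OF zero zero] by simp
  have phin: "\<phi> (nmul n \<alpha>) = real n * \<phi> \<alpha>" for n
    using assms(3) by (induction n) (auto simp: phi0 add nmul_in_subgroup[OF H] algebra_simps)
  have "0 < \<phi> \<alpha>" using strict_mono_onD[OF mono zero assms(3,4)] phi0 by simp
  then obtain n where "\<phi> \<gamma> < real n * \<phi> \<alpha>" using reals_Archimedean3 by blast
  then have "\<gamma> \<le> nmul n \<alpha>"
    using strict_mono_onD[OF mono nmul_in_subgroup[OF H assms(3), of n] assms(5)] phin[of n] by force
  then show ?thesis ..
qed

section \<open>The module of differentials\<close>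

lemma quotient_module_simps:
  "carrier (quotient_module M N) = a_rcosets\<^bsub>M\<^esub> N"
  "\<zero>\<^bsub>quotient_module M N\<^esub> = N"
  "C \<oplus>\<^bsub>quotient_module M N\<^esub> D = C <+>\<^bsub>M\<^esub> D"
  "r \<odot>\<^bsub>quotient_module M N\<^esub> C = (\<Union>x\<in>C. N +>\<^bsub>M\<^esub> (r \<odot>\<^bsub>M\<^esub> x))"
  by (simp_all add: quotient_module_def)

lemma (in module) abelian_subgroup_submodule:
  assumes "submodule N R M"
  shows "abelian_subgroup N M"
  using assms M.abelian_group_axioms
  by (intro abelian_subgroupI3 additive_subgroupI) (auto simp: submodule_def)

lemma (in module) quotient_smult:
  assumes N: "submodule N R M" and r: "r \<in> carrier R" and x: "x \<in> carrier M"
  shows "r \<odot>\<^bsub>quotient_module M N\<^esub> (N +>\<^bsub>M\<^esub> x) = N +>\<^bsub>M\<^esub> (r \<odot>\<^bsub>M\<^esub> x)"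
proof -
  interpret N: abelian_subgroup N M using abelian_subgroup_submodule[OF N] .
  have "N +>\<^bsub>M\<^esub> (r \<odot>\<^bsub>M\<^esub> y) = N +>\<^bsub>M\<^esub> (r \<odot>\<^bsub>M\<^esub> x)" if y: "y \<in> N +>\<^bsub>M\<^esub> x" for y
  proof -
    obtain h where h: "h \<in> N" "y = h \<oplus>\<^bsub>M\<^esub> x"
      using y unfolding a_r_coset_def' by auto
    have hM: "h \<in> carrier M" using h(1) submoduleE(1)[OF N] by blast
    have rh: "r \<odot>\<^bsub>M\<^esub> h \<in> N" using submoduleE(4)[OF N r h(1)] .
    have "r \<odot>\<^bsub>M\<^esub> y = r \<odot>\<^bsub>M\<^esub> h \<oplus>\<^bsub>M\<^esub> r \<odot>\<^bsub>M\<^esub> x"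
      unfolding h(2) using r hM x by (rule smult_r_distr)
    then have "r \<odot>\<^bsub>M\<^esub> y \<in> N +>\<^bsub>M\<^esub> (r \<odot>\<^bsub>M\<^esub> x)"
      using rh unfolding a_r_coset_def' by auto
    then show ?thesis using N.a_repr_independence' r x by simp
  qed
  moreover have "x \<in> N +>\<^bsub>M\<^esub> x" using N.a_rcos_self[OF x] .
  ultimately show ?thesis unfolding quotient_module_simps by blast
qed

lemma (in module) quotient_add:
  assumes N: "submodule N R M" and "x \<in> carrier M" "y \<in> carrier M"
  shows "(N +>\<^bsub>M\<^esub> x) \<oplus>\<^bsub>quotient_module M N\<^esub> (N +>\<^bsub>M\<^esub> y) = N +>\<^bsub>M\<^esub> (x \<oplus>\<^bsub>M\<^esub> y)"
  using abelian_subgroup.a_rcos_sum[OF abelian_subgroup_submodule[OF N] assms(2,3)]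
  by (simp add: quotient_module_simps)

lemma (in module) quotient_carrierE:
  assumes "C \<in> carrier (quotient_module M N)"
  obtains x where "x \<in> carrier M" "C = N +>\<^bsub>M\<^esub> x"
  using assms unfolding quotient_module_simps A_RCOSETS_def' by auto

lemma (in module) quotient_eq_zero_iff:
  assumes N: "submodule N R M" and x: "x \<in> carrier M"
  shows "N +>\<^bsub>M\<^esub> x = N \<longleftrightarrow> x \<in> N"
proof -
  interpret N: abelian_subgroup N M using abelian_subgroup_submodule[OF N] .
  show ?thesis using N.a_rcos_self[OF x] N.a_rcos_const[of x] by blast
qed

lemma (in module) quotient_module_is_module:
  assumes N: "submodule N R M"
  shows "module R (quotient_module M N)"
proof -
  interpret N: abelian_subgroup N M using abelian_subgroup_submodule[OF N] .
  let ?Q = "quotient_module M N"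
  have cl: "N +>\<^bsub>M\<^esub> x \<in> carrier ?Q" if "x \<in> carrier M" for x
    using M.a_rcosetsI[OF N.a_subset that] by (simp add: quotient_module_simps)
  have zero: "\<zero>\<^bsub>?Q\<^esub> = N +>\<^bsub>M\<^esub> \<zero>\<^bsub>M\<^esub>"
    using quotient_eq_zero_iff[OF N, of "\<zero>\<^bsub>M\<^esub>"] by (simp add: quotient_module_simps)
  note simps = quotient_smult[OF N] quotient_add[OF N] cl
  have ab: "abelian_group ?Q"
  proof (rule abelian_groupI)
    fix C assume "C \<in> carrier ?Q"
    then obtain x where x: "x \<in> carrier M" "C = N +>\<^bsub>M\<^esub> x" by (rule quotient_carrierE)
    then have "(N +>\<^bsub>M\<^esub> \<ominus>\<^bsub>M\<^esub> x) \<oplus>\<^bsub>?Q\<^esub> C = \<zero>\<^bsub>?Q\<^esub>" by (simp add: simps zero M.l_neg)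
    then show "\<exists>D\<in>carrier ?Q. D \<oplus>\<^bsub>?Q\<^esub> C = \<zero>\<^bsub>?Q\<^esub>" using cl[of "\<ominus>\<^bsub>M\<^esub> x"] x(1) by blast
  qed (auto simp: zero simps M.a_ac elim!: quotient_carrierE)
  show ?thesis
  proof (rule moduleI)
    fix a C assume "a \<in> carrier R" "C \<in> carrier ?Q"
    then show "a \<odot>\<^bsub>?Q\<^esub> C \<in> carrier ?Q"
      by (elim quotient_carrierE) (simp add: simps)
  next
    fix a b C assume "a \<in> carrier R" "b \<in> carrier R" "C \<in> carrier ?Q"
    then show "(a \<oplus> b) \<odot>\<^bsub>?Q\<^esub> C = a \<odot>\<^bsub>?Q\<^esub> C \<oplus>\<^bsub>?Q\<^esub> b \<odot>\<^bsub>?Q\<^esub> C"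
      by (elim quotient_carrierE) (simp add: simps smult_l_distr)
  next
    fix a C D assume "a \<in> carrier R" "C \<in> carrier ?Q" "D \<in> carrier ?Q"
    then show "a \<odot>\<^bsub>?Q\<^esub> (C \<oplus>\<^bsub>?Q\<^esub> D) = a \<odot>\<^bsub>?Q\<^esub> C \<oplus>\<^bsub>?Q\<^esub> a \<odot>\<^bsub>?Q\<^esub> D"
      by (elim quotient_carrierE) (simp add: simps smult_r_distr)
  next
    fix a b C assume "a \<in> carrier R" "b \<in> carrier R" "C \<in> carrier ?Q"
    then show "(a \<otimes> b) \<odot>\<^bsub>?Q\<^esub> C = a \<odot>\<^bsub>?Q\<^esub> (b \<odot>\<^bsub>?Q\<^esub> C)"
      by (elim quotient_carrierE) (simp add: simps smult_assoc1)
  next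
    fix C assume "C \<in> carrier ?Q"
    then show "\<one> \<odot>\<^bsub>?Q\<^esub> C = C"
      by (elim quotient_carrierE) (simp add: simps)
  qed (use ab R.cring_axioms in auto)
qed

lemma (in module) submodule_generated_is_submodule:
  assumes "S \<subseteq> carrier M"
  shows "submodule (submodule_generated R M S) R M"
proof (rule submoduleI)
  show "submodule_generated R M S \<subseteq> carrier M"
    unfolding submodule_generated_def using carrier_is_submodule assms by blast
  show "\<zero>\<^bsub>M\<^esub> \<in> submodule_generated R M S"
    unfolding submodule_generated_def
    by (auto simp: submodule_def dest: subgroup.one_closed)
qed (auto simp: submodule_generated_def submoduleE)

lemma submodule_generated_incl: "S \<subseteq> submodule_generated R M S"
  unfolding submodule_generated_def by blast

lemma submodule_generated_least:
  "submodule N R M \<Longrightarrow> S \<subseteq> N \<Longrightarrow> submodule_generated R M S \<subseteq> N"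
  unfolding submodule_generated_def by blast

context cring
begin

text \<open>\<open>F\<close> is the free module on the symbols \<open>d b\<close>, and \<open>N A\<close> its submodule of relations of a derivation
  over \<open>A\<close>; the module of differentials is \<open>F / N A\<close>.\<close>

abbreviation F where "F \<equiv> free_on_self R"

lemma free_simps:
  "\<zero>\<^bsub>F\<^esub> = (\<lambda>b\<in>carrier R. \<zero>)"
  "f \<oplus>\<^bsub>F\<^esub> g = (\<lambda>b\<in>carrier R. f b \<oplus> g b)"
  "c \<odot>\<^bsub>F\<^esub> f = (\<lambda>b\<in>carrier R. c \<otimes> f b)"
  by (simp_all add: free_on_self_def)

lemma free_carrier_iff:
  "f \<in> carrier F \<longleftrightarrow> f \<in> extensional (carrier R) \<and> (\<forall>b\<in>carrier R. f b \<in> carrier R) \<and>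
    finite {b \<in> carrier R. f b \<noteq> \<zero>}"
  by (auto simp: free_on_self_def PiE_def)

lemma free_on_self_is_module: "module R F"
proof (rule moduleI)
  have add_closed: "f \<oplus>\<^bsub>F\<^esub> g \<in> carrier F" if f: "f \<in> carrier F" and g: "g \<in> carrier F" for f g
  proof -
    have "{b \<in> carrier R. f b \<oplus> g b \<noteq> \<zero>} \<subseteq> {b \<in> carrier R. f b \<noteq> \<zero>} \<union> {b \<in> carrier R. g b \<noteq> \<zero>}"
      by auto
    then have "finite {b \<in> carrier R. f b \<oplus> g b \<noteq> \<zero>}"
      using f g by (auto simp: free_carrier_iff intro: finite_subset)
    moreover have "{b \<in> carrier R. (f \<oplus>\<^bsub>F\<^esub> g) b \<noteq> \<zero>} = {b \<in> carrier R. f b \<oplus> g b \<noteq> \<zero>}"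
      by (auto simp: free_simps)
    ultimately show ?thesis
      using f g by (simp add: free_carrier_iff) (auto simp: free_simps)
  qed
  have smult_closed: "c \<odot>\<^bsub>F\<^esub> f \<in> carrier F" if c: "c \<in> carrier R" and f: "f \<in> carrier F" for c f
  proof -
    have "{b \<in> carrier R. c \<otimes> f b \<noteq> \<zero>} \<subseteq> {b \<in> carrier R. f b \<noteq> \<zero>}"
      using c by auto
    then have "finite {b \<in> carrier R. c \<otimes> f b \<noteq> \<zero>}"
      using f by (auto simp: free_carrier_iff intro: finite_subset)
    moreover have "{b \<in> carrier R. (c \<odot>\<^bsub>F\<^esub> f) b \<noteq> \<zero>} = {b \<in> carrier R. c \<otimes> f b \<noteq> \<zero>}"
      by (auto simp: free_simps)
    ultimately show ?thesis
      using f c by (simp add: free_carrier_iff) (auto simp: free_simps)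
  qed
  show "abelian_group F"
  proof (rule abelian_groupI)
    fix f assume f: "f \<in> carrier F"
    have neg: "(\<ominus> \<one>) \<odot>\<^bsub>F\<^esub> f \<in> carrier F" using smult_closed f by simp
    have "(\<ominus> \<one>) \<odot>\<^bsub>F\<^esub> f \<oplus>\<^bsub>F\<^esub> f = \<zero>\<^bsub>F\<^esub>"
      using f by (auto simp: free_simps free_carrier_iff l_minus l_neg intro!: restrict_ext)
    then show "\<exists>g\<in>carrier F. g \<oplus>\<^bsub>F\<^esub> f = \<zero>\<^bsub>F\<^esub>" using neg by blast
    show "\<zero>\<^bsub>F\<^esub> \<oplus>\<^bsub>F\<^esub> f = f"
      using f by (intro extensionalityI[of _ "carrier R"]) (auto simp: free_simps free_carrier_iff)
  qed (use add_closed in \<open>auto simp: free_simps free_carrier_iff a_assoc intro!: restrict_ext a_comm\<close>)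
  fix f assume f: "f \<in> carrier F"
  show "\<one> \<odot>\<^bsub>F\<^esub> f = f"
    using f by (intro extensionalityI[of _ "carrier R"]) (auto simp: free_simps free_carrier_iff)
qed (auto simp: free_simps free_carrier_iff l_distr r_distr m_assoc is_cring intro!: restrict_ext
   elim: rev_finite_subset)


abbreviation N where "N A \<equiv> submodule_generated R F (kaehler_relations R A)"

definition differential :: "'a set \<Rightarrow> 'a \<Rightarrow> ('a \<Rightarrow> 'a) set" where
  "differential A b = N A +>\<^bsub>F\<^esub> diff_symbol R b"

lemma diff_symbol_closed: "diff_symbol R b \<in> carrier F"
proof -
  have "{x \<in> carrier R. diff_symbol R b x \<noteq> \<zero>} \<subseteq> {b}" by (auto simp: diff_symbol_def)
  then show ?thesis
    by (auto simp: free_carrier_iff diff_symbol_def elim: finite_subset)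
qed

lemma kaehler_relations_subset: "A \<subseteq> carrier R \<Longrightarrow> kaehler_relations R A \<subseteq> carrier F"
proof -
  interpret F: module R F by (rule free_on_self_is_module)
  show ?thesis
    by (auto simp: kaehler_relations_def Let_def diff_symbol_closed intro!: F.M.minus_closed F.smult_closed)
qed

lemma relations_submodule: "A \<subseteq> carrier R \<Longrightarrow> submodule (N A) R F"
  using module.submodule_generated_is_submodule[OF free_on_self_is_module kaehler_relations_subset] .

lemma kaehler_eq: "kaehler R A = quotient_module F (N A)"
  by (simp add: kaehler_def)

lemma kaehler_is_module: "A \<subseteq> carrier R \<Longrightarrow> module R (kaehler R A)"
  unfolding kaehler_eq
  by (rule module.quotient_module_is_module[OF free_on_self_is_module relations_submodule])

lemma coset_eqI:
  assumes A: "A \<subseteq> carrier R" and "f \<in> carrier F" "g \<in> carrier F" "f \<ominus>\<^bsub>F\<^esub> g \<in> kaehler_relations R A"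
  shows "N A +>\<^bsub>F\<^esub> f = N A +>\<^bsub>F\<^esub> g"
proof -
  interpret F: module R F by (rule free_on_self_is_module)
  interpret N: abelian_subgroup "N A" F using F.abelian_subgroup_submodule[OF relations_submodule[OF A]] .
  have "f \<ominus>\<^bsub>F\<^esub> g \<in> N A" by (rule subsetD[OF submodule_generated_incl assms(4)])
  then have "f \<in> N A +>\<^bsub>F\<^esub> g" 
    using N.a_rcos_module[OF assms(3,2)] by (simp add: a_minus_def)
  then show ?thesis by (rule N.a_repr_independence'[OF _ assms(3), symmetric])
qed

lemma differential_closed: "A \<subseteq> carrier R \<Longrightarrow> differential A b \<in> carrier (kaehler R A)"
proof -
  assume A: "A \<subseteq> carrier R"
  interpret F: module R F by (rule free_on_self_is_module)
  interpret N: abelian_subgroup "N A" F using F.abelian_subgroup_submodule[OF relations_submodule[OF A]] .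
  show ?thesis
    unfolding kaehler_eq differential_def quotient_module_simps
    by (rule F.M.a_rcosetsI[OF N.a_subset diff_symbol_closed])
qed

lemma
  assumes A: "A \<subseteq> carrier R"
  shows differential_add: "b \<in> carrier R \<Longrightarrow> c \<in> carrier R \<Longrightarrow>
      differential A (b \<oplus> c) = differential A b \<oplus>\<^bsub>kaehler R A\<^esub> differential A c"
    and differential_mult: "b \<in> carrier R \<Longrightarrow> c \<in> carrier R \<Longrightarrow>
      differential A (b \<otimes> c) =
        b \<odot>\<^bsub>kaehler R A\<^esub> differential A c \<oplus>\<^bsub>kaehler R A\<^esub> c \<odot>\<^bsub>kaehler R A\<^esub> differential A b"
    and differential_base: "b \<in> A \<Longrightarrow> differential A b = \<zero>\<^bsub>kaehler R A\<^esub>"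
proof -
  interpret F: module R F by (rule free_on_self_is_module)
  note simps = F.quotient_add[OF relations_submodule[OF A]] F.quotient_smult[OF relations_submodule[OF A]]
    diff_symbol_closed
  show "differential A (b \<oplus> c) = differential A b \<oplus>\<^bsub>kaehler R A\<^esub> differential A c"
    if "b \<in> carrier R" "c \<in> carrier R" for b c
    unfolding differential_def kaehler_eq using that
    by (simp add: simps, intro coset_eqI[OF A])
       (auto simp: diff_symbol_closed kaehler_relations_def Let_def)
  show "differential A (b \<otimes> c) =
        b \<odot>\<^bsub>kaehler R A\<^esub> differential A c \<oplus>\<^bsub>kaehler R A\<^esub> c \<odot>\<^bsub>kaehler R A\<^esub> differential A b"
    if "b \<in> carrier R" "c \<in> carrier R"
    unfolding differential_def kaehler_eq using that
    by (simp add: simps, intro coset_eqI[OF A])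
       (auto simp: diff_symbol_closed kaehler_relations_def Let_def)
  show "differential A b = \<zero>\<^bsub>kaehler R A\<^esub>" if "b \<in> A"
  proof -
    have "diff_symbol R b \<in> kaehler_relations R A"
      using that by (auto simp: kaehler_relations_def Let_def)
    then have "diff_symbol R b \<in> N A" by (rule subsetD[OF submodule_generated_incl])
    then show ?thesis
      unfolding differential_def kaehler_eq quotient_module_simps
      using F.quotient_eq_zero_iff[OF relations_submodule[OF A] diff_symbol_closed] by simp
  qed
qed

text \<open>As every element of the free module is a finite combination of the symbols, the module of
  differentials vanishes once all differentials do.\<close>

lemma kaehler_trivialI:
  assumes A: "A \<subseteq> carrier R"
    and zero: "\<And>b. b \<in> carrier R \<Longrightarrow> differential A b = \<zero>\<^bsub>kaehler R A\<^esub>"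
  shows "carrier (kaehler R A) = {\<zero>\<^bsub>kaehler R A\<^esub>}"
proof -
  interpret F: module R F by (rule free_on_self_is_module)
  have sub: "submodule (N A) R F" by (rule relations_submodule[OF A])
  have sym: "diff_symbol R b \<in> N A" if "b \<in> carrier R" for b
    using zero[OF that] F.quotient_eq_zero_iff[OF sub diff_symbol_closed]
    unfolding differential_def kaehler_eq quotient_module_simps by blast
  have "f \<in> N A" if "f \<in> carrier F" for f
    using that
  proof (induction "card {b \<in> carrier R. f b \<noteq> \<zero>}" arbitrary: f)
    case 0
    then have "f = \<zero>\<^bsub>F\<^esub>"
      by (intro extensionalityI[of _ "carrier R"]) (auto simp: free_carrier_iff free_simps)
    then show ?case using sub by (auto simp: submodule_def dest: subgroup.one_closed)
  next
    case (Suc n)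
    then obtain b where b: "b \<in> carrier R" "f b \<noteq> \<zero>"
      by (metis (mono_tags, lifting) Collect_empty_eq card.empty nat.distinct(1))
    have fb: "f b \<in> carrier R" using Suc.prems b(1) by (simp add: free_carrier_iff)
    define g where "g = f \<oplus>\<^bsub>F\<^esub> (\<ominus> f b) \<odot>\<^bsub>F\<^esub> diff_symbol R b"
    have g: "g \<in> carrier F" unfolding g_def using Suc.prems fb by (simp add: diff_symbol_closed)
    have gx: "g x = (if x = b then \<zero> else f x)" if "x \<in> carrier R" for x
      using Suc.prems that b(1) unfolding g_def
      by (simp add: free_simps diff_symbol_def free_carrier_iff r_neg)
    have "{x \<in> carrier R. g x \<noteq> \<zero>} = {x \<in> carrier R. f x \<noteq> \<zero>} - {b}"
      using gx by (auto split: if_splits)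
    then have "card {x \<in> carrier R. g x \<noteq> \<zero>} = n" using Suc.hyps(2) b by simp
    then have gN: "g \<in> N A" using Suc.hyps(1) g by blast
    have "f b \<odot>\<^bsub>F\<^esub> diff_symbol R b \<in> N A" using F.submoduleE(4)[OF sub fb sym[OF b(1)]] .
    then have "g \<oplus>\<^bsub>F\<^esub> f b \<odot>\<^bsub>F\<^esub> diff_symbol R b \<in> N A" by (rule F.submoduleE(5)[OF sub gN])
    also have "g \<oplus>\<^bsub>F\<^esub> f b \<odot>\<^bsub>F\<^esub> diff_symbol R b = f"
      unfolding g_def using Suc.prems fb diff_symbol_closed
      by (simp add: F.smult_l_minus F.M.a_assoc F.M.l_neg)
    finally show ?case .
  qed
  then have "N A = carrier F" using F.submoduleE(1)[OF sub] by blast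
  moreover have "C = N A" if "C \<in> carrier (kaehler R A)" for C
    using that calculation F.quotient_eq_zero_iff[OF sub] unfolding kaehler_eq
    by (elim F.quotient_carrierE) simp
  moreover have "N A \<in> carrier (kaehler R A)"
    using abelian_monoid.zero_closed[OF abelian_group.axioms(1)[OF module.axioms(2)[OF kaehler_is_module[OF A]]]]
    unfolding kaehler_eq quotient_module_simps .
  ultimately show ?thesis unfolding kaehler_eq quotient_module_simps by blast
qed


text \<open>A map that is a derivation modulo \<open>J\<close> extends to the free module by \<open>f \<mapsto> \<Sum> f(x) D x\<close>, and the
  preimage of \<open>J\<close> contains all relations.\<close>

lemma annihilates_derivation:
  assumes A: "A \<subseteq> carrier R" and J: "ideal J R" and D: "\<And>b. b \<in> carrier R \<Longrightarrow> D b \<in> carrier R"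
    and D_add: "\<And>b c. b \<in> carrier R \<Longrightarrow> c \<in> carrier R \<Longrightarrow> D (b \<oplus> c) \<ominus> (D b \<oplus> D c) \<in> J"
    and D_mult: "\<And>b c. b \<in> carrier R \<Longrightarrow> c \<in> carrier R \<Longrightarrow>
      D (b \<otimes> c) \<ominus> (b \<otimes> D c \<oplus> c \<otimes> D b) \<in> J"
    and D_base: "\<And>b. b \<in> A \<Longrightarrow> D b \<in> J"
    and a: "a \<in> carrier R" and b: "b \<in> carrier R"
    and zero: "a \<odot>\<^bsub>kaehler R A\<^esub> differential A b = \<zero>\<^bsub>kaehler R A\<^esub>"
  shows "a \<otimes> D b \<in> J"
proof -
  interpret F: module R F by (rule free_on_self_is_module)
  interpret J: ideal J R by fact
  have sub: "submodule (N A) R F" by (rule relations_submodule[OF A])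
  define ev where "ev f = (\<Oplus>x\<in>{x \<in> carrier R. f x \<noteq> \<zero>}. f x \<otimes> D x)" for f
  have ev: "ev f = (\<Oplus>x\<in>S. f x \<otimes> D x)"
    if "f \<in> carrier F" "finite S" "S \<subseteq> carrier R" "{x \<in> carrier R. f x \<noteq> \<zero>} \<subseteq> S" for f S
    unfolding ev_def
    using that D by (intro add.finprod_mono_neutral_cong_left) (auto simp: free_carrier_iff subset_iff)
  have ev_closed: "ev f \<in> carrier R" if "f \<in> carrier F" for f
    unfolding ev_def using that D by (intro finsum_closed) (auto simp: free_carrier_iff)
  have ev_add: "ev (f \<oplus>\<^bsub>F\<^esub> g) = ev f \<oplus> ev g" if f: "f \<in> carrier F" and g: "g \<in> carrier F" for f g
  proof -
    define S where "S = {x \<in> carrier R. f x \<noteq> \<zero>} \<union> {x \<in> carrier R. g x \<noteq> \<zero>}"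
    have S: "finite S" "S \<subseteq> carrier R" using f g by (auto simp: S_def free_carrier_iff)
    have fg: "f \<oplus>\<^bsub>F\<^esub> g \<in> carrier F" using f g by simp
    have "ev (f \<oplus>\<^bsub>F\<^esub> g) = (\<Oplus>x\<in>S. (f \<oplus>\<^bsub>F\<^esub> g) x \<otimes> D x)"
      using S by (intro ev fg) (auto simp: S_def free_simps)
    also have "\<dots> = (\<Oplus>x\<in>S. f x \<otimes> D x \<oplus> g x \<otimes> D x)"
      using f g S D by (intro finsum_cong') (auto simp: free_simps free_carrier_iff l_distr subset_iff)
    also have "\<dots> = (\<Oplus>x\<in>S. f x \<otimes> D x) \<oplus> (\<Oplus>x\<in>S. g x \<otimes> D x)"
      using f g S D by (intro finsum_addf) (auto simp: free_carrier_iff subset_iff)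
    also have "\<dots> = ev f \<oplus> ev g"
      using ev[OF f S] ev[OF g S] by (simp add: S_def)
    finally show ?thesis .
  qed
  have ev_smult: "ev (c \<odot>\<^bsub>F\<^esub> f) = c \<otimes> ev f" if c: "c \<in> carrier R" and f: "f \<in> carrier F" for c f
  proof -
    define S where "S = {x \<in> carrier R. f x \<noteq> \<zero>}"
    have S: "finite S" "S \<subseteq> carrier R" using f by (auto simp: S_def free_carrier_iff)
    have "ev (c \<odot>\<^bsub>F\<^esub> f) = (\<Oplus>x\<in>S. (c \<odot>\<^bsub>F\<^esub> f) x \<otimes> D x)"
      using S c by (intro ev F.smult_closed[OF c f]) (auto simp: S_def free_simps)
    also have "\<dots> = (\<Oplus>x\<in>S. c \<otimes> (f x \<otimes> D x))"
      using c f S D by (intro finsum_cong') (auto simp: free_simps free_carrier_iff m_assoc subset_iff)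
    also have "\<dots> = c \<otimes> (\<Oplus>x\<in>S. f x \<otimes> D x)"
      using c f S D by (intro finsum_rdistr[symmetric]) (auto simp: free_carrier_iff subset_iff)
    finally show ?thesis by (simp add: ev_def S_def)
  qed
  have ev_minus: "ev (f \<ominus>\<^bsub>F\<^esub> g) = ev f \<ominus> ev g" if f: "f \<in> carrier F" and g: "g \<in> carrier F" for f g
  proof -
    have "f \<ominus>\<^bsub>F\<^esub> g = f \<oplus>\<^bsub>F\<^esub> (\<ominus> \<one>) \<odot>\<^bsub>F\<^esub> g"
      using g by (simp only: F.smult_l_minus F.smult_one one_closed a_minus_def)
    then have "ev (f \<ominus>\<^bsub>F\<^esub> g) = ev f \<oplus> (\<ominus> \<one>) \<otimes> ev g"
      using f g by (simp only: ev_add ev_smult F.smult_closed a_inv_closed one_closed)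
    then show ?thesis using ev_closed[OF g] by (simp add: a_minus_def l_minus)
  qed
  have ev_sym: "ev (diff_symbol R c) = D c" if "c \<in> carrier R" for c
  proof -
    have "ev (diff_symbol R c) = (\<Oplus>x\<in>{c}. diff_symbol R c x \<otimes> D x)"
      using that by (intro ev diff_symbol_closed) (auto simp: diff_symbol_def)
    also have "\<dots> = D c" using that D[OF that] by (simp add: diff_symbol_def)
    finally show ?thesis .
  qed
  have "submodule {f \<in> carrier F. ev f \<in> J} R F"
  proof (rule F.submoduleI)
    have "\<zero>\<^bsub>F\<^esub> = \<zero> \<odot>\<^bsub>F\<^esub> \<zero>\<^bsub>F\<^esub>" by simp
    then have "ev \<zero>\<^bsub>F\<^esub> = \<zero>" using ev_smult[of \<zero> "\<zero>\<^bsub>F\<^esub>"] ev_closed[of "\<zero>\<^bsub>F\<^esub>"] by simp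
    then show "\<zero>\<^bsub>F\<^esub> \<in> {f \<in> carrier F. ev f \<in> J}" by simp
    fix f assume f: "f \<in> {f \<in> carrier F. ev f \<in> J}"
    then have eq: "\<ominus>\<^bsub>F\<^esub> f = (\<ominus> \<one>) \<odot>\<^bsub>F\<^esub> f" by (simp add: F.smult_l_minus)
    show "\<ominus>\<^bsub>F\<^esub> f \<in> {f \<in> carrier F. ev f \<in> J}"
      unfolding eq using f by (simp add: ev_smult J.I_l_closed del: F.smult_l_minus)
  qed (auto simp: ev_add ev_smult J.I_l_closed)
  moreover have "kaehler_relations R A \<subseteq> {f \<in> carrier F. ev f \<in> J}"
  proof
    fix r assume r: "r \<in> kaehler_relations R A"
    then consider
        (add) b c where "b \<in> carrier R" "c \<in> carrier R"
          "r = diff_symbol R (b \<oplus> c) \<ominus>\<^bsub>F\<^esub> (diff_symbol R b \<oplus>\<^bsub>F\<^esub> diff_symbol R c)"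
      | (mult) b c where "b \<in> carrier R" "c \<in> carrier R"
          "r = diff_symbol R (b \<otimes> c) \<ominus>\<^bsub>F\<^esub>
            (b \<odot>\<^bsub>F\<^esub> diff_symbol R c \<oplus>\<^bsub>F\<^esub> c \<odot>\<^bsub>F\<^esub> diff_symbol R b)"
      | (base) b where "b \<in> A" "r = diff_symbol R b"
      unfolding kaehler_relations_def Let_def by blast
    then have "ev r \<in> J"
    proof cases
      case add
      then show ?thesis by (simp add: ev_minus ev_add ev_sym diff_symbol_closed D_add)
    next
      case mult
      then show ?thesis by (simp add: ev_minus ev_add ev_smult ev_sym diff_symbol_closed D_mult)
    next
      case base
      then show ?thesis using D_base ev_sym subsetD[OF A] by simp
    qed
    then show "r \<in> {f \<in> carrier F. ev f \<in> J}" using subsetD[OF kaehler_relations_subset[OF A] r] by simp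
  qed
  ultimately have "N A \<subseteq> {f \<in> carrier F. ev f \<in> J}" by (rule submodule_generated_least)
  moreover have "a \<odot>\<^bsub>F\<^esub> diff_symbol R b \<in> N A"
    using zero F.quotient_smult[OF sub a diff_symbol_closed, of b]
      F.quotient_eq_zero_iff[OF sub F.smult_closed[OF a diff_symbol_closed], of b]
    unfolding differential_def kaehler_eq quotient_module_simps by simp
  ultimately show ?thesis using a b by (auto simp: ev_smult ev_sym diff_symbol_closed)
qed

end

section \<open>Valued fields\<close>

lemma (in abelian_monoid) finsum_swap:
  assumes "finite A" "finite B" "\<And>i j. i \<in> A \<Longrightarrow> j \<in> B \<Longrightarrow> f i j \<in> carrier G"
  shows "(\<Oplus>i\<in>A. \<Oplus>j\<in>B. f i j) = (\<Oplus>j\<in>B. \<Oplus>i\<in>A. f i j)"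
  using assms(1,3)
proof (induction A)
  case empty
  then show ?case by (simp add: finsum_zero)
next
  case (insert x A)
  have "(\<Oplus>i\<in>insert x A. \<Oplus>j\<in>B. f i j) = (\<Oplus>j\<in>B. f x j) \<oplus> (\<Oplus>j\<in>B. \<Oplus>i\<in>A. f i j)"
    using insert by (subst finsum_insert) (auto intro!: finsum_closed)
  also have "\<dots> = (\<Oplus>j\<in>B. f x j \<oplus> (\<Oplus>i\<in>A. f i j))"
    using insert by (intro finsum_addf[symmetric]) (auto intro!: finsum_closed)
  also have "\<dots> = (\<Oplus>j\<in>B. \<Oplus>i\<in>insert x A. f i j)"
    using insert by (intro finsum_cong') (auto intro!: finsum_closed)
  finally show ?case .
qed

locale valued_field = field L for L :: "('a, 'm) ring_scheme" (structure) +
  fixes v :: "'a \<Rightarrow> 'g::linordered_ab_group_add"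
  assumes valuation: "krull_valuation L v"
begin

text \<open>Balls around \<open>0\<close>, which belongs to all of them because of \<open>v 0 = \<infinity>\<close>; stating estimates as membership
  avoids separate treatment of vanishing terms.\<close>

definition ge :: "'g \<Rightarrow> 'a set" where "ge \<gamma> = {a \<in> carrier L. a = \<zero> \<or> \<gamma> \<le> v a}"
definition gt :: "'g \<Rightarrow> 'a set" where "gt \<gamma> = {a \<in> carrier L. a = \<zero> \<or> \<gamma> < v a}"

lemma v_mult: "a \<in> carrier L \<Longrightarrow> b \<in> carrier L \<Longrightarrow> a \<noteq> \<zero> \<Longrightarrow> b \<noteq> \<zero> \<Longrightarrow> v (a \<otimes> b) = v a + v b"
  using valuation unfolding krull_valuation_def by blast

lemma v_one: "v \<one> = 0"
  using v_mult[of \<one> \<one>] by simp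

lemma v_neg_one: "v (\<ominus> \<one>) = 0"
proof -
  have "\<ominus> \<one> \<noteq> \<zero>" by (metis add.inv_eq_1_iff one_closed one_not_zero)
  then have "v (\<ominus> \<one>) + v (\<ominus> \<one>) = 0" using v_mult[of "\<ominus> \<one>" "\<ominus> \<one>"] by (simp add: v_one l_minus)
  then show ?thesis by (simp add: double_zero)
qed

lemma v_neg: "a \<in> carrier L \<Longrightarrow> v (\<ominus> a) = v a"
proof (cases "a = \<zero>")
  case False
  assume a: "a \<in> carrier L"
  have "\<ominus> \<one> \<noteq> \<zero>" by (metis add.inv_eq_1_iff one_closed one_not_zero)
  then have "v (\<ominus> \<one> \<otimes> a) = v a" using v_mult[OF _ a _ False, of "\<ominus> \<one>"] v_neg_one by simp
  then show ?thesis using a by (simp add: l_minus)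
qed simp

lemma v_inv:
  assumes "a \<in> carrier L" "a \<noteq> \<zero>"
  shows "inv a \<in> carrier L" "inv a \<noteq> \<zero>" "a \<otimes> inv a = \<one>" "inv a \<otimes> a = \<one>" "v (inv a) = - v a"
proof -
  have u: "a \<in> Units L" using assms by (simp add: field_Units)
  show i: "inv a \<in> carrier L" "a \<otimes> inv a = \<one>" "inv a \<otimes> a = \<one>" using u by auto
  then show "inv a \<noteq> \<zero>" using assms(1) by (metis r_null one_not_zero)
  then have "v a + v (inv a) = 0" using v_mult[OF assms(1) i(1) assms(2)] i(2) v_one by simp
  then show "v (inv a) = - v a" by (simp add: eq_neg_iff_add_eq_0 add.commute)
qed

lemma v_div: "a \<in> carrier L \<Longrightarrow> b \<in> carrier L \<Longrightarrow> a \<noteq> \<zero> \<Longrightarrow> b \<noteq> \<zero> \<Longrightarrow> v (a \<otimes> inv b) = v a - v b"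
  using v_mult[of a "inv b"] v_inv[of b] by simp

lemma ge_carrier: "a \<in> ge \<gamma> \<Longrightarrow> a \<in> carrier L"
  and gt_carrier: "a \<in> gt \<gamma> \<Longrightarrow> a \<in> carrier L"
  and zero_ge: "\<zero> \<in> ge \<gamma>" and zero_gt: "\<zero> \<in> gt \<gamma>"
  and gt_imp_ge: "a \<in> gt \<gamma> \<Longrightarrow> a \<in> ge \<gamma>"
  and ge_mono: "a \<in> ge \<gamma> \<Longrightarrow> \<delta> \<le> \<gamma> \<Longrightarrow> a \<in> ge \<delta>"
  and ge_gt_mono: "a \<in> ge \<gamma> \<Longrightarrow> \<delta> < \<gamma> \<Longrightarrow> a \<in> gt \<delta>"
  and self_ge: "a \<in> carrier L \<Longrightarrow> a \<in> ge (v a)"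
  by (auto simp: ge_def gt_def)

lemma ge_neg: "a \<in> ge \<gamma> \<Longrightarrow> \<ominus> a \<in> ge \<gamma>"
  and gt_neg: "a \<in> gt \<gamma> \<Longrightarrow> \<ominus> a \<in> gt \<gamma>"
  by (auto simp: ge_def gt_def v_neg)

lemma v_add: "a \<in> carrier L \<Longrightarrow> b \<in> carrier L \<Longrightarrow> a \<noteq> \<zero> \<Longrightarrow> b \<noteq> \<zero> \<Longrightarrow> a \<oplus> b \<noteq> \<zero> \<Longrightarrow>
    min (v a) (v b) \<le> v (a \<oplus> b)"
  using valuation unfolding krull_valuation_def by blast

lemma ge_add: "a \<in> ge \<gamma> \<Longrightarrow> b \<in> ge \<gamma> \<Longrightarrow> a \<oplus> b \<in> ge \<gamma>"
  using v_add[of a b] unfolding ge_def by (cases "a = \<zero>"; cases "b = \<zero>") (auto simp: min_le_iff_disj intro: order_trans)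

lemma gt_add: "a \<in> gt \<gamma> \<Longrightarrow> b \<in> gt \<gamma> \<Longrightarrow> a \<oplus> b \<in> gt \<gamma>"
  using v_add[of a b] unfolding gt_def by (cases "a = \<zero>"; cases "b = \<zero>") (auto simp: min_le_iff_disj intro: less_le_trans)

lemma ge_minus: "a \<in> ge \<gamma> \<Longrightarrow> b \<in> ge \<gamma> \<Longrightarrow> a \<ominus> b \<in> ge \<gamma>"
  and gt_minus: "a \<in> gt \<gamma> \<Longrightarrow> b \<in> gt \<gamma> \<Longrightarrow> a \<ominus> b \<in> gt \<gamma>"
  by (simp_all add: a_minus_def ge_add ge_neg gt_add gt_neg)

lemma ge_mult: "a \<in> ge \<gamma> \<Longrightarrow> b \<in> ge \<delta> \<Longrightarrow> a \<otimes> b \<in> ge (\<gamma> + \<delta>)"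
  unfolding ge_def by (cases "a = \<zero>"; cases "b = \<zero>") (auto simp: v_mult add_mono)

lemma gt_mult: "a \<in> ge \<gamma> \<Longrightarrow> b \<in> gt \<delta> \<Longrightarrow> a \<otimes> b \<in> gt (\<gamma> + \<delta>)"
  unfolding ge_def gt_def by (cases "a = \<zero>"; cases "b = \<zero>") (auto simp: v_mult add_le_less_mono)

lemma ge_finsum:
  assumes "finite A" "\<And>i. i \<in> A \<Longrightarrow> f i \<in> ge \<gamma>"
  shows "(\<Oplus>i\<in>A. f i) \<in> ge \<gamma>"
  using assms
proof (induction A)
  case (insert x A)
  have "f x \<oplus> (\<Oplus>i\<in>A. f i) \<in> ge \<gamma>" using insert by (intro ge_add) auto
  moreover have "(\<Oplus>i\<in>insert x A. f i) = f x \<oplus> (\<Oplus>i\<in>A. f i)"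
    using insert by (intro finsum_insert) (auto intro: ge_carrier)
  ultimately show ?case by simp
qed (simp add: zero_ge)

lemma v_add_eq:
  assumes "a \<in> carrier L" "a \<noteq> \<zero>" "b \<in> gt (v a)"
  shows "a \<oplus> b \<noteq> \<zero>" "v (a \<oplus> b) = v a"
proof -
  have b: "b \<in> carrier L" using gt_carrier[OF assms(3)] .
  have ab: "a \<oplus> b \<oplus> \<ominus> b = a" using assms(1) b by (simp add: a_assoc r_neg)
  have not_gt: "a \<oplus> b \<notin> gt (v a)"
  proof
    assume "a \<oplus> b \<in> gt (v a)"
    then have "a \<in> gt (v a)" using gt_add[OF _ gt_neg[OF assms(3)]] ab by metis
    then show False using assms(2) by (simp add: gt_def)
  qed
  then show ne: "a \<oplus> b \<noteq> \<zero>" using zero_gt by metis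
  have "a \<oplus> b \<in> ge (v a)" using ge_add[OF self_ge gt_imp_ge[OF assms(3)]] assms(1) by simp
  then show "v (a \<oplus> b) = v a" using not_gt ne assms(1) b by (auto simp: ge_def gt_def)
qed

lemma ge_pow: "a \<in> ge 0 \<Longrightarrow> a [^] (n::nat) \<in> ge 0"
proof (induction n)
  case 0
  then show ?case by (simp add: ge_def v_one)
next
  case (Suc n)
  then show ?case using ge_mult[of "a [^] n" 0 a 0] by simp
qed

lemma one_ge: "\<one> \<in> ge 0"
  by (simp add: ge_def v_one)

lemma val_ring_eq: "val_ring L v (carrier L) = ge 0"
  by (auto simp: val_ring_def ge_def)

lemma val_ideal_eq: "val_ideal L v (carrier L) = gt 0"
  by (auto simp: val_ideal_def gt_def)

lemma val_ring_subring: "subring (ge 0) L"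
  using ge_mult[of _ 0 _ 0] by (intro subringI) (auto simp: one_ge ge_neg ge_add intro: ge_carrier)

lemma val_ring_cring: "cring (L\<lparr>carrier := ge 0\<rparr>)"
  using subcring_iff[of "ge 0"] subcringI'[OF val_ring_subring] ge_carrier by blast

abbreviation \<Gamma> where "\<Gamma> \<equiv> value_group L v (carrier L)"

lemma value_groupI: "a \<in> carrier L \<Longrightarrow> a \<noteq> \<zero> \<Longrightarrow> v a \<in> \<Gamma>"
  by (auto simp: value_group_def)

lemma value_groupE: "\<alpha> \<in> \<Gamma> \<Longrightarrow> (\<And>a. a \<in> carrier L \<Longrightarrow> a \<noteq> \<zero> \<Longrightarrow> v a = \<alpha> \<Longrightarrow> thesis) \<Longrightarrow> thesis"
  by (auto simp: value_group_def)

lemma value_group_convex: "convex_subgroup \<Gamma> \<Gamma>"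
  unfolding convex_subgroup_def
proof (intro conjI ballI)
  show "0 \<in> \<Gamma>" using value_groupI[of \<one>] v_one by simp
  fix x assume "x \<in> \<Gamma>"
  then obtain a where a: "a \<in> carrier L" "a \<noteq> \<zero>" "v a = x" by (rule value_groupE)
  then show "- x \<in> \<Gamma>" using value_groupI[of "inv a"] v_inv[of a] by simp
  fix y assume "y \<in> \<Gamma>"
  then obtain b where b: "b \<in> carrier L" "b \<noteq> \<zero>" "v b = y" by (rule value_groupE)
  then show "x + y \<in> \<Gamma>" using value_groupI[of "a \<otimes> b"] v_mult[of a b] a integral_iff[of a b] by simp
qed auto

abbreviation OL where "OL \<equiv> val_ring_of L v"

lemma OL_carrier: "carrier OL = ge 0"
  by (simp add: val_ring_eq)

lemma OL_cring: "cring OL"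
  using val_ring_cring by (simp add: val_ring_eq)

lemma OL_neg: "a \<in> ge 0 \<Longrightarrow> \<ominus>\<^bsub>OL\<^esub> a = \<ominus> a"
proof -
  interpret B: cring OL by (rule OL_cring)
  assume a: "a \<in> ge 0"
  have "a \<in> carrier OL" "\<ominus> a \<in> carrier OL" unfolding OL_carrier using a ge_neg by auto
  moreover have "\<ominus> a \<oplus>\<^bsub>OL\<^esub> a = \<zero>\<^bsub>OL\<^esub>" using ge_carrier[OF a] by (simp add: l_neg)
  ultimately show ?thesis by (intro B.minus_equality) auto
qed

lemma OL_minus: "b \<in> ge 0 \<Longrightarrow> a \<ominus>\<^bsub>OL\<^esub> b = a \<ominus> b"
  by (simp add: a_minus_def OL_neg)

lemma upset_ideal:
  assumes pos: "\<And>\<alpha>. \<alpha> \<in> S \<Longrightarrow> 0 \<le> \<alpha>"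
    and up: "\<And>\<alpha> \<beta>. \<alpha> \<in> S \<Longrightarrow> \<beta> \<in> \<Gamma> \<Longrightarrow> \<alpha> \<le> \<beta> \<Longrightarrow> \<beta> \<in> S"
  shows "ideal {a \<in> carrier L. a = \<zero> \<or> v a \<in> S} OL"
proof -
  interpret B: cring OL by (rule OL_cring)
  let ?J = "{a \<in> carrier L. a = \<zero> \<or> v a \<in> S}"
  have sub: "?J \<subseteq> ge 0" using pos by (auto simp: ge_def)
  have up': "b \<in> ?J" if "a \<in> ?J" "b \<in> carrier L" "a \<noteq> \<zero>" "b \<noteq> \<zero>" "v a \<le> v b" for a b
    using up[of "v a" "v b"] that value_groupI[of b] by auto
  show ?thesis
  proof (rule B.add.subgroupI[THEN idealI[OF B.ring_axioms]])
    show "?J \<subseteq> carrier OL" using sub OL_carrier by simp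
    show "?J \<noteq> {}" by auto
    fix a assume a: "a \<in> ?J"
    show "\<ominus>\<^bsub>OL\<^esub> a \<in> ?J" using a sub by (simp add: OL_neg subset_iff v_neg)
  next
    fix a b assume a: "a \<in> ?J" and b: "b \<in> ?J"
    have "a \<oplus> b \<in> ?J"
    proof (cases "a = \<zero> \<or> b = \<zero> \<or> a \<oplus> b = \<zero>")
      case True
      then show ?thesis using a b by auto
    next
      case False
      then show ?thesis
        using up'[OF a, of "a \<oplus> b"] up'[OF b, of "a \<oplus> b"] v_add[of a b] a b
        by (auto simp: min_le_iff_disj)
    qed
    then show "a \<oplus>\<^bsub>OL\<^esub> b \<in> ?J" by simp
  next
    fix a r assume a: "a \<in> ?J" and r: "r \<in> carrier OL"
    have r': "r \<in> ge 0" "r \<in> carrier L" using r OL_carrier ge_carrier by auto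
    have "r \<otimes> a \<in> ?J"
    proof (cases "a = \<zero> \<or> r = \<zero>")
      case True
      then show ?thesis using a r' by auto
    next
      case False
      then show ?thesis
        using up'[OF a, of "r \<otimes> a"] v_mult[of r a] a r' by (auto simp: integral_iff ge_def)
    qed
    then show "r \<otimes>\<^bsub>OL\<^esub> a \<in> ?J" "a \<otimes>\<^bsub>OL\<^esub> r \<in> ?J" using a r' by (simp_all add: m_comm)
  qed
qed

end

section \<open>Automorphisms of immediate extensions\<close>

lemma (in cring) diff_diff_cancel:
  "a \<in> carrier R \<Longrightarrow> c \<in> carrier R \<Longrightarrow> x \<in> carrier R \<Longrightarrow> (a \<ominus> c) \<ominus> (x \<ominus> c) = a \<ominus> x"
proof - qed algebra

lemma (in cring) diff_times:
  "a \<in> carrier R \<Longrightarrow> b \<in> carrier R \<Longrightarrow> c \<in> carrier R \<Longrightarrow> a \<otimes> c \<ominus> b \<otimes> c = (a \<ominus> b) \<otimes> c"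
proof - qed algebra

lemma (in cring) first_order_step:
  assumes "a \<in> carrier R" "b \<in> carrier R" "n \<in> carrier R" "u \<in> carrier R" "x \<in> carrier R"
  shows "(a \<ominus> b \<ominus> n \<otimes> u) \<oplus> n \<otimes> (u \<ominus> (b \<ominus> x)) = a \<ominus> x \<ominus> (n \<oplus> \<one>) \<otimes> (b \<ominus> x)"
  using assms by algebra

lemma (in cring) add_diff_cancel':
  "a \<in> carrier R \<Longrightarrow> b \<in> carrier R \<Longrightarrow> b \<oplus> (a \<ominus> b) = a"
proof - qed algebra

text \<open>The properties of a Galois defect extension of prime degree on which the argument rests: the
  extension is immediate, \<open>\<sigma>\<close> preserves values and fixes exactly \<open>K\<close>, and the integers
  between \<open>0\<close> and \<open>p\<close> are units of the valuation ring.  That \<open>\<sigma>\<close> has order \<open>p\<close> is a consequence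
  when the degree is \<open>p\<close>, and is therefore added separately.\<close>

locale immediate_automorphism = valued_field L v for L :: "('a, 'm) ring_scheme" (structure)
  and v :: "'a \<Rightarrow> 'g::linordered_ab_group_add" +
  fixes K :: "'a set" and p :: nat and \<sigma> :: "'a \<Rightarrow> 'a"
  assumes K: "subfield K L"
    and p: "Factorial_Ring.prime p"
    and sigma_hom: "\<sigma> \<in> ring_hom L L"
    and sigma_fixes: "x \<in> carrier L \<Longrightarrow> \<sigma> x = x \<longleftrightarrow> x \<in> K"
    and v_sigma: "x \<in> carrier L \<Longrightarrow> x \<noteq> \<zero> \<Longrightarrow> v (\<sigma> x) = v x"
    and nontrivial: "\<exists>x\<in>carrier L. x \<notin> K"
    and immediate: "x \<in> carrier L \<Longrightarrow> x \<notin> K \<Longrightarrow> \<exists>c\<in>K. v x < v (x \<ominus> c)"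
    and v_of_nat: "0 < i \<Longrightarrow> i < p \<Longrightarrow> [i] \<cdot> \<one> \<noteq> \<zero> \<and> v ([i] \<cdot> \<one>) = 0"
begin

lemmas K_subring = subringE[OF subfieldE(1)[OF K]]
lemmas K_carr = subsetD[OF K_subring(1)]

lemma K_inv: "a \<in> K \<Longrightarrow> a \<noteq> \<zero> \<Longrightarrow> inv a \<in> K"
  using subfield_m_inv(1)[OF K, of a] by simp

lemma K_finsum: "finite A \<Longrightarrow> (\<And>i. i \<in> A \<Longrightarrow> f i \<in> K) \<Longrightarrow> (\<Oplus>i\<in>A. f i) \<in> K"
proof (induction A rule: finite_induct)
  case (insert x A)
  then have "(\<Oplus>i\<in>insert x A. f i) = f x \<oplus> (\<Oplus>i\<in>A. f i)"
    by (intro finsum_insert) (auto intro: K_carr)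
  then show ?case using insert K_subring(7) by simp
qed (simp add: K_subring(2))

lemma notin_K_minus: "x \<in> carrier L \<Longrightarrow> x \<notin> K \<Longrightarrow> c \<in> K \<Longrightarrow> x \<ominus> c \<in> carrier L \<and> x \<ominus> c \<notin> K"
proof -
  assume x: "x \<in> carrier L" "x \<notin> K" and c: "c \<in> K"
  have "x = (x \<ominus> c) \<oplus> c" using x(1) K_carr[OF c] by (simp add: a_minus_def a_assoc l_neg)
  then show ?thesis using x K_carr[OF c] K_subring(7)[OF _ c, of "x \<ominus> c"] by auto
qed

lemma notin_K_mult: "x \<in> carrier L \<Longrightarrow> x \<notin> K \<Longrightarrow> c \<in> K \<Longrightarrow> c \<noteq> \<zero> \<Longrightarrow> x \<otimes> c \<in> carrier L \<and> x \<otimes> c \<notin> K"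
  using subfield_m_inv_simprule[OF K, of c x] K_carr[of c] by (auto simp: m_comm)

lemma notin_K_nonzero: "x \<notin> K \<Longrightarrow> x \<noteq> \<zero>"
  using K_subring(2) by blast

lemma p_gt_1: "1 < p" using p by (rule prime_gt_1_nat)

subsection \<open>The powers of the automorphism\<close>

abbreviation s :: "nat \<Rightarrow> 'a \<Rightarrow> 'a" where "s k \<equiv> \<sigma> ^^ k"

lemma s_hom: "s k \<in> ring_hom L L"
proof (induction k)
  case (Suc k)
  then show ?case using ring_hom_trans[OF Suc sigma_hom] by (simp add: comp_def)
qed (simp add: ring_hom_memI)

lemma s_ring_hom: "ring_hom_cring L L (s k)"
  using s_hom by (intro ring_hom_cring.intro ring_hom_cring_axioms.intro is_cring)

lemma s_closed [simp]: "x \<in> carrier L \<Longrightarrow> s k x \<in> carrier L"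
  and s_add: "x \<in> carrier L \<Longrightarrow> y \<in> carrier L \<Longrightarrow> s k (x \<oplus> y) = s k x \<oplus> s k y"
  and s_mult: "x \<in> carrier L \<Longrightarrow> y \<in> carrier L \<Longrightarrow> s k (x \<otimes> y) = s k x \<otimes> s k y"
  using s_hom[of k] by (auto simp: ring_hom_def)

lemma s_neg: "x \<in> carrier L \<Longrightarrow> s k (\<ominus> x) = \<ominus> s k x"
  and s_zero: "s k \<zero> = \<zero>"
proof -
  interpret s: ring_hom_cring L L "s k" by (rule s_ring_hom)
  show "x \<in> carrier L \<Longrightarrow> s k (\<ominus> x) = \<ominus> s k x" and "s k \<zero> = \<zero>" by simp_all
qed

lemma s_minus: "x \<in> carrier L \<Longrightarrow> y \<in> carrier L \<Longrightarrow> s k (x \<ominus> y) = s k x \<ominus> s k y"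
  by (simp add: a_minus_def s_add s_neg)

lemma s_fixes: "c \<in> K \<Longrightarrow> s k c = c"
  by (induction k) (simp_all add: sigma_fixes K_carr)

lemma s_pow: "x \<in> carrier L \<Longrightarrow> s k (x [^] (n::nat)) = s k x [^] n"
  by (induction n) (simp_all add: s_mult s_fixes K_subring(3))

lemma s_finsum: "f \<in> A \<rightarrow> carrier L \<Longrightarrow> s k (\<Oplus>i\<in>A. f i) = (\<Oplus>i\<in>A. s k (f i))"
  using ring_hom_cring.hom_finsum[OF s_ring_hom, of f A k] by (simp add: comp_def)

lemma s_nonzero: "x \<in> carrier L \<Longrightarrow> x \<noteq> \<zero> \<Longrightarrow> s k x \<noteq> \<zero>"
  using s_mult[of x "inv x" k] v_inv[of x] s_fixes[OF K_subring(3)] by (metis integral_iff one_not_zero s_closed)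

lemma v_s: "x \<in> carrier L \<Longrightarrow> x \<noteq> \<zero> \<Longrightarrow> v (s k x) = v x"
  by (induction k) (simp_all add: v_sigma s_nonzero)

lemma s_ge: "x \<in> ge \<gamma> \<Longrightarrow> s k x \<in> ge \<gamma>"
  and s_gt: "x \<in> gt \<gamma> \<Longrightarrow> s k x \<in> gt \<gamma>"
  using v_s[of x k] by (cases "x = \<zero>"; auto simp: ge_def gt_def s_zero)+

abbreviation D where "D x \<equiv> \<sigma> x \<ominus> x"

lemma sigma_closed [simp]: "x \<in> carrier L \<Longrightarrow> \<sigma> x \<in> carrier L"
  using s_closed[of x 1] by simp

lemma sigma_eqs:
  "x \<in> carrier L \<Longrightarrow> y \<in> carrier L \<Longrightarrow> \<sigma> (x \<oplus> y) = \<sigma> x \<oplus> \<sigma> y"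
  "x \<in> carrier L \<Longrightarrow> y \<in> carrier L \<Longrightarrow> \<sigma> (x \<otimes> y) = \<sigma> x \<otimes> \<sigma> y"
  "x \<in> carrier L \<Longrightarrow> y \<in> carrier L \<Longrightarrow> \<sigma> (x \<ominus> y) = \<sigma> x \<ominus> \<sigma> y"
  "c \<in> K \<Longrightarrow> \<sigma> c = c"
  using s_add[of x y 1] s_mult[of x y 1] s_minus[of x y 1] s_fixes[of c 1] by simp_all

lemma D_eq_zero_iff: "x \<in> carrier L \<Longrightarrow> D x = \<zero> \<longleftrightarrow> x \<in> K"
  using sigma_fixes[of x] by (simp add: r_right_minus_eq)

lemma D_minus_const: "x \<in> carrier L \<Longrightarrow> c \<in> K \<Longrightarrow> D (x \<ominus> c) = D x"
  using K_carr[of c] diff_diff_cancel[of "\<sigma> x" c x] by (simp add: sigma_eqs)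

lemma D_mult_const: "x \<in> carrier L \<Longrightarrow> c \<in> K \<Longrightarrow> D (x \<otimes> c) = D x \<otimes> c"
  using K_carr[of c] diff_times[of "\<sigma> x" x c] by (simp add: sigma_eqs)

lemma value_in_K: "x \<in> carrier L \<Longrightarrow> x \<noteq> \<zero> \<Longrightarrow> \<exists>c\<in>K. c \<noteq> \<zero> \<and> v c = v x"
proof (cases "x \<in> K")
  case False
  assume x: "x \<in> carrier L" "x \<noteq> \<zero>"
  obtain c where c: "c \<in> K" "v x < v (x \<ominus> c)" using immediate[OF x(1) False] by blast
  have "\<ominus> (x \<ominus> c) \<in> gt (v x)"
    using c x K_carr by (intro gt_neg) (auto simp: gt_def)
  from v_add_eq[OF x this] have "x \<oplus> \<ominus> (x \<ominus> c) \<noteq> \<zero> \<and> v (x \<oplus> \<ominus> (x \<ominus> c)) = v x" by simp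
  moreover have "x \<oplus> \<ominus> (x \<ominus> c) = c" using x K_carr[OF c(1)] by algebra
  ultimately show ?thesis using c(1) by auto
qed blast

lemma value_group_K: "value_group L v K = \<Gamma>"
proof
  show "value_group L v K \<subseteq> \<Gamma>" using K_subring(1) unfolding value_group_def by blast
  show "\<Gamma> \<subseteq> value_group L v K"
  proof
    fix \<alpha> assume "\<alpha> \<in> \<Gamma>"
    then obtain x where x: "x \<in> carrier L" "x \<noteq> \<zero>" "v x = \<alpha>" by (rule value_groupE)
    obtain c where "c \<in> K" "c \<noteq> \<zero>" "v c = v x" using value_in_K[OF x(1,2)] by blast
    then show "\<alpha> \<in> value_group L v K"
      using imageI[of c "K - {\<zero>}" v] x(3) by (simp add: value_group_def)
  qed
qed

lemma KvalE:
  assumes "\<alpha> \<in> \<Gamma>"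
  obtains c where "c \<in> K" "c \<noteq> \<zero>" "v c = \<alpha>"
proof -
  have "\<alpha> \<in> v ` (K - {\<zero>})" using assms value_group_K unfolding value_group_def by simp
  then show thesis using that by auto
qed

text \<open>\<open>\<sigma> x - x = \<sigma> (x - c) - (x - c)\<close> for every \<open>c \<in> K\<close>, and immediacy gives a \<open>c\<close> with
  \<open>v (x - c) > v x\<close>.\<close>

lemma v_D_gt: "x \<in> carrier L \<Longrightarrow> x \<noteq> \<zero> \<Longrightarrow> D x \<in> gt (v x)"
proof (cases "x \<in> K")
  case True
  assume "x \<in> carrier L"
  then have "D x = \<zero>" using True D_eq_zero_iff by blast
  then show ?thesis by (simp only: zero_gt)
next
  case False
  assume x: "x \<in> carrier L" "x \<noteq> \<zero>"
  obtain c where c: "c \<in> K" "v x < v (x \<ominus> c)" using immediate[OF x(1) False] by blast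
  have "x \<ominus> c \<in> gt (v x)" using c x K_carr by (auto simp: gt_def)
  then have "D (x \<ominus> c) \<in> gt (v x)" using s_gt[of "x \<ominus> c" _ 1] by (simp add: gt_minus)
  then show ?thesis using D_minus_const[OF x(1) c(1)] by simp
qed

lemma D_gt: "x \<in> ge \<gamma> \<Longrightarrow> D x \<in> gt \<gamma>"
  using v_D_gt[of x] D_eq_zero_iff[of \<zero>] K_subring(2)
  by (cases "x = \<zero>") (auto simp: ge_def gt_def)

lemma of_nat_in_K: "[(k::nat)] \<cdot> \<one> \<in> K"
  by (induction k) (simp_all add: K_subring(2,3,7))

lemma of_nat_ge: "[(k::nat)] \<cdot> \<one> \<in> ge 0"
  by (induction k) (simp_all add: zero_ge one_ge ge_add)

text \<open>To first order \<open>\<sigma>\<^sup>k x - x\<close> is \<open>k (\<sigma> x - x)\<close>, since \<open>\<sigma>\<close> moves \<open>\<sigma> x - x\<close> by a term of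
  higher value.\<close>

lemma s_minus_self:
  assumes x: "x \<in> carrier L" "x \<notin> K"
  shows "s k x \<ominus> x \<ominus> [k] \<cdot> \<one> \<otimes> D x \<in> gt (v (D x))"
proof (induction k)
  case 0
  have "x \<ominus> x \<ominus> \<zero> \<otimes> D x = \<zero>" using x by (simp add: a_minus_def r_neg)
  then show ?case by (simp add: zero_gt)
next
  case (Suc k)
  let ?u = "D x" and ?n = "[k] \<cdot> \<one>"
  have u: "?u \<in> carrier L" using x by simp
  have n: "?n \<in> carrier L" "?n \<in> K" using of_nat_in_K K_carr by auto
  have sk: "s k x \<in> carrier L" "\<sigma> x \<in> carrier L" "\<sigma> ?u \<in> carrier L" "\<sigma> (s k x) \<in> carrier L"
    using x u by simp_all
  have "\<sigma> (s k x \<ominus> x \<ominus> ?n \<otimes> ?u) \<in> gt (v ?u)" using s_gt[OF Suc, of 1] by simp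
  moreover have "?n \<otimes> D ?u \<in> gt (v ?u)" using gt_mult[OF of_nat_ge D_gt[OF self_ge[OF u]], of k] by simp
  ultimately have "\<sigma> (s k x \<ominus> x \<ominus> ?n \<otimes> ?u) \<oplus> ?n \<otimes> D ?u \<in> gt (v ?u)" by (rule gt_add)
  moreover have "\<sigma> (s k x \<ominus> x \<ominus> ?n \<otimes> ?u) \<oplus> ?n \<otimes> D ?u = \<sigma> (s k x) \<ominus> x \<ominus> (?n \<oplus> \<one>) \<otimes> ?u"
  proof -
    have "\<sigma> (s k x \<ominus> x \<ominus> ?n \<otimes> ?u) = \<sigma> (s k x) \<ominus> \<sigma> x \<ominus> ?n \<otimes> \<sigma> ?u"
      using x u n(1) sk by (simp add: sigma_eqs(1-3) sigma_eqs(4)[OF n(2)])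
    then show ?thesis using first_order_step[OF sk(4,2) n(1) sk(3) x(1)] by simp
  qed
  ultimately show ?case by simp
qed

lemma v_s_minus_self:
  assumes x: "x \<in> carrier L" "x \<notin> K" and k: "0 < k" "k < p"
  shows "s k x \<ominus> x \<noteq> \<zero>" "v (s k x \<ominus> x) = v (D x)"
proof -
  have u: "D x \<in> carrier L" "D x \<noteq> \<zero>" using x D_eq_zero_iff by auto
  have n: "[k] \<cdot> \<one> \<in> carrier L" using of_nat_in_K K_carr by auto
  have nu: "[k] \<cdot> \<one> \<otimes> D x \<in> carrier L" "[k] \<cdot> \<one> \<otimes> D x \<noteq> \<zero>" "v ([k] \<cdot> \<one> \<otimes> D x) = v (D x)"
    using v_of_nat[OF k] u n v_mult[OF n u(1)] by (auto simp: integral_iff)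
  have "[k] \<cdot> \<one> \<otimes> D x \<oplus> (s k x \<ominus> x \<ominus> [k] \<cdot> \<one> \<otimes> D x) = s k x \<ominus> x"
    using nu(1) x(1) by (intro add_diff_cancel') simp_all
  then show "s k x \<ominus> x \<noteq> \<zero>" "v (s k x \<ominus> x) = v (D x)"
    using v_add_eq[OF nu(1,2), of "s k x \<ominus> x \<ominus> [k] \<cdot> \<one> \<otimes> D x"] s_minus_self[OF x, of k] nu(3)
    by simp_all
qed

subsection \<open>The set \<open>\<Sigma>\<close>\<close>

abbreviation Sig where "Sig \<equiv> Sigma_set L v \<sigma>"

text \<open>Division by an element of \<open>K\<close> of the same value, which commutes with \<open>D\<close>, turns \<open>D b / b\<close> into
  \<open>D x\<close> with \<open>v x = 0\<close>.\<close>

lemma Sigma_iff: "\<alpha> \<in> Sig \<longleftrightarrow> (\<exists>x\<in>ge 0. x \<notin> K \<and> v (D x) = \<alpha>)"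
proof
  assume "\<alpha> \<in> Sig"
  then obtain b where b: "b \<in> carrier L" "b \<noteq> \<zero>" "\<sigma> b \<noteq> b" "\<alpha> = v (D b \<otimes> inv b)"
    unfolding Sigma_set_def by blast
  have bK: "b \<notin> K" using b sigma_fixes by blast
  have Db: "D b \<in> carrier L" "D b \<noteq> \<zero>" using b(1) bK D_eq_zero_iff by auto
  obtain c where c: "c \<in> K" "c \<noteq> \<zero>" "v c = v b" using value_in_K[OF b(1,2)] by blast
  have ic: "inv c \<in> K" "inv c \<noteq> \<zero>" using K_inv[OF c(1,2)] v_inv[of c] c K_carr by auto
  have "b \<otimes> inv c \<in> ge 0" using v_div[of b c] b c K_carr ic by (auto simp: ge_def)
  moreover have "b \<otimes> inv c \<notin> K" using notin_K_mult[OF b(1) bK ic] by blast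
  moreover have "v (D (b \<otimes> inv c)) = \<alpha>"
    using v_div[OF Db(1) _ Db(2), of c] v_div[OF Db(1) b(1) Db(2) b(2)] c K_carr b(4)
    by (simp add: D_mult_const[OF b(1) ic(1)])
  ultimately show "\<exists>x\<in>ge 0. x \<notin> K \<and> v (D x) = \<alpha>" by blast
next
  assume "\<exists>x\<in>ge 0. x \<notin> K \<and> v (D x) = \<alpha>"
  then obtain x where x: "x \<in> ge 0" "x \<notin> K" "v (D x) = \<alpha>" by blast
  \<comment> \<open>If \<open>v x > 0\<close>, the unit \<open>x + 1\<close> replaces \<open>x\<close>.\<close>
  have xc: "x \<in> carrier L" using x(1) ge_carrier by blast
  obtain b where b: "b \<in> carrier L" "b \<notin> K" "v b = 0" "D b = D x"
  proof (cases "v x = 0")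
    case False
    then have "x \<in> gt (v \<one>)" using x(1) notin_K_nonzero[OF x(2)] by (auto simp: ge_def gt_def v_one)
    then have "v (\<one> \<oplus> x) = 0" using v_add_eq[of \<one> x] v_one by simp
    moreover have eq: "\<one> \<oplus> x = x \<ominus> \<ominus> \<one>" using xc by algebra
    moreover have "\<ominus> \<one> \<in> K" using K_subring by blast
    ultimately show ?thesis
      using that[of "x \<ominus> \<ominus> \<one>"] notin_K_minus[OF xc x(2), of "\<ominus> \<one>"] D_minus_const[OF xc, of "\<ominus> \<one>"] by simp
  qed (use that[of x] x xc in blast)
  have bz: "b \<noteq> \<zero>" using notin_K_nonzero[OF b(2)] .
  have "D b \<noteq> \<zero>" using b D_eq_zero_iff by blast
  then have "v (D b \<otimes> inv b) = \<alpha>" using v_div[of "D b" b] b x(3) xc bz by simp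
  moreover have "\<sigma> b \<noteq> b" using b sigma_fixes by blast
  ultimately show "\<alpha> \<in> Sig" unfolding Sigma_set_def using b(1) bz by blast
qed

lemma Sigma_pos: "\<alpha> \<in> Sig \<Longrightarrow> 0 < \<alpha>"
  and Sigma_subset: "Sig \<subseteq> \<Gamma>"
proof -
  have *: "0 < \<alpha> \<and> \<alpha> \<in> \<Gamma>" if "\<alpha> \<in> Sig" for \<alpha>
  proof -
    obtain x where x: "x \<in> ge 0" "x \<notin> K" "v (D x) = \<alpha>" using \<open>\<alpha> \<in> Sig\<close> Sigma_iff by blast
    then have "D x \<noteq> \<zero>" "D x \<in> gt 0" using D_gt D_eq_zero_iff ge_carrier by blast+
    then show ?thesis using x(3) value_groupI[of "D x"] by (auto simp: gt_def)
  qed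
  then show "\<alpha> \<in> Sig \<Longrightarrow> 0 < \<alpha>" and "Sig \<subseteq> \<Gamma>" by auto
qed

lemma Sigma_up:
  assumes "\<alpha> \<in> Sig" "\<beta> \<in> \<Gamma>" "\<alpha> \<le> \<beta>"
  shows "\<beta> \<in> Sig"
proof -
  obtain x where x: "x \<in> ge 0" "x \<notin> K" "v (D x) = \<alpha>" using assms(1) Sigma_iff by blast
  have "\<beta> - \<alpha> \<in> \<Gamma>" using convex_subgroupD(5)[OF value_group_convex] assms Sigma_subset by blast
  then obtain c where c: "c \<in> K" "c \<noteq> \<zero>" "v c = \<beta> - \<alpha>" by (rule KvalE)
  have xc: "x \<in> carrier L" "D x \<in> carrier L" "D x \<noteq> \<zero>" using x ge_carrier D_eq_zero_iff by auto
  have "x \<otimes> c \<in> ge 0" using ge_mult[OF x(1), of c 0] c K_carr assms(3) by (auto simp: ge_def)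
  moreover have "v (D (x \<otimes> c)) = \<beta>"
    using D_mult_const[OF xc(1) c(1)] v_mult[OF xc(2) K_carr[OF c(1)] xc(3) c(2)] x(3) c(3) by simp
  ultimately show ?thesis using Sigma_iff notin_K_mult[OF xc(1) x(2) c(1,2)] by blast
qed

text \<open>Replacing \<open>x\<close> by \<open>x - c\<close> with \<open>c \<in> K\<close> close to \<open>x\<close> keeps \<open>D x\<close> and enlarges the denominator of
  \<open>D x / x\<close>.\<close>

lemma Sigma_no_least:
  assumes "\<alpha> \<in> Sig"
  shows "\<exists>\<beta>\<in>Sig. \<beta> < \<alpha>"
proof -
  obtain x where x: "x \<in> ge 0" "x \<notin> K" "v (D x) = \<alpha>" using assms Sigma_iff by blast
  have xc: "x \<in> carrier L" "D x \<in> carrier L" "D x \<noteq> \<zero>" using x ge_carrier D_eq_zero_iff by auto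
  obtain c where c: "c \<in> K" "v x < v (x \<ominus> c)" using immediate[OF xc(1) x(2)] by blast
  have y: "x \<ominus> c \<in> carrier L" "x \<ominus> c \<notin> K" using notin_K_minus[OF xc(1) x(2) c(1)] by auto
  then have yz: "x \<ominus> c \<noteq> \<zero>" using notin_K_nonzero by blast
  have pos: "0 < v (x \<ominus> c)" using c(2) x(1) notin_K_nonzero[OF x(2)] by (auto simp: ge_def)
  have "\<sigma> (x \<ominus> c) \<noteq> x \<ominus> c" using y sigma_fixes by blast
  then have "v (D (x \<ominus> c) \<otimes> inv (x \<ominus> c)) \<in> Sig" unfolding Sigma_set_def using y yz by blast
  moreover have "v (D (x \<ominus> c) \<otimes> inv (x \<ominus> c)) = \<alpha> - v (x \<ominus> c)"
    using v_div[OF xc(2) y(1) xc(3) yz] x(3) D_minus_const[OF xc(1) c(1)] by simp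
  ultimately show ?thesis using pos by (metis diff_less_eq less_add_same_cancel1)
qed

lemma Sigma_nonempty: "Sig \<noteq> {}"
proof -
  obtain x where x: "x \<in> carrier L" "x \<notin> K" using nontrivial by blast
  then have "\<sigma> x \<noteq> x" "x \<noteq> \<zero>" using sigma_fixes notin_K_nonzero by blast+
  then show ?thesis unfolding Sigma_set_def using x by blast
qed

end

locale immediate_cyclic = immediate_automorphism +
  assumes sigma_order: "x \<in> carrier L \<Longrightarrow> (\<sigma> ^^ p) x = x"

section \<open>Trace and Galois coordinates\<close>

lemma (in cring) linear_factor_product:
  "w \<in> carrier R \<Longrightarrow> r \<in> carrier R \<Longrightarrow> z \<in> carrier R \<Longrightarrow> P \<in> carrier R \<Longrightarrow>
   (w \<otimes> r) \<otimes> P \<oplus> (\<ominus> r \<otimes> z) \<otimes> P = r \<otimes> (w \<ominus> z) \<otimes> P"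
proof - qed algebra

lemma (in cring) shifted_coefficient:
  "r \<in> carrier R \<Longrightarrow> a \<in> carrier R \<Longrightarrow> z \<in> carrier R \<Longrightarrow> t \<in> carrier R \<Longrightarrow>
   \<ominus> (r \<otimes> a) \<otimes> (t \<otimes> z) = (\<ominus> r \<otimes> z) \<otimes> (a \<otimes> t)"
proof - qed algebra

context immediate_cyclic
begin

text \<open>The \<open>a\<^sub>j\<close> are the coefficients of the product of \<open>(\<sigma>\<^sup>k x - X) / (\<sigma>\<^sup>k x - x)\<close> over \<open>0 < k \<le> m\<close>.
  This polynomial is \<open>1\<close> at \<open>x\<close> and vanishes at \<open>\<sigma>\<^sup>k x\<close>, and each factor lowers the values of the
  coefficients by at most \<open>v (\<sigma>\<^sup>k x - x) = v (D x)\<close>.\<close>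

lemma galois_coordinates_aux:
  assumes x: "x \<in> ge 0" "x \<notin> K" and m: "m < p"
  shows "\<exists>a. (\<forall>j. a j \<in> ge (- nmul m (v (D x)))) \<and> (\<forall>j>m. a j = \<zero>) \<and>
    (\<forall>k\<le>m. (\<Oplus>j\<in>{..m}. a j \<otimes> s k x [^] j) = (if k = 0 then \<one> else \<zero>))"
  using m
proof (induction m)
  case 0
  show ?case
    by (intro exI[of _ "\<lambda>j. if j = 0 then \<one> else \<zero>"])
       (auto simp: one_ge zero_ge)
next
  case (Suc m)
  let ?\<beta> = "v (D x)"
  have xc: "x \<in> carrier L" using x(1) ge_carrier by blast
  obtain a where a: "\<And>j. a j \<in> ge (- nmul m ?\<beta>)" "\<And>j. j > m \<Longrightarrow> a j = \<zero>"
    "\<And>k. k \<le> m \<Longrightarrow> (\<Oplus>j\<in>{..m}. a j \<otimes> s k x [^] j) = (if k = 0 then \<one> else \<zero>)"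
    using Suc by auto
  have ac: "a j \<in> carrier L" for j using a(1) ge_carrier by blast
  define w where "w = s (Suc m) x"
  define r where "r = inv (w \<ominus> x)"
  have wc: "w \<in> carrier L" and wge: "w \<in> ge 0"
    using xc s_ge[OF x(1)] unfolding w_def by (auto intro: s_closed simp del: funpow.simps)
  have wx: "w \<ominus> x \<noteq> \<zero>" "v (w \<ominus> x) = ?\<beta>" "w \<ominus> x \<in> carrier L"
    using v_s_minus_self[OF xc x(2), of "Suc m"] Suc.prems wc xc unfolding w_def by auto
  have r: "r \<in> carrier L" "r \<otimes> (w \<ominus> x) = \<one>" "r \<in> ge (- ?\<beta>)"
    using v_inv[OF wx(3,1)] wx(2) unfolding r_def by (auto simp: ge_def)
  \<comment> \<open>the coefficients after multiplication by \<open>r (w - X)\<close>\<close>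
  define b where "b j = (w \<otimes> r) \<otimes> a j \<oplus> (case j of 0 \<Rightarrow> \<zero> | Suc i \<Rightarrow> \<ominus> (r \<otimes> a i))" for j
  have ra: "r \<otimes> a i \<in> ge (- nmul (Suc m) ?\<beta>)" for i
    using ge_mult[OF r(3) a(1), of i] by simp
  have "(w \<otimes> r) \<otimes> a i \<in> ge (- nmul (Suc m) ?\<beta>)" for i
    using ge_mult[OF wge ra, of i] wc r(1) ac by (simp add: m_assoc)
  then have b_ge: "b j \<in> ge (- nmul (Suc m) ?\<beta>)" for j
    unfolding b_def by (intro ge_add) (auto split: nat.split intro: ge_neg ra zero_ge simp del: nmul.simps)
  have b_zero: "b j = \<zero>" if "j > Suc m" for j
    unfolding b_def using that a(2)[of j] a(2)[of "j - 1"] wc r(1) by (auto split: nat.split)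
  have b_eval: "(\<Oplus>j\<in>{..Suc m}. b j \<otimes> z [^] j) = r \<otimes> (w \<ominus> z) \<otimes> (\<Oplus>j\<in>{..m}. a j \<otimes> z [^] j)"
    if z: "z \<in> carrier L" for z
  proof -
    let ?P = "\<Oplus>j\<in>{..m}. a j \<otimes> z [^] j"
    have P: "?P \<in> carrier L" using ac z by (intro finsum_closed) auto
    have "(\<Oplus>j\<in>{..Suc m}. b j \<otimes> z [^] j) =
      (\<Oplus>j\<in>{..Suc m}. ((w \<otimes> r) \<otimes> a j) \<otimes> z [^] j \<oplus>
        (case j of 0 \<Rightarrow> \<zero> | Suc i \<Rightarrow> \<ominus> (r \<otimes> a i)) \<otimes> z [^] j)"
      using ac wc r(1) z by (intro finsum_cong') (auto simp: b_def l_distr split: nat.split)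
    also have "\<dots> = (\<Oplus>j\<in>{..Suc m}. ((w \<otimes> r) \<otimes> a j) \<otimes> z [^] j) \<oplus>
        (\<Oplus>j\<in>{..Suc m}. (case j of 0 \<Rightarrow> \<zero> | Suc i \<Rightarrow> \<ominus> (r \<otimes> a i)) \<otimes> z [^] j)"
      using ac wc r(1) z by (intro finsum_addf) (auto split: nat.split)
    also have "(\<Oplus>j\<in>{..Suc m}. ((w \<otimes> r) \<otimes> a j) \<otimes> z [^] j) = (\<Oplus>j\<in>{..m}. ((w \<otimes> r) \<otimes> a j) \<otimes> z [^] j)"
      using ac wc r(1) z a(2)[of "Suc m"] by (subst finsum_Suc) (auto intro!: l_zero finsum_closed)
    also have "\<dots> = (\<Oplus>j\<in>{..m}. (w \<otimes> r) \<otimes> (a j \<otimes> z [^] j))"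
      using ac wc r(1) z by (intro finsum_cong') (auto simp: m_assoc)
    also have "\<dots> = (w \<otimes> r) \<otimes> ?P"
      using ac wc r(1) z by (intro finsum_rdistr[symmetric]) auto
    also have "(\<Oplus>j\<in>{..Suc m}. (case j of 0 \<Rightarrow> \<zero> | Suc i \<Rightarrow> \<ominus> (r \<otimes> a i)) \<otimes> z [^] j) =
        (\<Oplus>i\<in>{..m}. \<ominus> (r \<otimes> a i) \<otimes> (z [^] i \<otimes> z))"
      using ac r(1) z by (subst finsum_Suc2) (auto intro!: r_zero finsum_closed split: nat.split)
    also have "\<dots> = (\<Oplus>i\<in>{..m}. (\<ominus> r \<otimes> z) \<otimes> (a i \<otimes> z [^] i))"
      using ac r(1) z by (intro finsum_cong') (auto simp: shifted_coefficient)
    also have "\<dots> = (\<ominus> r \<otimes> z) \<otimes> ?P"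
      using ac r(1) z by (intro finsum_rdistr[symmetric]) auto
    finally show ?thesis using linear_factor_product[OF wc r(1) z P] by simp
  qed
  have "(\<Oplus>j\<in>{..Suc m}. b j \<otimes> s k x [^] j) = (if k = 0 then \<one> else \<zero>)" if k: "k \<le> Suc m" for k
  proof (cases "k = Suc m")
    case True
    have "(\<Oplus>j\<in>{..m}. a j \<otimes> w [^] j) \<in> carrier L" using ac wc by (intro finsum_closed) auto
    moreover have "w \<ominus> w = \<zero>" using wc by (simp add: r_right_minus_eq)
    ultimately show ?thesis using True b_eval[OF wc] r(1) by (simp add: w_def del: funpow.simps)
  next
    case False
    then have km: "k \<le> m" using k by simp
    show ?thesis
    proof (cases "k = 0")
      case True
      then show ?thesis using b_eval[OF xc] a(3)[OF km] r(2) by simp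
    next
      case False
      then show ?thesis using b_eval[OF s_closed[OF xc, of k]] a(3)[OF km] r(1) wc xc by simp
    qed
  qed
  then show ?case using b_ge b_zero by blast
qed

lemma galois_coordinates:
  assumes x: "x \<in> ge 0" "x \<notin> K"
  shows "\<exists>a. (\<forall>j. a j \<in> ge (- nmul (p - 1) (v (D x)))) \<and>
    (\<forall>k<p. (\<Oplus>j\<in>{..<p}. a j \<otimes> s k (x [^] j)) = (if k = 0 then \<one> else \<zero>))"
proof -
  have "p - 1 < p" and eq: "{..p - 1} = {..<p}" using p_gt_1 by auto
  from galois_coordinates_aux[OF x this(1)] obtain a where
    a: "\<And>j. a j \<in> ge (- nmul (p - 1) (v (D x)))"
    "\<And>k. k \<le> p - 1 \<Longrightarrow> (\<Oplus>j\<in>{..<p}. a j \<otimes> s k x [^] j) = (if k = 0 then \<one> else \<zero>)"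
    unfolding eq by blast
  moreover have "x \<in> carrier L" using x(1) ge_carrier by blast
  ultimately show ?thesis by (intro exI[of _ a]) (simp add: s_pow)
qed

text \<open>Shown below to be the trace of the multiplication map.\<close>

definition Tr where "Tr z = (\<Oplus>k\<in>{..<p}. s k z)"

lemma Tr_closed [simp]: "z \<in> carrier L \<Longrightarrow> Tr z \<in> carrier L"
  unfolding Tr_def by (intro finsum_closed) auto

lemma Tr_ge: "z \<in> ge \<gamma> \<Longrightarrow> Tr z \<in> ge \<gamma>"
  unfolding Tr_def by (intro ge_finsum) (auto intro: s_ge)

lemma cyclic_shift:
  assumes f: "\<And>k. f k \<in> carrier L" and per: "f p = f 0"
  shows "(\<Oplus>k\<in>{..<p}. f (Suc k)) = (\<Oplus>k\<in>{..<p}. f k)"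
proof -
  obtain q where q: "p = Suc q" using p_gt_1 by (cases p) auto
  have eq: "{..<p} = {..q}" unfolding q by auto
  have T: "(\<Oplus>k\<in>{..q}. f k) \<in> carrier L" and S: "(\<Oplus>k\<in>{..q}. f (Suc k)) \<in> carrier L"
    using f by (auto intro!: finsum_closed)
  have "(\<Oplus>k\<in>{..q}. f (Suc k)) \<oplus> f 0 = (\<Oplus>k\<in>{..Suc q}. f k)"
    using f by (subst finsum_Suc2) auto
  also have "\<dots> = f 0 \<oplus> (\<Oplus>k\<in>{..q}. f k)" using f per q by (subst finsum_Suc) auto
  finally show ?thesis using S T f unfolding eq by (simp add: a_comm)
qed

lemma Tr_in_K:
  assumes z: "z \<in> carrier L"
  shows "Tr z \<in> K"
proof -
  have "\<sigma> (Tr z) = (\<Oplus>k\<in>{..<p}. s (Suc k) z)"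
    unfolding Tr_def using s_finsum[of "\<lambda>k. s k z" "{..<p}" 1] z by simp
  also have "\<dots> = Tr z"
    unfolding Tr_def using z sigma_order[OF z]
    by (intro cyclic_shift[of "\<lambda>k. s k z"]) (auto simp del: funpow.simps)
  finally show ?thesis using sigma_fixes z by simp
qed

lemma Tr_const_mult: "c \<in> K \<Longrightarrow> z \<in> carrier L \<Longrightarrow> Tr (c \<otimes> z) = c \<otimes> Tr z"
  unfolding Tr_def using K_carr[of c]
  by (simp add: s_mult s_fixes finsum_rdistr cong: finsum_cong) 

lemma Tr_finsum:
  assumes "finite A" "f \<in> A \<rightarrow> carrier L"
  shows "Tr (\<Oplus>i\<in>A. f i) = (\<Oplus>i\<in>A. Tr (f i))"
proof -
  have "Tr (\<Oplus>i\<in>A. f i) = (\<Oplus>k\<in>{..<p}. \<Oplus>i\<in>A. s k (f i))"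
    unfolding Tr_def using assms s_finsum[OF assms(2)] by simp
  also have "\<dots> = (\<Oplus>i\<in>A. Tr (f i))"
    unfolding Tr_def using assms by (intro finsum_swap) (auto intro: s_closed funcset_mem)
  finally show ?thesis .
qed

text \<open>After exchanging the sums over \<open>j\<close> and over the conjugates only the identity contributes.\<close>

lemma coordinates_expand:
  assumes "finite J" and a: "\<And>j. j \<in> J \<Longrightarrow> a j \<in> carrier L" and b: "\<And>j. j \<in> J \<Longrightarrow> b j \<in> carrier L"
    and ab: "\<And>k. k < p \<Longrightarrow> (\<Oplus>j\<in>J. a j \<otimes> s k (b j)) = (if k = 0 then \<one> else \<zero>)"
    and z: "z \<in> carrier L"
  shows "(\<Oplus>j\<in>J. a j \<otimes> Tr (b j \<otimes> z)) = z"
proof -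
  have "(\<Oplus>j\<in>J. a j \<otimes> Tr (b j \<otimes> z)) = (\<Oplus>j\<in>J. \<Oplus>k\<in>{..<p}. a j \<otimes> s k (b j) \<otimes> s k z)"
    using a b z unfolding Tr_def
    by (intro finsum_cong') (auto simp: finsum_rdistr s_mult m_assoc intro!: finsum_closed finsum_cong')
  also have "\<dots> = (\<Oplus>k\<in>{..<p}. \<Oplus>j\<in>J. a j \<otimes> s k (b j) \<otimes> s k z)"
    using assms by (intro finsum_swap) auto
  also have "\<dots> = (\<Oplus>k\<in>{..<p}. (\<Oplus>j\<in>J. a j \<otimes> s k (b j)) \<otimes> s k z)"
    using assms(1,5) a b
    by (intro finsum_cong' refl finsum_ldistr[symmetric]) (auto intro!: finsum_closed)
  also have "\<dots> = (\<Oplus>k\<in>{..<p}. if 0 = k then z else \<zero>)"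
    using ab z by (intro finsum_cong') auto
  also have "\<dots> = z" using z p_gt_1 by (intro finsum_singleton) auto
  finally show ?thesis .
qed

text \<open>In \<open>1 = \<Sum> a\<^sub>j Tr (x\<^sup>j)\<close> some term has value at most \<open>0\<close>, so that the trace of some \<open>x\<^sup>j\<close> has small
  value; dividing \<open>x\<^sup>j\<close> by its trace gives \<open>y\<close>.\<close>

lemma trace_one:
  assumes x: "x \<in> ge 0" "x \<notin> K"
  shows "\<exists>y\<in>ge (- nmul (p - 1) (v (D x))). Tr y = \<one>"
proof -
  let ?B = "nmul (p - 1) (v (D x))"
  have xc: "x \<in> carrier L" using x(1) ge_carrier by blast
  obtain a where a: "\<And>j. a j \<in> ge (- ?B)"
    "\<And>k. k < p \<Longrightarrow> (\<Oplus>j\<in>{..<p}. a j \<otimes> s k (x [^] j)) = (if k = 0 then \<one> else \<zero>)"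
    using galois_coordinates[OF x] by blast
  have one: "(\<Oplus>j\<in>{..<p}. a j \<otimes> Tr (x [^] j \<otimes> \<one>)) = \<one>"
    using coordinates_expand[of "{..<p}" a "\<lambda>j. x [^] j" \<one>] a ge_carrier xc by auto
  have "\<exists>j. a j \<otimes> Tr (x [^] j) \<notin> gt 0"
  proof (rule ccontr)
    assume "\<nexists>j. a j \<otimes> Tr (x [^] j) \<notin> gt 0"
    then have gt: "a j \<otimes> Tr (x [^] j) \<in> gt 0" for j by blast
    have "(\<Oplus>j\<in>J. a j \<otimes> Tr (x [^] j)) \<in> gt 0" if "finite J" for J :: "nat set"
      using that
    proof induction
      case (insert j J)
      have "(\<Oplus>j\<in>insert j J. a j \<otimes> Tr (x [^] j)) = a j \<otimes> Tr (x [^] j) \<oplus> (\<Oplus>j\<in>J. a j \<otimes> Tr (x [^] j))"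
        using insert gt gt_carrier by (intro finsum_insert) auto
      then show ?case using gt_add[OF gt insert.IH, of j] by simp
    qed (simp add: zero_gt)
    from this[of "{..<p}"] have "\<one> \<in> gt 0" using one xc by simp
    then show False using v_one by (simp add: gt_def)
  qed
  then obtain j where j: "a j \<otimes> Tr (x [^] j) \<notin> gt 0" by blast
  let ?b = "x [^] j" and ?t = "Tr (x [^] j)"
  have b: "?b \<in> carrier L" "?b \<in> ge 0" using xc ge_pow[OF x(1)] by auto
  have t: "?t \<in> K" "?t \<in> carrier L" using Tr_in_K b by auto
  have t0: "?t \<noteq> \<zero>" using j ge_carrier[OF a(1)] zero_gt by auto
  have it: "inv ?t \<in> K" "inv ?t \<in> carrier L" using K_inv[OF t(1) t0] K_carr by auto
  have "v ?t \<le> ?B"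
  proof (rule ccontr)
    assume "\<not> v ?t \<le> ?B"
    then have "?t \<in> gt ?B" using t by (simp add: gt_def not_le)
    from gt_mult[OF a(1)[of j] this] show False using j by simp
  qed
  then have "inv ?t \<in> ge (- ?B)" using v_inv[OF t(2) t0] by (simp add: ge_def)
  from ge_mult[OF this b(2)] have "inv ?t \<otimes> ?b \<in> ge (- ?B)" by simp
  moreover have "Tr (inv ?t \<otimes> ?b) = \<one>" using Tr_const_mult[OF it(1) b(1)] v_inv[OF t(2) t0] by simp
  ultimately show ?thesis by blast
qed

text \<open>A trace \<open>Tr (b y)\<close> with \<open>Tr y = 1\<close> is a weighted mean of the conjugates of \<open>b\<close>, hence as close to
  \<open>b\<close> as the conjugates are, up to the value of \<open>y\<close>.\<close>

lemma approximate_by_trace: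
  assumes b: "b \<in> carrier L" "b \<notin> K" and y: "y \<in> ge \<gamma>" "Tr y = \<one>"
  shows "b \<ominus> Tr (b \<otimes> y) \<in> ge (v (D b) + \<gamma>)"
proof -
  have yc: "y \<in> carrier L" using y(1) ge_carrier by blast
  have "Tr (b \<otimes> y) \<ominus> b = (\<Oplus>k\<in>{..<p}. (s k b \<ominus> b) \<otimes> s k y)"
  proof -
    have "(\<Oplus>k\<in>{..<p}. (s k b \<ominus> b) \<otimes> s k y) = (\<Oplus>k\<in>{..<p}. s k (b \<otimes> y) \<oplus> (\<ominus> b) \<otimes> s k y)"
      using b(1) yc by (intro finsum_cong') (auto simp: s_mult a_minus_def l_distr)
    also have "\<dots> = Tr (b \<otimes> y) \<oplus> (\<Oplus>k\<in>{..<p}. (\<ominus> b) \<otimes> s k y)"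
      unfolding Tr_def using b(1) yc by (intro finsum_addf) auto
    also have "(\<Oplus>k\<in>{..<p}. (\<ominus> b) \<otimes> s k y) = (\<ominus> b) \<otimes> Tr y"
      unfolding Tr_def using b(1) yc by (intro finsum_rdistr[symmetric]) auto
    finally show ?thesis using y(2) b(1) by (simp add: a_minus_def)
  qed
  moreover have "(\<Oplus>k\<in>{..<p}. (s k b \<ominus> b) \<otimes> s k y) \<in> ge (v (D b) + \<gamma>)"
  proof (rule ge_finsum)
    fix k assume k: "k \<in> {..<p}"
    have "s k b \<ominus> b \<in> ge (v (D b))"
    proof (cases "k = 0")
      case True
      then show ?thesis using b(1) by (simp add: a_minus_def r_neg zero_ge)
    next
      case False
      then show ?thesis using v_s_minus_self[OF b, of k] k b(1) by (auto simp: ge_def)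
    qed
    then show "(s k b \<ominus> b) \<otimes> s k y \<in> ge (v (D b) + \<gamma>)" by (intro ge_mult s_ge y)
  qed simp
  ultimately have "\<ominus> (Tr (b \<otimes> y) \<ominus> b) \<in> ge (v (D b) + \<gamma>)" by (auto intro: ge_neg)
  moreover have "\<ominus> (Tr (b \<otimes> y) \<ominus> b) = b \<ominus> Tr (b \<otimes> y)"
    using b(1) Tr_closed[of "b \<otimes> y"] yc by (simp add: a_minus_def minus_add a_comm)
  ultimately show ?thesis by simp
qed

end

section \<open>Differentials of the valuation ring\<close>

lemma (in cring) subring_finsum:
  assumes H: "subring H R" and "finite J" "\<And>j. j \<in> J \<Longrightarrow> f j \<in> H"
  shows "finsum (R\<lparr>carrier := H\<rparr>) f J = finsum R f J"
  using assms(2,3)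
proof (induction J)
  case empty
  interpret H: ring "R\<lparr>carrier := H\<rparr>" using subring_is_ring[OF H] .
  show ?case by simp
next
  case (insert x J)
  interpret H: ring "R\<lparr>carrier := H\<rparr>" using subring_is_ring[OF H] .
  have "finsum (R\<lparr>carrier := H\<rparr>) f (insert x J) = f x \<oplus> finsum (R\<lparr>carrier := H\<rparr>) f J"
    using insert by (subst H.finsum_insert) auto
  also have "\<dots> = finsum R f (insert x J)"
    using insert subringE(1)[OF H] by (subst finsum_insert) auto
  finally show ?case .
qed

lemma (in cring) additive_defect:
  "b' \<in> carrier R \<Longrightarrow> c' \<in> carrier R \<Longrightarrow> b \<in> carrier R \<Longrightarrow> c \<in> carrier R \<Longrightarrow>
   ((b' \<oplus> c') \<ominus> (b \<oplus> c)) \<ominus> ((b' \<ominus> b) \<oplus> (c' \<ominus> c)) = \<zero>"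
proof - qed algebra

lemma (in cring) leibniz_defect:
  "b' \<in> carrier R \<Longrightarrow> c' \<in> carrier R \<Longrightarrow> b \<in> carrier R \<Longrightarrow> c \<in> carrier R \<Longrightarrow>
   (b' \<otimes> c' \<ominus> b \<otimes> c) \<ominus> (b \<otimes> (c' \<ominus> c) \<oplus> c \<otimes> (b' \<ominus> b)) = (b' \<ominus> b) \<otimes> (c' \<ominus> c)"
proof - qed algebra

lemma (in module) smult_finsum_left:
  assumes "finite J" "f \<in> J \<rightarrow> carrier R" "m \<in> carrier M"
  shows "(\<Oplus>j\<in>J. f j) \<odot>\<^bsub>M\<^esub> m = (\<Oplus>\<^bsub>M\<^esub>j\<in>J. f j \<odot>\<^bsub>M\<^esub> m)"
  using assms(1,2)
proof (induction J)
  case (insert x J)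
  then show ?case using assms(3) by (simp add: Pi_def smult_l_distr)
qed (use assms(3) in simp)

lemma (in module) additive_finsum:
  assumes d: "\<And>b. b \<in> carrier R \<Longrightarrow> d b \<in> carrier M"
    and d_add: "\<And>b c. b \<in> carrier R \<Longrightarrow> c \<in> carrier R \<Longrightarrow> d (b \<oplus> c) = d b \<oplus>\<^bsub>M\<^esub> d c"
    and J: "finite J" "f \<in> J \<rightarrow> carrier R"
  shows "d (\<Oplus>j\<in>J. f j) = (\<Oplus>\<^bsub>M\<^esub>j\<in>J. d (f j))"
  using J
proof (induction J)
  case empty
  have "d \<zero> \<oplus>\<^bsub>M\<^esub> d \<zero> = d \<zero> \<oplus>\<^bsub>M\<^esub> \<zero>\<^bsub>M\<^esub>" using d d_add[of \<zero> \<zero>] by simp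
  then show ?case using d by (simp del: M.r_zero)
next
  case (insert x J)
  then have "(\<Oplus>j\<in>J. f j) \<in> carrier R" "f x \<in> carrier R" by (auto intro!: R.finsum_closed)
  then show ?case using insert d by (simp add: Pi_def d_add)
qed

text \<open>The tensor \<open>\<Sum> a\<^sub>j \<otimes> b\<^sub>j\<close> plays the role of \<open>e\<close> times a separability idempotent.  The sum of the
  \<open>a\<^sub>i e d(b\<^sub>i w)\<close> is linear in \<open>w\<close>, because \<open>e d(b\<^sub>i w)\<close> can be expanded by \<open>e z = \<Sum> a\<^sub>j t(b\<^sub>j z)\<close>.  By the
  Leibniz rule it is also the sum of \<open>e\<^sup>2 dw\<close> and of \<open>w\<close> times its value at \<open>1\<close>.  Hence
  \<open>e\<^sup>2 dw = 0\<close>.\<close>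

lemma (in module) derivation_killed_by_coordinates:
  assumes d: "\<And>b. b \<in> carrier R \<Longrightarrow> d b \<in> carrier M"
    and d_add: "\<And>b c. b \<in> carrier R \<Longrightarrow> c \<in> carrier R \<Longrightarrow> d (b \<oplus> c) = d b \<oplus>\<^bsub>M\<^esub> d c"
    and d_mult: "\<And>b c. b \<in> carrier R \<Longrightarrow> c \<in> carrier R \<Longrightarrow>
      d (b \<otimes> c) = b \<odot>\<^bsub>M\<^esub> d c \<oplus>\<^bsub>M\<^esub> c \<odot>\<^bsub>M\<^esub> d b"
    and e: "e \<in> carrier R" "d e = \<zero>\<^bsub>M\<^esub>"
    and t: "\<And>z. z \<in> carrier R \<Longrightarrow> t z \<in> carrier R" "\<And>z. z \<in> carrier R \<Longrightarrow> d (t z) = \<zero>\<^bsub>M\<^esub>"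
    and J: "finite J" and a: "\<And>j. j \<in> J \<Longrightarrow> a j \<in> carrier R" and b: "\<And>j. j \<in> J \<Longrightarrow> b j \<in> carrier R"
    and ab: "(\<Oplus>j\<in>J. a j \<otimes> b j) = e"
    and expand: "\<And>z. z \<in> carrier R \<Longrightarrow> (\<Oplus>j\<in>J. a j \<otimes> t (b j \<otimes> z)) = e \<otimes> z"
    and w: "w \<in> carrier R"
  shows "(e \<otimes> e) \<odot>\<^bsub>M\<^esub> d w = \<zero>\<^bsub>M\<^esub>"
proof -
  have ed: "e \<odot>\<^bsub>M\<^esub> d z = (\<Oplus>\<^bsub>M\<^esub>j\<in>J. t (b j \<otimes> z) \<odot>\<^bsub>M\<^esub> d (a j))" if z: "z \<in> carrier R" for z
  proof -
    have "d (e \<otimes> z) = (\<Oplus>\<^bsub>M\<^esub>j\<in>J. d (a j \<otimes> t (b j \<otimes> z)))"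
      unfolding expand[OF z, symmetric] using J a b t z by (intro additive_finsum d d_add) auto
    also have "\<dots> = (\<Oplus>\<^bsub>M\<^esub>j\<in>J. t (b j \<otimes> z) \<odot>\<^bsub>M\<^esub> d (a j))"
      using a b t z d by (intro M.finsum_cong') (auto simp: d_mult)
    finally show ?thesis using e z d by (simp add: d_mult)
  qed
  define \<Theta> where "\<Theta> = (\<Oplus>\<^bsub>M\<^esub>j\<in>J. (e \<otimes> b j) \<odot>\<^bsub>M\<^esub> d (a j))"
  have \<Theta>: "\<Theta> \<in> carrier M" unfolding \<Theta>_def using b e a d by (intro M.finsum_closed) auto
  have U: "(\<Oplus>\<^bsub>M\<^esub>i\<in>J. a i \<odot>\<^bsub>M\<^esub> (e \<odot>\<^bsub>M\<^esub> d (b i \<otimes> z))) = z \<odot>\<^bsub>M\<^esub> \<Theta>" if z: "z \<in> carrier R" for z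
  proof -
    have "(\<Oplus>\<^bsub>M\<^esub>i\<in>J. a i \<odot>\<^bsub>M\<^esub> (e \<odot>\<^bsub>M\<^esub> d (b i \<otimes> z))) =
      (\<Oplus>\<^bsub>M\<^esub>i\<in>J. \<Oplus>\<^bsub>M\<^esub>j\<in>J. (a i \<otimes> t (b i \<otimes> (b j \<otimes> z))) \<odot>\<^bsub>M\<^esub> d (a j))"
    proof (intro M.finsum_cong' refl)
      fix i assume i: "i \<in> J"
      have "a i \<odot>\<^bsub>M\<^esub> (e \<odot>\<^bsub>M\<^esub> d (b i \<otimes> z)) =
        (\<Oplus>\<^bsub>M\<^esub>j\<in>J. a i \<odot>\<^bsub>M\<^esub> (t (b j \<otimes> (b i \<otimes> z)) \<odot>\<^bsub>M\<^esub> d (a j)))"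
        using i a b z t d J by (subst ed) (auto intro!: finsum_smult_ldistr)
      also have "\<dots> = (\<Oplus>\<^bsub>M\<^esub>j\<in>J. (a i \<otimes> t (b i \<otimes> (b j \<otimes> z))) \<odot>\<^bsub>M\<^esub> d (a j))"
        using i a b z t d by (intro M.finsum_cong') (auto simp: smult_assoc1 R.m_lcomm)
      finally show "a i \<odot>\<^bsub>M\<^esub> (e \<odot>\<^bsub>M\<^esub> d (b i \<otimes> z)) =
        (\<Oplus>\<^bsub>M\<^esub>j\<in>J. (a i \<otimes> t (b i \<otimes> (b j \<otimes> z))) \<odot>\<^bsub>M\<^esub> d (a j))" .
    qed (use a b z t d in \<open>auto intro!: M.finsum_closed\<close>)
    also have "\<dots> = (\<Oplus>\<^bsub>M\<^esub>j\<in>J. \<Oplus>\<^bsub>M\<^esub>i\<in>J. (a i \<otimes> t (b i \<otimes> (b j \<otimes> z))) \<odot>\<^bsub>M\<^esub> d (a j))"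
      using J a b z t d by (intro M.finsum_swap) auto
    also have "\<dots> = (\<Oplus>\<^bsub>M\<^esub>j\<in>J. z \<odot>\<^bsub>M\<^esub> ((e \<otimes> b j) \<odot>\<^bsub>M\<^esub> d (a j)))"
    proof (intro M.finsum_cong' refl)
      fix j assume j: "j \<in> J"
      have "(\<Oplus>\<^bsub>M\<^esub>i\<in>J. (a i \<otimes> t (b i \<otimes> (b j \<otimes> z))) \<odot>\<^bsub>M\<^esub> d (a j)) =
        (\<Oplus>i\<in>J. a i \<otimes> t (b i \<otimes> (b j \<otimes> z))) \<odot>\<^bsub>M\<^esub> d (a j)"
        using J a b z t d j by (intro smult_finsum_left[symmetric]) auto
      also have "\<dots> = (z \<otimes> (e \<otimes> b j)) \<odot>\<^bsub>M\<^esub> d (a j)"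
        using expand[of "b j \<otimes> z"] b z j e by (simp add: R.m_ac)
      also have "\<dots> = z \<odot>\<^bsub>M\<^esub> ((e \<otimes> b j) \<odot>\<^bsub>M\<^esub> d (a j))"
        using z e b a d j by (simp add: smult_assoc1)
      finally show "(\<Oplus>\<^bsub>M\<^esub>i\<in>J. (a i \<otimes> t (b i \<otimes> (b j \<otimes> z))) \<odot>\<^bsub>M\<^esub> d (a j)) =
        z \<odot>\<^bsub>M\<^esub> ((e \<otimes> b j) \<odot>\<^bsub>M\<^esub> d (a j))" .
    qed (use a b z e d in auto)
    also have "\<dots> = z \<odot>\<^bsub>M\<^esub> \<Theta>"
      unfolding \<Theta>_def using a b z e d J by (intro finsum_smult_ldistr[symmetric]) auto
    finally show ?thesis .
  qed
  have U1: "(\<Oplus>\<^bsub>M\<^esub>i\<in>J. a i \<odot>\<^bsub>M\<^esub> (e \<odot>\<^bsub>M\<^esub> d (b i))) = \<Theta>"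
  proof -
    have "(\<Oplus>\<^bsub>M\<^esub>i\<in>J. a i \<odot>\<^bsub>M\<^esub> (e \<odot>\<^bsub>M\<^esub> d (b i))) = (\<Oplus>\<^bsub>M\<^esub>i\<in>J. a i \<odot>\<^bsub>M\<^esub> (e \<odot>\<^bsub>M\<^esub> d (b i \<otimes> \<one>)))"
      using a b e d by (intro M.finsum_cong') auto
    then show ?thesis using U[of \<one>] \<Theta> by simp
  qed
  have dw: "d w \<in> carrier M" using d w .
  have "w \<odot>\<^bsub>M\<^esub> \<Theta> = (\<Oplus>\<^bsub>M\<^esub>i\<in>J. (e \<otimes> (a i \<otimes> b i)) \<odot>\<^bsub>M\<^esub> d w \<oplus>\<^bsub>M\<^esub> w \<odot>\<^bsub>M\<^esub> (a i \<odot>\<^bsub>M\<^esub> (e \<odot>\<^bsub>M\<^esub> d (b i))))"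
    unfolding U[OF w, symmetric]
  proof (intro M.finsum_cong' refl)
    fix i assume i: "i \<in> J"
    note c = a[OF i] b[OF i] e(1) w dw d[OF b[OF i]]
    have "a i \<odot>\<^bsub>M\<^esub> (e \<odot>\<^bsub>M\<^esub> d (b i \<otimes> w)) =
      (a i \<otimes> e \<otimes> b i) \<odot>\<^bsub>M\<^esub> d w \<oplus>\<^bsub>M\<^esub> (a i \<otimes> e \<otimes> w) \<odot>\<^bsub>M\<^esub> d (b i)"
      using c by (simp add: d_mult smult_r_distr smult_assoc1)
    also have "a i \<otimes> e \<otimes> b i = e \<otimes> (a i \<otimes> b i)" using c by (simp add: R.m_ac)
    also have "a i \<otimes> e \<otimes> w = w \<otimes> a i \<otimes> e" using c by (simp add: R.m_ac)
    finally show "a i \<odot>\<^bsub>M\<^esub> (e \<odot>\<^bsub>M\<^esub> d (b i \<otimes> w)) =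
      (e \<otimes> (a i \<otimes> b i)) \<odot>\<^bsub>M\<^esub> d w \<oplus>\<^bsub>M\<^esub> w \<odot>\<^bsub>M\<^esub> (a i \<odot>\<^bsub>M\<^esub> (e \<odot>\<^bsub>M\<^esub> d (b i)))"
      using c by (simp add: smult_assoc1)
  qed (use a b e w dw d in auto)
  also have "\<dots> = (\<Oplus>\<^bsub>M\<^esub>i\<in>J. (e \<otimes> (a i \<otimes> b i)) \<odot>\<^bsub>M\<^esub> d w) \<oplus>\<^bsub>M\<^esub>
      (\<Oplus>\<^bsub>M\<^esub>i\<in>J. w \<odot>\<^bsub>M\<^esub> (a i \<odot>\<^bsub>M\<^esub> (e \<odot>\<^bsub>M\<^esub> d (b i))))"
    using a b e w dw d by (intro M.finsum_addf) auto
  also have "(\<Oplus>\<^bsub>M\<^esub>i\<in>J. (e \<otimes> (a i \<otimes> b i)) \<odot>\<^bsub>M\<^esub> d w) = (\<Oplus>i\<in>J. e \<otimes> (a i \<otimes> b i)) \<odot>\<^bsub>M\<^esub> d w"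
    using a b e dw J by (intro smult_finsum_left[symmetric]) auto
  also have "(\<Oplus>i\<in>J. e \<otimes> (a i \<otimes> b i)) = e \<otimes> e"
    unfolding ab[symmetric] using a b e J ab by (subst R.finsum_rdistr) auto
  also have "(\<Oplus>\<^bsub>M\<^esub>i\<in>J. w \<odot>\<^bsub>M\<^esub> (a i \<odot>\<^bsub>M\<^esub> (e \<odot>\<^bsub>M\<^esub> d (b i)))) = w \<odot>\<^bsub>M\<^esub> \<Theta>"
    unfolding U1[symmetric] using a b e w d J by (intro finsum_smult_ldistr[symmetric]) auto
  finally have "w \<odot>\<^bsub>M\<^esub> \<Theta> = (e \<otimes> e) \<odot>\<^bsub>M\<^esub> d w \<oplus>\<^bsub>M\<^esub> w \<odot>\<^bsub>M\<^esub> \<Theta>" .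
  then show ?thesis using w \<Theta> e dw by (metis M.add.r_cancel_one' smult_closed R.m_closed)
qed

context immediate_cyclic
begin

abbreviation OK where "OK \<equiv> val_ring L v K"
abbreviation \<Omega> where "\<Omega> \<equiv> kaehler OL OK"

lemma OK_iff: "c \<in> OK \<longleftrightarrow> c \<in> K \<and> c \<in> ge 0"
  using K_carr by (auto simp: val_ring_def ge_def)

lemma OK_subset: "OK \<subseteq> carrier OL"
  unfolding OL_carrier using OK_iff by blast

abbreviation diff where "diff \<equiv> cring.differential OL OK"

lemma differential_killed:
  assumes x: "x \<in> ge 0" "x \<notin> K" and e: "e \<in> K" "e \<in> ge (nmul (p - 1) (v (D x)))" and w: "w \<in> ge 0"
  shows "(e \<otimes> e) \<odot>\<^bsub>\<Omega>\<^esub> diff w = \<zero>\<^bsub>\<Omega>\<^esub>"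
proof -
  interpret B: cring OL by (rule OL_cring)
  interpret \<Omega>: module OL \<Omega> by (rule B.kaehler_is_module[OF OK_subset])
  let ?B = "nmul (p - 1) (v (D x))"
  have xc: "x \<in> carrier L" "e \<in> carrier L" using x(1) e ge_carrier by auto
  obtain a where a: "\<And>j. a j \<in> ge (- ?B)"
    "\<And>k. k < p \<Longrightarrow> (\<Oplus>j\<in>{..<p}. a j \<otimes> s k (x [^] j)) = (if k = 0 then \<one> else \<zero>)"
    using galois_coordinates[OF x] by blast
  have ac: "a j \<in> carrier L" for j using a(1) ge_carrier by blast
  have ea: "e \<otimes> a j \<in> ge 0" for j using ge_mult[OF e(2) a(1)] by simp
  have xj: "x [^] j \<in> ge 0" for j :: nat using ge_pow[OF x(1)] .
  have D_pos: "0 \<le> v (D x)"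
  proof -
    have "D x \<noteq> \<zero>" using D_eq_zero_iff[OF xc(1)] x(2) by blast
    then show ?thesis using D_gt[OF x(1)] unfolding gt_def by force
  qed
  have e0: "e \<in> ge 0" using ge_mono[OF e(2) nmul_nonneg[OF D_pos]] .
  have sum_eq: "(\<Oplus>\<^bsub>OL\<^esub>j\<in>J. f j) = (\<Oplus>j\<in>J. f j)" if "finite J" "\<And>j. j \<in> J \<Longrightarrow> f j \<in> ge 0" for f and J :: "nat set"
    using subring_finsum[OF val_ring_subring that] by (simp add: val_ring_eq)
  have mult0: "y \<otimes> z \<in> ge 0" if "y \<in> ge 0" "z \<in> ge 0" for y z using ge_mult[OF that] by simp
  have "(e \<otimes>\<^bsub>OL\<^esub> e) \<odot>\<^bsub>\<Omega>\<^esub> diff w = \<zero>\<^bsub>\<Omega>\<^esub>"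
  proof (rule \<Omega>.derivation_killed_by_coordinates[of diff e Tr "{..<p}" "\<lambda>j. e \<otimes> a j" "\<lambda>j. x [^] j"])
    show "diff b \<in> carrier \<Omega>" for b using B.differential_closed[OF OK_subset] .
    show "diff (b \<oplus>\<^bsub>OL\<^esub> c) = diff b \<oplus>\<^bsub>\<Omega>\<^esub> diff c" if "b \<in> carrier OL" "c \<in> carrier OL" for b c
      using B.differential_add[OF OK_subset that] .
    show "diff (b \<otimes>\<^bsub>OL\<^esub> c) = b \<odot>\<^bsub>\<Omega>\<^esub> diff c \<oplus>\<^bsub>\<Omega>\<^esub> c \<odot>\<^bsub>\<Omega>\<^esub> diff b" if "b \<in> carrier OL" "c \<in> carrier OL" for b c
      using B.differential_mult[OF OK_subset that] .
    show "e \<in> carrier OL" "w \<in> carrier OL" unfolding OL_carrier using e0 w by auto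
    show "diff e = \<zero>\<^bsub>\<Omega>\<^esub>" using B.differential_base[OF OK_subset] OK_iff e(1) e0 by blast
    show "Tr z \<in> carrier OL" if "z \<in> carrier OL" for z using that Tr_ge unfolding OL_carrier by blast
    show "diff (Tr z) = \<zero>\<^bsub>\<Omega>\<^esub>" if "z \<in> carrier OL" for z
      using that B.differential_base[OF OK_subset] OK_iff Tr_ge Tr_in_K ge_carrier unfolding OL_carrier by blast
    show "e \<otimes> a j \<in> carrier OL" "x [^] j \<in> carrier OL" for j
      unfolding OL_carrier using ea xj by auto
    have "(\<Oplus>j\<in>{..<p}. e \<otimes> a j \<otimes> x [^] j) = e \<otimes> (\<Oplus>j\<in>{..<p}. a j \<otimes> x [^] j)"
      using ac xc by (subst finsum_rdistr) (auto simp: m_assoc intro!: finsum_cong')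
    also have "\<dots> = e" using a(2)[of 0] p_gt_1 xc by simp
    finally show "(\<Oplus>\<^bsub>OL\<^esub>j\<in>{..<p}. (e \<otimes> a j) \<otimes>\<^bsub>OL\<^esub> x [^] j) = e"
      using sum_eq[of "{..<p}" "\<lambda>j. e \<otimes> a j \<otimes> x [^] j"] mult0[OF ea xj] by simp
    fix z assume "z \<in> carrier OL"
    then have z: "z \<in> ge 0" "z \<in> carrier L" unfolding OL_carrier using ge_carrier by auto
    have "(\<Oplus>j\<in>{..<p}. e \<otimes> a j \<otimes> Tr (x [^] j \<otimes> z)) = e \<otimes> (\<Oplus>j\<in>{..<p}. a j \<otimes> Tr (x [^] j \<otimes> z))"
      using ac xc z by (subst finsum_rdistr) (auto simp: m_assoc intro!: finsum_cong')
    also have "(\<Oplus>j\<in>{..<p}. a j \<otimes> Tr (x [^] j \<otimes> z)) = z"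
      using coordinates_expand[of "{..<p}" a "\<lambda>j. x [^] j" z] a ac xc z by auto
    finally show "(\<Oplus>\<^bsub>OL\<^esub>j\<in>{..<p}. (e \<otimes> a j) \<otimes>\<^bsub>OL\<^esub> Tr (x [^] j \<otimes>\<^bsub>OL\<^esub> z)) = e \<otimes>\<^bsub>OL\<^esub> z"
      using sum_eq[of "{..<p}" "\<lambda>j. e \<otimes> a j \<otimes> Tr (x [^] j \<otimes> z)"] mult0[OF ea Tr_ge[OF mult0[OF xj z(1)]]] by simp
  qed simp
  then show ?thesis by simp
qed

text \<open>The element \<open>b\<close> is so close to a trace \<open>c \<in> K\<close> that \<open>b - c\<close> is divisible by an \<open>e\<^sup>2\<close> that annihilates
  all differentials.\<close>

lemma kaehler_trivial_if_halving:
  assumes half: "halving Sig"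
  shows "carrier \<Omega> = {\<zero>\<^bsub>\<Omega>\<^esub>}"
proof -
  interpret B: cring OL by (rule OL_cring)
  interpret \<Omega>: module OL \<Omega> by (rule B.kaehler_is_module[OF OK_subset])
  show ?thesis
  proof (rule B.kaehler_trivialI[OF OK_subset])
    fix b assume "b \<in> carrier OL"
    then have b: "b \<in> ge 0" "b \<in> carrier L" unfolding OL_carrier using ge_carrier by auto
    show "diff b = \<zero>\<^bsub>\<Omega>\<^esub>"
    proof (cases "b \<in> K")
      case True
      then show ?thesis using B.differential_base[OF OK_subset] OK_iff b by blast
    next
      case False
      define \<alpha> where "\<alpha> = v (D b)"
      have "\<alpha> \<in> Sig" using Sigma_iff b False \<alpha>_def by blast
      \<comment> \<open>One multiple \<open>(p - 1) \<beta>\<close> is lost in the approximation, two are needed for \<open>e\<^sup>2\<close>.\<close>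
      then obtain \<beta> where \<beta>: "\<beta> \<in> Sig" "nmul (3 * (p - 1)) \<beta> \<le> \<alpha>"
        using halving_nmul[OF half Sigma_pos] by blast
      obtain x where x: "x \<in> ge 0" "x \<notin> K" "v (D x) = \<beta>" using \<beta>(1) Sigma_iff by blast
      let ?B = "nmul (p - 1) \<beta>"
      have "3 * (p - 1) = (p - 1) + ((p - 1) + (p - 1))" by simp
      then have B3: "?B + (?B + ?B) \<le> \<alpha>" using \<beta>(2) by (simp only: nmul_add)
      obtain y where y: "y \<in> ge (- ?B)" "Tr y = \<one>" using trace_one[OF x(1,2)] x(3) by blast
      have "?B \<in> \<Gamma>" using nmul_in_subgroup[OF value_group_convex] \<beta>(1) Sigma_subset by blast
      then obtain e where e: "e \<in> K" "e \<noteq> \<zero>" "v e = ?B" by (rule KvalE)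
      have ec: "e \<in> carrier L" "e \<in> ge ?B" using e K_carr by (auto simp: ge_def)
      have eep: "e \<otimes> e \<in> carrier L" "e \<otimes> e \<noteq> \<zero>" "v (e \<otimes> e) = ?B + ?B"
        using ec e v_mult[of e e] by (auto simp: integral_iff)
      have e2: "inv (e \<otimes> e) \<in> carrier L" "(e \<otimes> e) \<otimes> inv (e \<otimes> e) = \<one>" "inv (e \<otimes> e) \<in> ge (- (?B + ?B))"
        using v_inv[OF eep(1,2)] eep(3) by (auto simp: ge_def)
      define c where "c = Tr (b \<otimes> y)"
      have c: "c \<in> K" "c \<in> carrier L" unfolding c_def using Tr_in_K b(2) y(1) ge_carrier by auto
      have "b \<ominus> c \<in> ge (\<alpha> + - ?B)" unfolding c_def \<alpha>_def by (rule approximate_by_trace[OF b(2) False y])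
      moreover have "?B + ?B \<le> \<alpha> + - ?B" using B3 by (simp add: le_diff_eq add.commute)
      ultimately have bc: "b \<ominus> c \<in> ge (?B + ?B)" by (rule ge_mono)
      define b' where "b' = inv (e \<otimes> e) \<otimes> (b \<ominus> c)"
      have b': "b' \<in> ge 0" unfolding b'_def using ge_mult[OF e2(3) bc] by simp
      have ee0: "e \<otimes> e \<in> ge 0"
        using eep Sigma_pos[OF \<beta>(1)] nmul_nonneg[of \<beta> "p - 1"] by (auto simp: ge_def)
      have bc0: "b \<ominus> c \<in> ge 0" using ge_mono[OF bc] eep(3) ee0 eep(2) by (auto simp: ge_def)
      have "b \<ominus> (b \<ominus> c) \<in> ge 0" using ge_minus[OF b(1) bc0] .
      moreover have "b \<ominus> (b \<ominus> c) = c" using b(2) c(2) by (simp add: a_minus_def minus_add r_neg2)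
      ultimately have cO: "c \<in> OK" using OK_iff c by simp
      have eeO: "e \<otimes> e \<in> OK" using OK_iff ee0 K_subring(6) e by simp
      have "(e \<otimes> e) \<otimes> b' = b \<ominus> c"
        unfolding b'_def using e2 eep(1) b c by (simp add: m_assoc[symmetric])
      moreover have "c \<oplus> (b \<ominus> c) = b" using b c by (intro add_diff_cancel')
      ultimately have beq: "b = c \<oplus>\<^bsub>OL\<^esub> (e \<otimes> e) \<otimes>\<^bsub>OL\<^esub> b'" by simp
      have carr: "c \<in> carrier OL" "e \<otimes> e \<in> carrier OL" "b' \<in> carrier OL"
        unfolding OL_carrier using b' cO ee0 OK_iff by auto
      have "diff b = diff c \<oplus>\<^bsub>\<Omega>\<^esub> ((e \<otimes> e) \<odot>\<^bsub>\<Omega>\<^esub> diff b' \<oplus>\<^bsub>\<Omega>\<^esub> b' \<odot>\<^bsub>\<Omega>\<^esub> diff (e \<otimes> e))"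
        unfolding beq
        using B.differential_add[OF OK_subset carr(1) B.m_closed[OF carr(2,3)]]
          B.differential_mult[OF OK_subset carr(2,3)] by simp
      also have "\<dots> = \<zero>\<^bsub>\<Omega>\<^esub>"
        using differential_killed[OF x(1,2) e(1) _ b'] ec(2) x(3) carr
          B.differential_base[OF OK_subset cO] B.differential_base[OF OK_subset eeO] by simp
      finally show ?thesis .
    qed
  qed
qed


lemma ramification_ideal_iff:
  "a \<in> ramification_ideal L v \<sigma> \<longleftrightarrow> a \<in> carrier L \<and> (a = \<zero> \<or> v a \<in> Sig)"
  by (auto simp: ramification_ideal_def)

text \<open>\<open>\<sigma> - id\<close> takes values in \<open>I\<close> and is a derivation modulo \<open>I\<^sup>2\<close>, since
  \<open>D (b c) = b D c + c D b + D b D c\<close>.\<close>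

lemma halving_if_kaehler_killed:
  assumes kill: "\<And>a \<omega>. a \<in> gt 0 \<Longrightarrow> \<omega> \<in> carrier \<Omega> \<Longrightarrow> a \<odot>\<^bsub>\<Omega>\<^esub> \<omega> = \<zero>\<^bsub>\<Omega>\<^esub>"
  shows "halving Sig"
proof -
  interpret B: cring OL by (rule OL_cring)
  \<comment> \<open>the values of the nonzero elements of \<open>I\<^sup>2\<close>\<close>
  define S where "S = {\<gamma> \<in> \<Gamma>. \<exists>\<beta>\<in>Sig. \<beta> + \<beta> \<le> \<gamma>}"
  let ?J = "{a \<in> carrier L. a = \<zero> \<or> v a \<in> S}"
  have S_pos: "0 \<le> \<alpha>" if "\<alpha> \<in> S" for \<alpha>
    using that Sigma_pos by (auto simp: S_def intro: order_trans[OF add_nonneg_nonneg] less_imp_le)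
  have ideal: "ideal ?J OL"
    by (rule upset_ideal[OF S_pos]) (auto simp: S_def intro: order_trans)
  have prod_J: "D b \<otimes> D c \<in> ?J" if bc: "b \<in> ge 0" "c \<in> ge 0" for b c
  proof (cases "b \<in> K \<or> c \<in> K")
    case True
    then have "D b = \<zero> \<or> D c = \<zero>" using D_eq_zero_iff ge_carrier[OF bc(1)] ge_carrier[OF bc(2)] by blast
    moreover have "D b \<in> carrier L" "D c \<in> carrier L" using ge_carrier[OF bc(1)] ge_carrier[OF bc(2)] by auto
    ultimately have "D b \<otimes> D c = \<zero>" by (elim disjE) (simp_all only: l_null r_null)
    then show ?thesis by (simp del: mem_Collect_eq) simp
  next
    case False
    have c: "D b \<in> carrier L" "D c \<in> carrier L" using ge_carrier[OF bc(1)] ge_carrier[OF bc(2)] by auto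
    have nz: "D b \<noteq> \<zero>" "D c \<noteq> \<zero>"
      using False D_eq_zero_iff ge_carrier[OF bc(1)] ge_carrier[OF bc(2)] by blast+
    have sig: "v (D b) \<in> Sig" "v (D c) \<in> Sig" using Sigma_iff bc False by blast+
    then have "min (v (D b)) (v (D c)) \<in> Sig" by (simp add: min_def)
    moreover have "min (v (D b)) (v (D c)) + min (v (D b)) (v (D c)) \<le> v (D b) + v (D c)"
      by (intro add_mono) auto
    moreover have "v (D b) + v (D c) \<in> \<Gamma>"
      using convex_subgroupD(3)[OF value_group_convex] sig Sigma_subset by blast
    ultimately have "v (D b \<otimes> D c) \<in> S" unfolding S_def v_mult[OF c nz] by blast
    then show ?thesis using c by blast
  qed
  have zJ: "\<zero> \<in> ?J" by simp
  have key: "a \<otimes> D b \<in> ?J" if a: "a \<in> gt 0" and b: "b \<in> ge 0" for a b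
  proof -
    have ac: "a \<in> carrier OL" and bc: "b \<in> carrier OL"
      unfolding OL_carrier using a b gt_imp_ge by auto
    have mult0: "y \<otimes> z \<in> ge 0" if "y \<in> ge 0" "z \<in> ge 0" for y z using ge_mult[OF that] by simp
    have D0: "D b \<in> ge 0" if "b \<in> ge 0" for b using gt_imp_ge[OF D_gt[OF that]] .
    have "a \<otimes>\<^bsub>OL\<^esub> D b \<in> ?J"
    proof (rule B.annihilates_derivation[OF OK_subset ideal _ _ _ _ ac bc])
      show "D b \<in> carrier OL" if "b \<in> carrier OL" for b using D0 that OL_carrier by blast
      show "a \<odot>\<^bsub>\<Omega>\<^esub> diff b = \<zero>\<^bsub>\<Omega>\<^esub>" by (rule kill[OF a B.differential_closed[OF OK_subset]])
      fix b assume "b \<in> OK"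
      then have "D b = \<zero>" using D_eq_zero_iff OK_iff ge_carrier by blast
      then show "D b \<in> ?J" using zJ by metis
    next
      fix b c assume "b \<in> carrier OL" "c \<in> carrier OL"
      then have bc: "b \<in> ge 0" "c \<in> ge 0" "b \<in> carrier L" "c \<in> carrier L"
        unfolding OL_carrier using ge_carrier by auto
      note sc = sigma_closed[OF bc(3)] sigma_closed[OF bc(4)]
      have "D (b \<oplus> c) \<ominus> (D b \<oplus> D c) = \<zero>"
        using additive_defect[OF sc bc(3,4)] by (simp only: sigma_eqs(1)[OF bc(3,4)])
      moreover have "D (b \<oplus>\<^bsub>OL\<^esub> c) \<ominus>\<^bsub>OL\<^esub> (D b \<oplus>\<^bsub>OL\<^esub> D c) = D (b \<oplus> c) \<ominus> (D b \<oplus> D c)"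
        using OL_minus[OF ge_add[OF D0[OF bc(1)] D0[OF bc(2)]]] OL_minus[OF bc(1)] OL_minus[OF bc(2)]
          OL_minus[OF ge_add[OF bc(1,2)]] by simp
      ultimately show "D (b \<oplus>\<^bsub>OL\<^esub> c) \<ominus>\<^bsub>OL\<^esub> (D b \<oplus>\<^bsub>OL\<^esub> D c) \<in> ?J"
        using zJ by metis
      have "D (b \<otimes> c) \<ominus> (b \<otimes> D c \<oplus> c \<otimes> D b) = D b \<otimes> D c"
        using leibniz_defect[OF sc bc(3,4)] by (simp only: sigma_eqs(2)[OF bc(3,4)])
      moreover have "D (b \<otimes>\<^bsub>OL\<^esub> c) \<ominus>\<^bsub>OL\<^esub> (b \<otimes>\<^bsub>OL\<^esub> D c \<oplus>\<^bsub>OL\<^esub> c \<otimes>\<^bsub>OL\<^esub> D b) =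
          D (b \<otimes> c) \<ominus> (b \<otimes> D c \<oplus> c \<otimes> D b)"
        using OL_minus[OF ge_add[OF mult0[OF bc(1) D0[OF bc(2)]] mult0[OF bc(2) D0[OF bc(1)]]]]
          OL_minus[OF bc(1)] OL_minus[OF bc(2)] OL_minus[OF mult0[OF bc(1,2)]] by simp
      ultimately show "D (b \<otimes>\<^bsub>OL\<^esub> c) \<ominus>\<^bsub>OL\<^esub> (b \<otimes>\<^bsub>OL\<^esub> D c \<oplus>\<^bsub>OL\<^esub> c \<otimes>\<^bsub>OL\<^esub> D b) \<in> ?J"
        using prod_J[OF bc(1,2)] by metis
    qed
    then show ?thesis by simp
  qed
  show ?thesis
    unfolding halving_def
  proof
    fix \<alpha> assume \<alpha>: "\<alpha> \<in> Sig"
    \<comment> \<open>Since \<open>\<Sigma>\<close> has no least element, every element of \<open>I\<close> lies in \<open>\<M>\<^sub>L I\<close>.\<close>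
    obtain \<gamma> where \<gamma>: "\<gamma> \<in> Sig" "\<gamma> < \<alpha>" using Sigma_no_least[OF \<alpha>] by blast
    obtain x where x: "x \<in> ge 0" "x \<notin> K" "v (D x) = \<gamma>" using \<gamma>(1) Sigma_iff by blast
    have "\<alpha> - \<gamma> \<in> \<Gamma>" using convex_subgroupD(5)[OF value_group_convex] \<alpha> \<gamma>(1) Sigma_subset by blast
    then obtain a where a: "a \<in> carrier L" "a \<noteq> \<zero>" "v a = \<alpha> - \<gamma>" by (rule value_groupE)
    have "a \<in> gt 0" using a \<gamma>(2) by (simp add: gt_def)
    then have "a \<otimes> D x \<in> ?J" using key x(1) by blast
    moreover have Dx: "D x \<in> carrier L" "D x \<noteq> \<zero>" using ge_carrier[OF x(1)] x(2) D_eq_zero_iff by auto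
    moreover have "v (a \<otimes> D x) = \<alpha>" using v_mult[OF a(1) Dx(1) a(2) Dx(2)] a(3) x(3) by simp
    ultimately have "\<alpha> \<in> S" using a by (auto simp: integral_iff)
    then show "\<exists>\<beta>\<in>Sig. \<beta> + \<beta> \<le> \<alpha>" unfolding S_def by blast
  qed
qed

end

section \<open>The trace of an immediate cyclic extension\<close>

lemma (in ring) combine_eq_finsum:
  "length Ks = length Us \<Longrightarrow> set Ks \<subseteq> carrier R \<Longrightarrow> set Us \<subseteq> carrier R \<Longrightarrow>
    combine Ks Us = (\<Oplus>i\<in>{..<length Us}. Ks ! i \<otimes> Us ! i)"
proof (induction Ks Us rule: list_induct2)
  case (Cons k Ks u Us)
  let ?f = "\<lambda>i. (k # Ks) ! i \<otimes> (u # Us) ! i"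
  have c: "?f \<in> {..<Suc (length Us)} \<rightarrow> carrier R"
    using Cons.prems Cons.hyps by (auto simp: nth_Cons subset_iff split: nat.split)
  have "(\<Oplus>i\<in>{..<length (u # Us)}. ?f i) = ?f 0 \<oplus> (\<Oplus>i\<in>Suc ` {..<length Us}. ?f i)"
    using c unfolding length_Cons lessThan_Suc_eq_insert_0 by (intro finsum_insert) auto
  also have "(\<Oplus>i\<in>Suc ` {..<length Us}. ?f i) = (\<Oplus>i\<in>{..<length Us}. ?f (Suc i))"
    using c by (intro finsum_reindex) auto
  also have "\<dots> = combine Ks Us" using Cons by simp
  finally show ?case by simp
qed simp

lemma (in ring) base_coordinates_unique:
  assumes K: "subfield K R" and us: "independent K us"
    and c: "\<And>i. i < length us \<Longrightarrow> c i \<in> K" and d: "\<And>i. i < length us \<Longrightarrow> d i \<in> K"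
    and eq: "(\<Oplus>i\<in>{..<length us}. c i \<otimes> us ! i) = (\<Oplus>i\<in>{..<length us}. d i \<otimes> us ! i)"
    and i: "i < length us"
  shows "c i = d i"
proof -
  have usc: "set us \<subseteq> carrier R" using independent_in_carrier[OF us] .
  have KR: "K \<subseteq> carrier R" using subfieldE(3)[OF K] .
  have comb: "combine (map f [0..<length us]) us = (\<Oplus>i\<in>{..<length us}. f i \<otimes> us ! i)"
    if "\<And>i. i < length us \<Longrightarrow> f i \<in> K" for f
  proof -
    have "set (map f [0..<length us]) \<subseteq> carrier R" using that KR by auto
    from combine_eq_finsum[OF _ this usc]
    have "combine (map f [0..<length us]) us = (\<Oplus>i\<in>{..<length us}. map f [0..<length us] ! i \<otimes> us ! i)" by simp
    also have "\<dots> = (\<Oplus>i\<in>{..<length us}. f i \<otimes> us ! i)"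
      using that KR usc by (intro finsum_cong') (auto simp: subset_iff)
    finally show ?thesis .
  qed
  let ?w = "combine (map c [0..<length us]) us"
  have cK: "set (map c [0..<length us]) \<subseteq> K" and dK: "set (map d [0..<length us]) \<subseteq> K"
    using c d by auto
  have len: "length (map c [0..<length us]) = length us" "length (map d [0..<length us]) = length us" by simp_all
  have w: "?w \<in> Span K us" unfolding Span_mem_iff_length_version[OF K usc] using cK len(1) by blast
  have wd: "?w = combine (map d [0..<length us]) us" using comb[OF c] comb[OF d] eq by simp
  have "map c [0..<length us] = map d [0..<length us]"
    using unique_decomposition[OF K us w] cK dK len wd by blast
  then have "map c [0..<length us] ! i = map d [0..<length us] ! i" by (rule arg_cong)
  then show ?thesis using i by simp
qed

lemma (in ring) base_coordinates_exist:
  assumes K: "subfield K R" and us: "independent K us" "Span K us = carrier R" and w: "w \<in> carrier R"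
  shows "\<exists>c. (\<forall>i<length us. c i \<in> K) \<and> w = (\<Oplus>i\<in>{..<length us}. c i \<otimes> us ! i)"
proof -
  have usc: "set us \<subseteq> carrier R" using independent_in_carrier[OF us(1)] .
  have "w \<in> Span K us" using us(2) w by simp
  then obtain Ks where Ks: "set Ks \<subseteq> K" "length Ks = length us" "w = combine Ks us"
    using Span_mem_iff_length_version[OF K usc] by blast
  have "set Ks \<subseteq> carrier R" using Ks(1) subfieldE(3)[OF K] by blast
  from combine_eq_finsum[OF Ks(2) this usc] show ?thesis
    using Ks by (intro exI[of _ "\<lambda>i. Ks ! i"]) (auto simp: subset_iff)
qed

context immediate_cyclic
begin

text \<open>If \<open>a\<^sub>l\<close> has the coordinates \<open>c\<^sub>l\<^sub>i\<close> in the basis, then \<open>z = \<Sum> a\<^sub>l Tr (b\<^sub>l z)\<close> gives the matrix entries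
  \<open>M\<^sub>i\<^sub>j = \<Sum> c\<^sub>l\<^sub>i Tr (b\<^sub>l z u\<^sub>j)\<close>, whose diagonal sum is \<open>\<Sum> Tr (a\<^sub>l b\<^sub>l z) = Tr z\<close>, for any basis \<open>u\<close>.\<close>

lemma matrix_trace_eq:
  assumes us: "independent K us" "Span K us = carrier L" and z: "z \<in> carrier L"
    and M: "\<And>i j. i < length us \<Longrightarrow> j < length us \<Longrightarrow> M i j \<in> K"
    and zM: "\<And>j. j < length us \<Longrightarrow> z \<otimes> us ! j = (\<Oplus>i\<in>{..<length us}. M i j \<otimes> us ! i)"
  shows "(\<Oplus>i\<in>{..<length us}. M i i) = Tr z"
proof -
  let ?n = "length us"
  have usc: "us ! i \<in> carrier L" if "i < ?n" for i
    using independent_in_carrier[OF us(1)] that by auto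
  obtain x where x: "x \<in> ge 0" "x \<notin> K" using Sigma_nonempty Sigma_iff by blast
  have xc: "x \<in> carrier L" using ge_carrier x(1) by blast
  obtain a where a: "\<And>j. a j \<in> ge (- nmul (p - 1) (v (D x)))"
    "\<And>k. k < p \<Longrightarrow> (\<Oplus>j\<in>{..<p}. a j \<otimes> s k (x [^] j)) = (if k = 0 then \<one> else \<zero>)"
    using galois_coordinates[OF x] by blast
  have ac: "a j \<in> carrier L" for j using a(1) ge_carrier by blast
  define b where "b j = x [^] j" for j :: nat
  have bc: "b j \<in> carrier L" for j using xc by (simp add: b_def)
  have expand: "(\<Oplus>l\<in>{..<p}. a l \<otimes> Tr (b l \<otimes> w)) = w" if "w \<in> carrier L" for w
    using coordinates_expand[of "{..<p}" a b w] a(2) ac bc that by (simp add: b_def)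
  have ab: "(\<Oplus>l\<in>{..<p}. a l \<otimes> b l) = \<one>" using a(2)[of 0] p_gt_1 by (simp add: b_def)
  have "\<forall>l. \<exists>c. (\<forall>i<?n. c i \<in> K) \<and> a l = (\<Oplus>i\<in>{..<?n}. c i \<otimes> us ! i)"
    using base_coordinates_exist[OF K us ac] by blast
  then obtain c where c: "\<And>l i. i < ?n \<Longrightarrow> c l i \<in> K" "\<And>l. a l = (\<Oplus>i\<in>{..<?n}. c l i \<otimes> us ! i)"
    by metis
  have cc: "c l i \<in> carrier L" if "i < ?n" for l i using c(1)[OF that] K_carr by blast
  have Mii: "M i j = (\<Oplus>l\<in>{..<p}. c l i \<otimes> Tr (b l \<otimes> (z \<otimes> us ! j)))" if i: "i < ?n" and j: "j < ?n" for i j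
  proof (rule base_coordinates_unique[OF K us(1) _ _ _ i])
    let ?w = "z \<otimes> us ! j"
    have w: "?w \<in> carrier L" using z usc j by simp
    show "M i j \<in> K" if "i < ?n" for i using M that j .
    show "(\<Oplus>l\<in>{..<p}. c l i \<otimes> Tr (b l \<otimes> ?w)) \<in> K" if "i < ?n" for i
      using c(1)[OF that] Tr_in_K bc w by (intro K_finsum K_subring(6)) auto
    have "?w = (\<Oplus>l\<in>{..<p}. (\<Oplus>i\<in>{..<?n}. c l i \<otimes> us ! i) \<otimes> Tr (b l \<otimes> ?w))"
      using expand[OF w] unfolding c(2)[symmetric] by simp
    also have "\<dots> = (\<Oplus>l\<in>{..<p}. \<Oplus>i\<in>{..<?n}. c l i \<otimes> Tr (b l \<otimes> ?w) \<otimes> us ! i)"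
    proof (intro finsum_cong' refl)
      fix l
      have "(\<Oplus>i\<in>{..<?n}. c l i \<otimes> us ! i) \<otimes> Tr (b l \<otimes> ?w) = (\<Oplus>i\<in>{..<?n}. c l i \<otimes> us ! i \<otimes> Tr (b l \<otimes> ?w))"
        using cc usc bc w by (intro finsum_ldistr) auto
      also have "\<dots> = (\<Oplus>i\<in>{..<?n}. c l i \<otimes> Tr (b l \<otimes> ?w) \<otimes> us ! i)"
        using cc usc bc w by (intro finsum_cong') (auto simp: m_ac)
      finally show "(\<Oplus>i\<in>{..<?n}. c l i \<otimes> us ! i) \<otimes> Tr (b l \<otimes> ?w) =
        (\<Oplus>i\<in>{..<?n}. c l i \<otimes> Tr (b l \<otimes> ?w) \<otimes> us ! i)" .
    qed (use cc usc bc w in \<open>auto intro!: finsum_closed\<close>)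
    also have "\<dots> = (\<Oplus>i\<in>{..<?n}. \<Oplus>l\<in>{..<p}. c l i \<otimes> Tr (b l \<otimes> ?w) \<otimes> us ! i)"
      using cc usc bc w by (intro finsum_swap) auto
    also have "\<dots> = (\<Oplus>i\<in>{..<?n}. (\<Oplus>l\<in>{..<p}. c l i \<otimes> Tr (b l \<otimes> ?w)) \<otimes> us ! i)"
      using cc usc bc w by (intro finsum_cong' refl finsum_ldistr[symmetric]) (auto intro!: finsum_closed)
    finally show "(\<Oplus>i\<in>{..<?n}. M i j \<otimes> us ! i) = (\<Oplus>i\<in>{..<?n}. (\<Oplus>l\<in>{..<p}. c l i \<otimes> Tr (b l \<otimes> ?w)) \<otimes> us ! i)"
      using zM[OF j] by simp
  qed
  have "(\<Oplus>i\<in>{..<?n}. M i i) = (\<Oplus>i\<in>{..<?n}. \<Oplus>l\<in>{..<p}. Tr (c l i \<otimes> us ! i \<otimes> (b l \<otimes> z)))"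
  proof (intro finsum_cong' refl)
    fix i assume "i \<in> {..<?n}"
    then have i: "i < ?n" by simp
    have "c l i \<otimes> Tr (b l \<otimes> (z \<otimes> us ! i)) = Tr (c l i \<otimes> us ! i \<otimes> (b l \<otimes> z))" for l
    proof -
      have "c l i \<otimes> us ! i \<otimes> (b l \<otimes> z) = c l i \<otimes> (b l \<otimes> (z \<otimes> us ! i))"
        using cc[OF i] usc[OF i] bc z by (simp add: m_ac)
      then show ?thesis using Tr_const_mult[OF c(1)[OF i]] bc z usc[OF i] by simp
    qed
    then show "M i i = (\<Oplus>l\<in>{..<p}. Tr (c l i \<otimes> us ! i \<otimes> (b l \<otimes> z)))" unfolding Mii[OF i i] by simp
  qed (use cc usc bc z in \<open>auto intro!: finsum_closed\<close>)
  also have "\<dots> = (\<Oplus>l\<in>{..<p}. \<Oplus>i\<in>{..<?n}. Tr (c l i \<otimes> us ! i \<otimes> (b l \<otimes> z)))"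
    using cc usc bc z by (intro finsum_swap) auto
  also have "\<dots> = (\<Oplus>l\<in>{..<p}. Tr (a l \<otimes> b l \<otimes> z))"
  proof (intro finsum_cong' refl)
    fix l
    have "(\<Oplus>i\<in>{..<?n}. Tr (c l i \<otimes> us ! i \<otimes> (b l \<otimes> z))) = Tr (\<Oplus>i\<in>{..<?n}. c l i \<otimes> us ! i \<otimes> (b l \<otimes> z))"
      using cc usc bc z by (intro Tr_finsum[symmetric]) auto
    also have "(\<Oplus>i\<in>{..<?n}. c l i \<otimes> us ! i \<otimes> (b l \<otimes> z)) = a l \<otimes> (b l \<otimes> z)"
      unfolding c(2)[of l] using cc usc bc z by (intro finsum_ldistr[symmetric]) auto
    finally show "(\<Oplus>i\<in>{..<?n}. Tr (c l i \<otimes> us ! i \<otimes> (b l \<otimes> z))) = Tr (a l \<otimes> b l \<otimes> z)"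
      using ac bc z by (simp add: m_assoc)
  qed (use ac bc z in auto)
  also have "\<dots> = Tr (\<Oplus>l\<in>{..<p}. a l \<otimes> b l \<otimes> z)"
    using ac bc z by (intro Tr_finsum[symmetric]) auto
  also have "(\<Oplus>l\<in>{..<p}. a l \<otimes> b l \<otimes> z) = z"
    using finsum_ldistr[of "{..<p}" z "\<lambda>l. a l \<otimes> b l"] ac bc z ab by simp
  finally show ?thesis .
qed

lemma field_trace_eq:
  assumes fin: "finite_dimension K (carrier L)" and z: "z \<in> carrier L"
  shows "field_trace L K z = Tr z"
proof -
  obtain n where "dimension n K (carrier L)" using fin by blast
  then obtain us where us: "independent K us" "Span K us = carrier L" using exists_base[OF K] by blast
  have usc: "us ! i \<in> carrier L" if "i < length us" for i
    using independent_in_carrier[OF us(1)] that by auto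
  have "\<forall>j. \<exists>c. j < length us \<longrightarrow> (\<forall>i<length us. c i \<in> K) \<and> z \<otimes> us ! j = (\<Oplus>i\<in>{..<length us}. c i \<otimes> us ! i)"
    using base_coordinates_exist[OF K us, of "z \<otimes> us ! j" for j] z usc by blast
  then obtain N where N: "\<And>j i. j < length us \<Longrightarrow> i < length us \<Longrightarrow> N j i \<in> K"
    "\<And>j. j < length us \<Longrightarrow> z \<otimes> us ! j = (\<Oplus>i\<in>{..<length us}. N j i \<otimes> us ! i)" by metis
  show ?thesis
    unfolding field_trace_def
  proof (rule the_equality)
    show "\<exists>us M. independent K us \<and> Span K us = carrier L \<and>
      (\<forall>i<length us. \<forall>j<length us. M i j \<in> K) \<and>
      (\<forall>j<length us. z \<otimes> us ! j = (\<Oplus>i\<in>{..<length us}. M i j \<otimes> us ! i)) \<and>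
      Tr z = (\<Oplus>i\<in>{..<length us}. M i i)"
      using us N matrix_trace_eq[OF us z, of "\<lambda>i j. N j i"]
      by (intro exI[of _ us] exI[of _ "\<lambda>i j. N j i"]) auto
  next
    fix t assume "\<exists>us M. independent K us \<and> Span K us = carrier L \<and>
      (\<forall>i<length us. \<forall>j<length us. M i j \<in> K) \<and>
      (\<forall>j<length us. z \<otimes> us ! j = (\<Oplus>i\<in>{..<length us}. M i j \<otimes> us ! i)) \<and>
      t = (\<Oplus>i\<in>{..<length us}. M i i)"
    then show "t = Tr z" using matrix_trace_eq[OF _ _ z] by blast
  qed
qed

end

section \<open>Independence of the defect\<close>

context immediate_cyclic
begin

abbreviation I where "I \<equiv> ramification_ideal L v \<sigma>"

lemma independent_iff_halving: "independent_defect L v \<sigma> \<longleftrightarrow> halving Sig"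
  unfolding independent_defect_def indep_defect_witness_def
  using halving_iff_strongly_convex[OF value_group_convex Sigma_subset Sigma_nonempty Sigma_pos Sigma_up] by simp

lemma ramification_ideal_eq_iff:
  "I = coarse_val_ideal L v H \<longleftrightarrow> Sig = {\<alpha> \<in> \<Gamma>. \<forall>h\<in>H. \<alpha> > h}"
proof
  assume eq: "I = coarse_val_ideal L v H"
  show "Sig = {\<alpha> \<in> \<Gamma>. \<forall>h\<in>H. \<alpha> > h}"
  proof (intro subset_antisym subsetI)
    fix \<alpha> assume a: "\<alpha> \<in> Sig"
    then obtain x where x: "x \<in> carrier L" "x \<noteq> \<zero>" "v x = \<alpha>" using Sigma_subset value_groupE by blast
    then have "x \<in> I" using a ramification_ideal_iff by simp
    then show "\<alpha> \<in> {\<alpha> \<in> \<Gamma>. \<forall>h\<in>H. \<alpha> > h}"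
      using x value_groupI[of x] unfolding eq coarse_val_ideal_def by auto
  next
    fix \<alpha> assume a: "\<alpha> \<in> {\<alpha> \<in> \<Gamma>. \<forall>h\<in>H. \<alpha> > h}"
    then obtain x where x: "x \<in> carrier L" "x \<noteq> \<zero>" "v x = \<alpha>" using value_groupE by blast
    then have "x \<in> I" unfolding eq using a by (simp add: coarse_val_ideal_def)
    then show "\<alpha> \<in> Sig" using x ramification_ideal_iff by simp
  qed
next
  assume eq: "Sig = {\<alpha> \<in> \<Gamma>. \<forall>h\<in>H. \<alpha> > h}"
  show "I = coarse_val_ideal L v H"
    unfolding ramification_ideal_def coarse_val_ideal_def eq using value_groupI by auto
qed

lemma ramification_ideal_ideal: "ideal I OL"
proof -
  have "I = {a \<in> carrier L. a = \<zero> \<or> v a \<in> Sig}" using ramification_ideal_iff by blast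
  then show ?thesis using upset_ideal[OF less_imp_le[OF Sigma_pos] Sigma_up] by simp
qed

lemma ramification_ideal_add: "a \<in> I \<Longrightarrow> b \<in> I \<Longrightarrow> a \<oplus> b \<in> I"
  using additive_subgroup.a_closed[OF ideal.axioms(1)[OF ramification_ideal_ideal], of a b] by simp

lemma ramification_idealI: "a \<in> ge \<gamma> \<Longrightarrow> \<gamma> \<in> Sig \<Longrightarrow> a \<in> I"
  using Sigma_up[of \<gamma> "v a"] value_groupI[of a] by (auto simp: ge_def ramification_ideal_iff)

lemma ramification_ideal_subset: "I \<subseteq> gt 0"
  using Sigma_pos by (auto simp: ramification_ideal_iff gt_def)

lemma ideals_set_pow:
  "J [^]\<^bsub>ideals_set R\<^esub> (0::nat) = carrier R"
  "J [^]\<^bsub>ideals_set R\<^esub> Suc n = ideal_prod R (J [^]\<^bsub>ideals_set R\<^esub> n) J"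
  by (simp_all add: nat_pow_def ideals_set_def)

text \<open>A sum of \<open>n\<close> elements of \<open>\<Sigma>\<close> is at least \<open>n\<close> times the smallest of them.\<close>

lemma ramification_ideal_pow_value:
  "a \<in> I [^]\<^bsub>ideals_set OL\<^esub> n \<Longrightarrow> \<exists>\<beta>\<in>Sig. a \<in> ge (nmul n \<beta>)"
proof (induction n arbitrary: a)
  case 0
  have "a \<in> ge (nmul 0 \<beta>)" for \<beta>
    using "0" unfolding ideals_set_pow(1) OL_carrier nmul.simps(1) .
  then show ?case using Sigma_nonempty by blast
next
  case (Suc n)
  have "a \<in> ideal_prod OL (I [^]\<^bsub>ideals_set OL\<^esub> n) I" using Suc.prems by (simp only: ideals_set_pow)
  then show ?case
  proof induction
    case (prod i j)
    obtain \<beta> where b: "\<beta> \<in> Sig" "i \<in> ge (nmul n \<beta>)" using Suc.IH[OF prod(1)] by blast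
    have jc: "j \<in> carrier L" using prod(2) ramification_ideal_iff by blast
    show ?case
    proof (cases "j = \<zero>")
      case True
      then have "i \<otimes>\<^bsub>OL\<^esub> j = \<zero>" using ge_carrier[OF b(2)] by simp
      then have "i \<otimes>\<^bsub>OL\<^esub> j \<in> ge (nmul (Suc n) \<beta>)" by (simp only: zero_ge)
      then show ?thesis using b(1) by blast
    next
      case False
      then have g: "v j \<in> Sig" using prod(2) ramification_ideal_iff by blast
      let ?\<mu> = "min \<beta> (v j)"
      have "i \<otimes> j \<in> ge (nmul n \<beta> + v j)" using ge_mult[OF b(2) self_ge[OF jc]] .
      moreover have "nmul (Suc n) ?\<mu> \<le> nmul n \<beta> + v j"
        using add_mono[OF nmul_mono_right[of ?\<mu> \<beta> n] min.cobounded2[of \<beta> "v j"]]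
        unfolding nmul.simps(2) add.commute[of ?\<mu>] by simp
      ultimately have "i \<otimes> j \<in> ge (nmul (Suc n) ?\<mu>)" by (rule ge_mono)
      then have "i \<otimes>\<^bsub>OL\<^esub> j \<in> ge (nmul (Suc n) ?\<mu>)" by simp
      moreover have "?\<mu> \<in> Sig" using b(1) g by (simp add: min_def)
      ultimately show ?thesis by blast
    qed
  next
    case (sum s1 s2)
    then obtain \<beta> \<gamma> where *: "\<beta> \<in> Sig" "s1 \<in> ge (nmul (Suc n) \<beta>)" "\<gamma> \<in> Sig" "s2 \<in> ge (nmul (Suc n) \<gamma>)"
      by blast
    let ?\<mu> = "min \<beta> \<gamma>"
    have "s1 \<in> ge (nmul (Suc n) ?\<mu>)" "s2 \<in> ge (nmul (Suc n) ?\<mu>)"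
      by (rule ge_mono[OF *(2) nmul_mono_right[OF min.cobounded1]],
          rule ge_mono[OF *(4) nmul_mono_right[OF min.cobounded2]])
    then have "s1 \<oplus> s2 \<in> ge (nmul (Suc n) ?\<mu>)" by (rule ge_add)
    then have "s1 \<oplus>\<^bsub>OL\<^esub> s2 \<in> ge (nmul (Suc n) ?\<mu>)" by simp
    moreover have "?\<mu> \<in> Sig" using *(1,3) by (simp add: min_def)
    ultimately show ?case by blast
  qed
qed

lemma ramification_ideal_pow_eq:
  assumes half: "halving Sig"
  shows "I [^]\<^bsub>ideals_set OL\<^esub> Suc n = I"
proof -
  interpret I: ideal I OL by (rule ramification_ideal_ideal)
  have prod: "ideal_prod OL J I = I" if J: "I \<subseteq> J" "J \<subseteq> carrier OL" for J
  proof (intro subset_antisym subsetI)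
    fix a assume "a \<in> ideal_prod OL J I"
    then show "a \<in> I"
    proof induction
      case (prod i j)
      then show ?case using I.I_l_closed[of j i] J by blast
    next
      case (sum s1 s2)
      then show ?case using ramification_ideal_add by simp
    qed
  next
    fix a assume a: "a \<in> I"
    show "a \<in> ideal_prod OL J I"
    proof (cases "a = \<zero>")
      case True
      have "\<zero> \<otimes>\<^bsub>OL\<^esub> \<zero> \<in> ideal_prod OL J I" using a True J by (intro ideal_prod.prod) auto
      then show ?thesis using True by simp
    next
      case False
      have ac: "a \<in> carrier L" and va: "v a \<in> Sig" using a False ramification_ideal_iff by auto
      obtain \<beta> where \<beta>: "\<beta> \<in> Sig" "\<beta> + \<beta> \<le> v a" using half va unfolding halving_def by blast
      then obtain b where b: "b \<in> carrier L" "b \<noteq> \<zero>" "v b = \<beta>" using Sigma_subset value_groupE by blast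
      have "v (a \<otimes> inv b) = v a - \<beta>" using v_div[OF ac b(1) False b(2)] b(3) by simp
      then have "a \<otimes> inv b \<in> ge \<beta>" using ac v_inv[OF b(1,2)] \<beta>(2) by (simp add: ge_def le_diff_eq)
      then have "a \<otimes> inv b \<in> J" using ramification_idealI \<beta>(1) J by blast
      moreover have "b \<in> I" using b \<beta>(1) ramification_ideal_iff by simp
      ultimately have "(a \<otimes> inv b) \<otimes>\<^bsub>OL\<^esub> b \<in> ideal_prod OL J I" by (rule ideal_prod.prod)
      moreover have "(a \<otimes> inv b) \<otimes> b = a" using ac b v_inv[OF b(1,2)] by (simp add: m_assoc)
      ultimately show ?thesis by simp
    qed
  qed
  have sub: "I \<subseteq> carrier OL" using ramification_ideal_subset gt_imp_ge OL_carrier by blast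
  show ?thesis
    by (induction n) (simp_all only: ideals_set_pow prod[OF sub subset_refl] prod[OF subset_refl sub])
qed

lemma ramification_ideal_pow_iff: "I [^]\<^bsub>ideals_set OL\<^esub> p = I \<longleftrightarrow> halving Sig"
proof
  assume eq: "I [^]\<^bsub>ideals_set OL\<^esub> p = I"
  show "halving Sig"
    unfolding halving_def
  proof
    fix \<alpha> assume "\<alpha> \<in> Sig"
    moreover then obtain a where a: "a \<in> carrier L" "a \<noteq> \<zero>" "v a = \<alpha>" using Sigma_subset value_groupE by blast
    ultimately have "a \<in> I [^]\<^bsub>ideals_set OL\<^esub> p" using ramification_ideal_iff unfolding eq by simp
    then obtain \<beta> where \<beta>: "\<beta> \<in> Sig" "a \<in> ge (nmul p \<beta>)" using ramification_ideal_pow_value by blast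
    have "nmul 2 \<beta> \<le> nmul p \<beta>"
      using Sigma_pos[OF \<beta>(1)] p_gt_1 by (intro nmul_mono_left) auto
    also have "nmul p \<beta> \<le> \<alpha>" using \<beta>(2) a unfolding ge_def by blast
    finally have "\<beta> + \<beta> \<le> \<alpha>" by (simp add: numeral_2_eq_2)
    then show "\<exists>\<beta>\<in>Sig. \<beta> + \<beta> \<le> \<alpha>" using \<beta>(1) by blast
  qed
next
  assume half: "halving Sig"
  obtain n where n: "p = Suc n" using p_gt_1 by (cases p) auto
  show "I [^]\<^bsub>ideals_set OL\<^esub> p = I"
    unfolding n by (rule ramification_ideal_pow_eq[OF half])
qed

lemma kaehler_trivial_iff: "carrier \<Omega> = {\<zero>\<^bsub>\<Omega>\<^esub>} \<longleftrightarrow> halving Sig"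
  and kaehler_trivial_if_killed:
    "\<forall>a\<in>gt 0. \<forall>\<omega>\<in>carrier \<Omega>. a \<odot>\<^bsub>\<Omega>\<^esub> \<omega> = \<zero>\<^bsub>\<Omega>\<^esub> \<Longrightarrow> carrier \<Omega> = {\<zero>\<^bsub>\<Omega>\<^esub>}"
proof -
  interpret B: cring OL by (rule OL_cring)
  interpret \<Omega>: module OL \<Omega> by (rule B.kaehler_is_module[OF OK_subset])
  show killed: "carrier \<Omega> = {\<zero>\<^bsub>\<Omega>\<^esub>}" if "\<forall>a\<in>gt 0. \<forall>\<omega>\<in>carrier \<Omega>. a \<odot>\<^bsub>\<Omega>\<^esub> \<omega> = \<zero>\<^bsub>\<Omega>\<^esub>"
    by (intro kaehler_trivial_if_halving halving_if_kaehler_killed that[rule_format])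
  have "a \<odot>\<^bsub>\<Omega>\<^esub> \<omega> = \<zero>\<^bsub>\<Omega>\<^esub>" if "carrier \<Omega> = {\<zero>\<^bsub>\<Omega>\<^esub>}" "a \<in> gt 0" "\<omega> \<in> carrier \<Omega>" for a \<omega>
  proof -
    have "a \<in> carrier OL" unfolding OL_carrier using that(2) gt_imp_ge by blast
    then have "a \<odot>\<^bsub>\<Omega>\<^esub> \<omega> \<in> carrier \<Omega>" using that(3) by (rule \<Omega>.smult_closed)
    then show ?thesis unfolding that(1) by simp
  qed
  then have "halving Sig" if "carrier \<Omega> = {\<zero>\<^bsub>\<Omega>\<^esub>}"
    using that by (intro halving_if_kaehler_killed)
  then show "carrier \<Omega> = {\<zero>\<^bsub>\<Omega>\<^esub>} \<longleftrightarrow> halving Sig"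
    using kaehler_trivial_if_halving by (intro iffI)
qed

lemma primeideal_ramification_ideal:
  assumes H: "convex_subgroup \<Gamma> H" and Sig: "Sig = {\<alpha> \<in> \<Gamma>. \<forall>h\<in>H. \<alpha> > h}"
  shows "primeideal I OL"
proof (rule primeideal.intro[OF ramification_ideal_ideal OL_cring], unfold_locales)
  have "\<one> \<notin> I" using ramification_ideal_subset v_one by (auto simp: gt_def)
  then show "carrier OL \<noteq> I" using one_ge OL_carrier by blast
  fix a b assume a: "a \<in> carrier OL" and b: "b \<in> carrier OL" and ab: "a \<otimes>\<^bsub>OL\<^esub> b \<in> I"
  have c: "a \<in> ge 0" "b \<in> ge 0" "a \<in> carrier L" "b \<in> carrier L" using a b OL_carrier ge_carrier by auto
  show "a \<in> I \<or> b \<in> I"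
  proof (rule ccontr)
    assume no: "\<not> (a \<in> I \<or> b \<in> I)"
    then have nz: "a \<noteq> \<zero>" "b \<noteq> \<zero>" using ramification_ideal_iff by auto
    have inH: "v x \<in> H" if x: "x \<in> ge 0" "x \<notin> I" "x \<noteq> \<zero>" "x \<in> carrier L" for x
    proof -
      have "v x \<notin> Sig" using x ramification_ideal_iff by blast
      then obtain h where "h \<in> H" "v x \<le> h"
        unfolding Sig using value_groupI[OF x(4,3)] by (auto simp: not_less)
      then show ?thesis
        using convex_subgroupD(6)[OF H convex_subgroupD(2)[OF H], of h "v x"] x value_groupI[OF x(4,3)]
        by (auto simp: ge_def)
    qed
    have "v (a \<otimes> b) \<in> H"
      using convex_subgroupD(3)[OF H inH inH, of a b] no nz c v_mult[of a b] by simp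
    moreover have "a \<otimes> b \<noteq> \<zero>" using c nz by (simp add: integral_iff)
    ultimately show False using ab ramification_ideal_iff[of "a \<otimes> b"] unfolding Sig by auto
  qed
qed

lemma coarse_val_ring_localization:
  assumes H: "convex_subgroup \<Gamma> H" and Sig: "Sig = {\<alpha> \<in> \<Gamma>. \<forall>h\<in>H. \<alpha> > h}"
  shows "coarse_val_ring L v H = localization_at L (val_ring L v (carrier L)) I"
proof -
  have zero: "0 \<in> H" using convex_subgroupD(2)[OF H] .
  show ?thesis
    unfolding coarse_val_ring_def localization_at_def coarsening_def coset_le_subgroup_iff[OF H] val_ring_eq
  proof (intro subset_antisym subsetI)
    fix a assume a: "a \<in> {a \<in> carrier L. a = \<zero> \<or> (\<exists>h\<in>H. h \<le> v a)}"
    show "a \<in> {a \<otimes> inv s | a s. a \<in> ge 0 \<and> s \<in> ge 0 - I}"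
    proof (cases "a \<in> ge 0")
      case True
      have "\<one> \<in> ge 0 - I" using one_ge ramification_ideal_subset v_one by (auto simp: gt_def)
      moreover have "a = a \<otimes> inv \<one>" using a by simp
      ultimately show ?thesis using True by blast
    next
      case False
      then have nz: "a \<noteq> \<zero>" "v a < 0" using a zero_ge by (auto simp: ge_def not_le)
      then obtain h where h: "h \<in> H" "h \<le> v a" using a by auto
      have ac: "a \<in> carrier L" using a by simp
      note i = v_inv[OF ac nz(1)]
      have "v a \<in> H" using convex_subgroupD(6)[OF H h(1) zero value_groupI[OF ac nz(1)] h(2)] nz(2) by simp
      then have "v (inv a) \<in> H" using i(5) convex_subgroupD(4)[OF H] by simp
      then have "inv a \<in> ge 0 - I"
        using i nz(2) ramification_ideal_iff[of "inv a"] unfolding Sig by (auto simp: ge_def)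
      moreover have "a = \<one> \<otimes> inv (inv a)"
        using ac i by (simp add: field_Units Units_inv_inv nz)
      ultimately show ?thesis using one_ge by blast
    qed
  next
    fix x assume "x \<in> {a \<otimes> inv s | a s. a \<in> ge 0 \<and> s \<in> ge 0 - I}"
    then obtain a t where x: "x = a \<otimes> inv t" "a \<in> ge 0" "t \<in> ge 0" "t \<notin> I" by blast
    have c: "a \<in> carrier L" "t \<in> carrier L" "t \<noteq> \<zero>" using x ge_carrier ramification_ideal_iff by auto
    have "v t \<notin> Sig" using x(4) c ramification_ideal_iff by blast
    then obtain h where h: "h \<in> H" "v t \<le> h"
      unfolding Sig using value_groupI[OF c(2,3)] by (auto simp: not_less)
    have "- h \<le> v (a \<otimes> inv t)" if "a \<noteq> \<zero>"
      using v_div[OF c(1,2) that c(3)] x(2) h(2) that add_mono[of 0 "v a" "- h" "- v t"] by (simp add: ge_def)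
    then have "a \<otimes> inv t = \<zero> \<or> (\<exists>h\<in>H. h \<le> v (a \<otimes> inv t))"
      using convex_subgroupD(4)[OF H h(1)] c v_inv(1)[OF c(2,3)] by (cases "a = \<zero>") auto
    then show "x \<in> {a \<in> carrier L. a = \<zero> \<or> (\<exists>h\<in>H. h \<le> v a)}"
      unfolding x(1) using c v_inv(1)[OF c(2,3)] by simp
  qed
qed

lemma coarse_value_group_eq: "coarse_value_group L v H = coset_group \<Gamma> H"
  by (auto simp: coarse_value_group_def coset_group_def coarsening_def value_group_def)

lemma defect_subgroup_eq:
  assumes "strongly_convex \<Gamma> H" and "Sig = {\<alpha> \<in> \<Gamma>. \<forall>h\<in>H. \<alpha> > h}"
  shows "defect_subgroup L v \<sigma> = H"
  unfolding defect_subgroup_def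
proof (rule the_equality)
  show "indep_defect_witness L v \<sigma> H" using assms by (simp add: indep_defect_witness_def)
  fix H' assume "indep_defect_witness L v \<sigma> H'"
  then show "H' = H"
    using convex_subgroup_eqI[of \<Gamma> H' H] strongly_convexD assms unfolding indep_defect_witness_def by blast
qed

end

text \<open>In mixed characteristic the hypothesis on \<open>p\<close> comes from the roots of unity in \<open>K\<close>.\<close>

locale immediate_cyclic_trace = immediate_cyclic +
  assumes finite_dim: "finite_dimension K (carrier L)"
    and p_value: "[p] \<cdot> \<one> = \<zero> \<or> v ([p] \<cdot> \<one>) \<in> Sigma_set L v \<sigma>"
begin

text \<open>\<open>Tr z\<close> is the sum of \<open>p z\<close> and of the differences \<open>\<sigma>\<^sup>k z - z\<close>, which all lie in \<open>I\<close>.\<close>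

lemma Tr_in_ramification_ideal:
  assumes z: "z \<in> gt 0"
  shows "Tr z \<in> I"
proof -
  have zc: "z \<in> carrier L" using gt_carrier[OF z] .
  have pc: "[p] \<cdot> \<one> \<in> carrier L" using of_nat_in_K K_carr by blast
  have "Tr z = (\<Oplus>k\<in>{..<p}. (s k z \<ominus> z) \<oplus> z)"
    unfolding Tr_def using zc by (intro finsum_cong') (auto simp: a_minus_def a_assoc l_neg)
  also have "\<dots> = (\<Oplus>k\<in>{..<p}. s k z \<ominus> z) \<oplus> (\<Oplus>k\<in>{..<p}. z)"
    using zc by (intro finsum_addf) auto
  also have "(\<Oplus>k\<in>{..<p}. z) = [p] \<cdot> \<one> \<otimes> z"
    using add.finprod_const[OF zc, of "{..<p}"] add_pow_ldistr[of \<one> z p] zc by simp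
  finally have eq: "Tr z = (\<Oplus>k\<in>{..<p}. s k z \<ominus> z) \<oplus> [p] \<cdot> \<one> \<otimes> z" .
  have "[p] \<cdot> \<one> \<otimes> z \<in> I"
  proof (cases "[p] \<cdot> \<one> = \<zero>")
    case True
    then show ?thesis using zc by (simp add: ramification_ideal_iff)
  next
    case False
    then have "v ([p] \<cdot> \<one>) \<in> Sig" using p_value by blast
    then show ?thesis
      using ramification_idealI ge_mult[OF self_ge[OF pc] gt_imp_ge[OF z]] by simp
  qed
  moreover have "(\<Oplus>k\<in>{..<p}. s k z \<ominus> z) \<in> I"
  proof (cases "z \<in> K")
    case True
    then have "(\<Oplus>k\<in>{..<p}. s k z \<ominus> z) = (\<Oplus>k\<in>{..<p}. \<zero>)"
      using zc by (intro finsum_cong') (auto simp: s_fixes a_minus_def r_neg)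
    then show ?thesis by (simp add: ramification_ideal_iff)
  next
    case False
    have "(\<Oplus>k\<in>{..<p}. s k z \<ominus> z) \<in> ge (v (D z))"
    proof (rule ge_finsum)
      fix k assume k: "k \<in> {..<p}"
      show "s k z \<ominus> z \<in> ge (v (D z))"
      proof (cases "k = 0")
        case True
        then show ?thesis using zc by (simp add: a_minus_def r_neg zero_ge)
      next
        case False
        then show ?thesis using v_s_minus_self[OF zc \<open>z \<notin> K\<close>, of k] k zc by (auto simp: ge_def)
      qed
    qed simp
    moreover have "v (D z) \<in> Sig" using Sigma_iff gt_imp_ge[OF z] False by blast
    ultimately show ?thesis by (rule ramification_idealI)
  qed
  ultimately show ?thesis unfolding eq using ramification_ideal_add by simp
qed

lemma trace_image: "field_trace L K ` val_ideal L v (carrier L) = Tr ` gt 0"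
  unfolding val_ideal_eq by (intro image_cong field_trace_eq[OF finite_dim] gt_carrier refl)

lemma in_trace_image:
  assumes c: "c \<in> K" "c \<noteq> \<zero>" and \<beta>: "\<beta> \<in> Sig" "nmul (p - 1) \<beta> < v c"
  shows "c \<in> Tr ` gt 0"
proof -
  obtain x where x: "x \<in> ge 0" "x \<notin> K" "v (D x) = \<beta>" using \<beta>(1) Sigma_iff by blast
  obtain y where y: "y \<in> ge (- nmul (p - 1) \<beta>)" "Tr y = \<one>" using trace_one[OF x(1,2)] x(3) by blast
  have yc: "y \<in> carrier L" and cc: "c \<in> carrier L" using ge_carrier[OF y(1)] K_carr[OF c(1)] by auto
  have "c \<otimes> y \<in> ge (v c + - nmul (p - 1) \<beta>)" using ge_mult[OF self_ge[OF cc] y(1)] .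
  then have "c \<otimes> y \<in> gt 0" using \<beta>(2) by (auto intro: ge_gt_mono)
  moreover have "Tr (c \<otimes> y) = c" using Tr_const_mult[OF c(1) yc] y(2) cc by simp
  ultimately show ?thesis by (metis image_eqI)
qed

lemma trace_image_if_independent:
  assumes half: "halving Sig" and Sig: "Sig = {\<alpha> \<in> \<Gamma>. \<forall>h\<in>H. \<alpha> > h}"
  shows "Tr ` gt 0 = coarse_val_ideal L v H \<inter> K"
proof -
  have I: "coarse_val_ideal L v H = I" using ramification_ideal_eq_iff Sig by blast
  show ?thesis
    unfolding I
  proof (intro subset_antisym subsetI)
    fix c assume "c \<in> Tr ` gt 0"
    then show "c \<in> I \<inter> K" using Tr_in_ramification_ideal Tr_in_K gt_carrier by blast
  next
    fix c assume c: "c \<in> I \<inter> K"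
    show "c \<in> Tr ` gt 0"
    proof (cases "c = \<zero>")
      case True
      have "Tr \<zero> = \<zero>" unfolding Tr_def by (simp add: s_zero)
      then show ?thesis using True zero_gt by (metis image_eqI)
    next
      case False
      then have "v c \<in> Sig" using c ramification_ideal_iff by blast
      then obtain \<beta> where \<beta>: "\<beta> \<in> Sig" "nmul p \<beta> \<le> v c" using halving_nmul[OF half Sigma_pos] by blast
      have "nmul p \<beta> = \<beta> + nmul (p - 1) \<beta>" using p_gt_1 by (cases p) auto
      then have "nmul (p - 1) \<beta> < nmul p \<beta>" using Sigma_pos[OF \<beta>(1)] by simp
      then show ?thesis using in_trace_image[OF _ False \<beta>(1)] c \<beta>(2) by auto
    qed
  qed
qed

text \<open>The trace image contains the elements of \<open>K\<close> of value \<open>(p-1) \<alpha>\<close> with \<open>\<alpha> \<in> \<Sigma>\<close>, and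
  \<open>(p-1) \<alpha>\<close> lies above a convex subgroup exactly if \<open>\<alpha>\<close> does.  Conversely all traces of elements of
  \<open>\<M>\<^sub>L\<close> lie in \<open>I\<close>.\<close>

lemma Sigma_if_trace_image:
  assumes H: "convex_subgroup \<Gamma> H" and eq: "Tr ` gt 0 = coarse_val_ideal L v H \<inter> K"
  shows "Sig = {\<alpha> \<in> \<Gamma>. \<forall>h\<in>H. \<alpha> > h}"
proof (intro subset_antisym subsetI)
  fix \<alpha> assume \<alpha>: "\<alpha> \<in> Sig"
  obtain \<beta> where \<beta>: "\<beta> \<in> Sig" "\<beta> < \<alpha>" using Sigma_no_least[OF \<alpha>] by blast
  have "nmul (p - 1) \<alpha> \<in> \<Gamma>" using nmul_in_subgroup[OF value_group_convex] \<alpha> Sigma_subset by blast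
  then obtain c where c: "c \<in> K" "c \<noteq> \<zero>" "v c = nmul (p - 1) \<alpha>" by (rule KvalE)
  have "nmul (p - 1) \<beta> < v c" unfolding c(3) using \<beta>(2) p_gt_1 by (intro nmul_strict_mono) auto
  from in_trace_image[OF c(1,2) \<beta>(1) this]
  have above: "\<forall>h\<in>H. h < nmul (p - 1) \<alpha>" unfolding eq coarse_val_ideal_def using c by auto
  have "h < \<alpha>" if h: "h \<in> H" for h
  proof (rule ccontr)
    assume "\<not> h < \<alpha>"
    then have "nmul (p - 1) \<alpha> \<le> nmul (p - 1) h" by (intro nmul_mono_right) simp
    moreover have "nmul (p - 1) h \<in> H" using nmul_in_subgroup[OF H h] .
    ultimately show False using above by force
  qed
  then show "\<alpha> \<in> {\<alpha> \<in> \<Gamma>. \<forall>h\<in>H. \<alpha> > h}" using \<alpha> Sigma_subset by blast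
next
  fix \<alpha> assume \<alpha>: "\<alpha> \<in> {\<alpha> \<in> \<Gamma>. \<forall>h\<in>H. \<alpha> > h}"
  then obtain c where c: "c \<in> K" "c \<noteq> \<zero>" "v c = \<alpha>" using KvalE by blast
  have "c \<in> coarse_val_ideal L v H \<inter> K" using c \<alpha> K_carr by (auto simp: coarse_val_ideal_def)
  then have "c \<in> I" unfolding eq[symmetric] using Tr_in_ramification_ideal by blast
  then show "\<alpha> \<in> Sig" using c ramification_ideal_iff by blast
qed

text \<open>As \<open>\<gamma> \<in> \<Sigma>\<close> lies in an archimedean convex subgroup, every positive value has a multiple that is at
  least \<open>\<gamma>\<close> and hence in \<open>\<Sigma>\<close>.  A subgroup below \<open>\<Sigma>\<close> is then trivial, and a prime ideal \<open>I\<close>, which contains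
  a power of each element of \<open>\<M>\<^sub>L\<close>, is all of \<open>\<M>\<^sub>L\<close>.\<close>

lemma archimedean_consequences:
  assumes G: "archimedean_group G" "convex_subgroup \<Gamma> G" and \<gamma>: "\<gamma> \<in> G" "\<gamma> \<in> Sig"
  shows "independent_defect L v \<sigma> \<Longrightarrow> defect_subgroup L v \<sigma> = {0}"
    and "primeideal I OL \<Longrightarrow> I = val_ideal L v (carrier L)"
proof -
  have multiple: "\<exists>n. \<gamma> \<le> nmul n \<alpha>" if \<alpha>: "\<alpha> \<in> \<Gamma>" "0 < \<alpha>" for \<alpha>
  proof (cases "\<alpha> \<le> \<gamma>")
    case True
    have "\<alpha> \<in> G" using convex_subgroupD(6)[OF G(2) convex_subgroupD(2)[OF G(2)] \<gamma>(1) \<alpha>(1)] \<alpha>(2) True by simp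
    then show ?thesis using archimedean_multiple[OF G] \<alpha>(2) \<gamma>(1) by blast
  next
    case False
    then have "\<gamma> \<le> nmul 1 \<alpha>" by simp
    then show ?thesis ..
  qed
  show "defect_subgroup L v \<sigma> = {0}" if "independent_defect L v \<sigma>"
  proof -
    obtain H where H: "strongly_convex \<Gamma> H" and Sig: "Sig = {\<alpha> \<in> \<Gamma>. \<forall>h\<in>H. \<alpha> > h}"
      using \<open>independent_defect L v \<sigma>\<close> unfolding independent_defect_def indep_defect_witness_def by blast
    have Hc: "convex_subgroup \<Gamma> H" using strongly_convexD[OF H] .
    have no: "\<not> 0 < h" if h: "h \<in> H" for h
    proof
      assume "0 < h"
      then obtain n where "\<gamma> \<le> nmul n h" using multiple convex_subgroupD(1)[OF Hc] h by blast
      moreover have "nmul n h \<in> H" using nmul_in_subgroup[OF Hc h] .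
      ultimately show False using \<gamma>(2) unfolding Sig by force
    qed
    have "h = 0" if "h \<in> H" for h
      using no[OF that] no[OF convex_subgroupD(4)[OF Hc that]] by simp
    then have "H = {0}" using convex_subgroupD(2)[OF Hc] by blast
    then show ?thesis using defect_subgroup_eq[OF H Sig] by simp
  qed
  show "I = val_ideal L v (carrier L)" if "primeideal I OL"
  proof -
    interpret I: primeideal I OL by fact
    have "a \<in> I" if a: "a \<in> gt 0" for a
    proof (cases "a = \<zero>")
      case True
      then show ?thesis by (simp add: ramification_ideal_iff)
    next
      case False
      have ac: "a \<in> carrier L" "0 < v a" "a \<in> carrier OL"
        using a False gt_imp_ge OL_carrier by (auto simp: gt_def)
      obtain n where n: "\<gamma> \<le> nmul n (v a)" using multiple[OF value_groupI[OF ac(1) False] ac(2)] by blast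
      have pow: "a [^] n \<noteq> \<zero> \<and> v (a [^] n) = nmul n (v a)" for n :: nat
        using ac(1) False by (induction n) (auto simp: v_one v_mult integral_iff add.commute)
      have aI: "a [^] n \<in> I"
        using ramification_idealI[OF _ \<gamma>(2), of "a [^] n"] pow[of n] n ac(1) by (simp add: ge_def)
      have "a [^] n \<in> I \<Longrightarrow> a \<in> I" for n :: nat
      proof (induction n)
        case 0
        then show ?case using ramification_ideal_subset v_one by (auto simp: gt_def)
      next
        case (Suc n)
        have "a [^] n \<in> carrier OL" using ge_pow ac(3) OL_carrier by simp
        then show ?case using I.I_prime[OF _ ac(3), of "a [^] n"] Suc by auto
      qed
      then show ?thesis using aI by blast
    qed
    then show ?thesis using ramification_ideal_subset unfolding val_ideal_eq by blast
  qed
qed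

end

section \<open>Defect extensions of prime degree are immediate\<close>

lemma (in ring) dimension_one_eq:
  assumes K: "subfield K R" and dim: "dimension 1 K E" and one: "\<one> \<in> E"
  shows "E = K"
proof -
  have "independent K [\<one>]"
    using subfieldE(6)[OF K] by (intro independent.li_Cons) auto
  then have E: "Span K [\<one>] = E"
    using independent_length_eq_dimension[OF K dim, of "[\<one>]"] one by simp
  have "independent K [\<one>]" by fact
  then have "Span K [\<one>] = K"
    using independent_length_eq_dimension[OF K dimension_one[OF K], of "[\<one>]"] subringE(3)[OF subfieldE(1)[OF K]]
    by simp
  then show ?thesis using E by simp
qed

lemma (in ring) finite_dimension_if_bounded:
  assumes K: "subfield K R" and bound: "\<And>us. independent K us \<Longrightarrow> length us \<le> n"
  shows "finite_dimension K (carrier R)"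
proof (rule ccontr)
  assume inf: "infinite_dimension K (carrier R)"
  have "\<exists>us. independent K us \<and> length us = m" for m
  proof (induction m)
    case 0
    show ?case by (intro exI[of _ "[]"]) simp
  next
    case (Suc m)
    then obtain us where us: "independent K us" "length us = m" by blast
    have "Span K us \<noteq> carrier R"
      using inf finite_dimensionI[OF dimensionI[OF K us(1)]] by blast
    then obtain u where "u \<in> carrier R" "u \<notin> Span K us"
      using Span_in_carrier[of K us] independent_in_carrier[OF us(1)] subfieldE(3)[OF K] by blast
    then have "independent K (u # us)" using us(1) by (intro independent.li_Cons)
    then show ?case using us(2) by (intro exI[of _ "u # us"]) simp
  qed
  then obtain us where "independent K us" "length us = Suc n" by blast
  then show False using bound by force
qed

lemma (in ring) subring_combine:
  assumes "subring H R"
  shows "ring.combine (R\<lparr>carrier := H\<rparr>) Ks Us = combine Ks Us"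
proof -
  interpret H: ring "R\<lparr>carrier := H\<rparr>" using subring_is_ring[OF assms] .
  show ?thesis by (induction Ks Us rule: combine.induct) simp_all
qed

context valued_field
begin

abbreviation res where "res \<equiv> residue_field L v"
abbreviation \<pi> where "\<pi> x \<equiv> gt 0 +>\<^bsub>OL\<^esub> x"

lemma max_ideal: "ideal (gt 0) OL"
proof -
  have "gt 0 = {a \<in> carrier L. a = \<zero> \<or> v a \<in> {\<gamma> \<in> \<Gamma>. 0 < \<gamma>}}"
    using value_groupI by (auto simp: gt_def)
  moreover have "ideal {a \<in> carrier L. a = \<zero> \<or> v a \<in> {\<gamma> \<in> \<Gamma>. 0 < \<gamma>}} OL"
    by (rule upset_ideal) auto
  ultimately show ?thesis by simp
qed

lemma res_eq: "res = OL Quot gt 0"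
  by (simp add: residue_field_def val_ideal_eq)

lemma residue_is_field: "field res"
proof -
  interpret B: cring OL by (rule OL_cring)
  have "maximalideal (gt 0) OL"
  proof (rule maximalidealI[OF max_ideal])
    show "carrier OL \<noteq> gt 0" using one_ge OL_carrier v_one by (auto simp: gt_def)
    fix J assume J: "ideal J OL" "gt 0 \<subseteq> J" "J \<subseteq> carrier OL"
    show "J = gt 0 \<or> J = carrier OL"
    proof (rule disjCI)
      assume "J \<noteq> carrier OL"
      have "J \<subseteq> gt 0"
      proof
        fix x assume x: "x \<in> J"
        then have xg: "x \<in> ge 0" "x \<in> carrier L" using J(3) OL_carrier ge_carrier by auto
        show "x \<in> gt 0"
        proof (rule ccontr)
          assume "x \<notin> gt 0"
          then have nz: "x \<noteq> \<zero>" "v x = 0" using xg by (auto simp: ge_def gt_def)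
          note i = v_inv[OF xg(2) nz(1)]
          have "inv x \<in> carrier OL" using i nz(2) OL_carrier by (simp add: ge_def)
          then have "inv x \<otimes>\<^bsub>OL\<^esub> x \<in> J" by (rule ideal.I_l_closed[OF J(1) x])
          then have "\<one>\<^bsub>OL\<^esub> \<in> J" using i(4) by simp
          then show False using ideal.one_imp_carrier[OF J(1)] \<open>J \<noteq> carrier OL\<close> by blast
        qed
      qed
      then show "J = gt 0" using J(2) by blast
    qed
  qed
  then show ?thesis unfolding res_eq by (rule maximalideal.quotient_is_field[OF _ OL_cring])
qed

lemma \<pi>_hom: "ring_hom_ring OL res \<pi>"
  unfolding res_eq by (rule ideal.rcos_ring_hom_ring[OF max_ideal])

lemma \<pi>_surj: "carrier res = \<pi> ` ge 0"
  unfolding res_eq FactRing_def A_RCOSETS_def' using OL_carrier by auto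

lemma \<pi>_zero_iff:
  assumes "x \<in> ge 0"
  shows "\<pi> x = \<zero>\<^bsub>res\<^esub> \<longleftrightarrow> x \<in> gt 0"
proof -
  interpret M: ideal "gt 0" OL by (rule max_ideal)
  have x: "x \<in> carrier OL" using assms OL_carrier by simp
  show ?thesis
    unfolding res_eq FactRing_def
    using M.a_rcos_self[OF x] M.a_rcos_const[of x] by auto
qed

lemma \<pi>_eq_iff:
  assumes "x \<in> ge 0" "y \<in> ge 0"
  shows "\<pi> x = \<pi> y \<longleftrightarrow> x \<ominus> y \<in> gt 0"
proof -
  interpret p: ring_hom_ring OL res \<pi> by (rule \<pi>_hom)
  have c: "x \<in> carrier OL" "y \<in> carrier OL" "\<ominus> y \<in> carrier OL" using assms ge_neg OL_carrier by auto
  have "\<pi> (x \<ominus> y) = \<pi> x \<ominus>\<^bsub>res\<^esub> \<pi> y"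
    using p.hom_add[OF c(1,3)] p.hom_a_inv[OF c(2)] OL_neg[OF assms(2)] by (simp add: a_minus_def)
  then have "x \<ominus> y \<in> gt 0 \<longleftrightarrow> \<pi> x \<ominus>\<^bsub>res\<^esub> \<pi> y = \<zero>\<^bsub>res\<^esub>" using \<pi>_zero_iff[OF ge_minus[OF assms]] by simp
  also have "\<dots> \<longleftrightarrow> \<pi> x = \<pi> y" using p.S.r_right_minus_eq p.hom_closed c by simp
  finally show ?thesis by blast
qed

end

locale valued_extension = valued_field L v for L :: "('a, 'm) ring_scheme" (structure)
  and v :: "'a \<Rightarrow> 'g::linordered_ab_group_add" +
  fixes K :: "'a set"
  assumes K: "subfield K L" and finite_dim: "finite_dimension K (carrier L)"
begin

lemmas K_subring = subringE[OF subfieldE(1)[OF K]]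
lemmas K_carr = subsetD[OF K_subring(1)]

lemma K_inv: "a \<in> K \<Longrightarrow> a \<noteq> \<zero> \<Longrightarrow> inv a \<in> K"
  using subfield_m_inv(1)[OF K, of a] by simp

abbreviation OK where "OK \<equiv> val_ring L v K"
abbreviation Kv where "Kv \<equiv> residue_subfield L v K"

lemma OK_iff: "c \<in> OK \<longleftrightarrow> c \<in> K \<and> c \<in> ge 0"
  using K_carr by (auto simp: val_ring_def ge_def)

lemma Kv_eq: "Kv = \<pi> ` OK"
  by (simp add: residue_subfield_def val_ideal_eq)

lemma Kv_subfield: "subfield Kv res"
proof -
  interpret B: cring OL by (rule OL_cring)
  interpret R: field res by (rule residue_is_field)
  interpret p: ring_hom_ring OL res \<pi> by (rule \<pi>_hom)
  have sub: "subring OK OL"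
  proof (rule B.subringI)
    show "OK \<subseteq> carrier OL" unfolding OL_carrier using OK_iff by blast
    show "\<one>\<^bsub>OL\<^esub> \<in> OK" by (simp add: OK_iff one_ge K_subring(3))
    fix a b assume "a \<in> OK"
    then have a: "a \<in> K" "a \<in> ge 0" by (simp_all add: OK_iff)
    show "\<ominus>\<^bsub>OL\<^esub> a \<in> OK" unfolding OK_iff OL_neg[OF a(2)] using K_subring(5)[OF a(1)] ge_neg[OF a(2)] ..
    assume "b \<in> OK"
    then have b: "b \<in> K" "b \<in> ge 0" by (simp_all add: OK_iff)
    show "a \<otimes>\<^bsub>OL\<^esub> b \<in> OK" "a \<oplus>\<^bsub>OL\<^esub> b \<in> OK"
      using ge_mult[OF a(2) b(2)] ge_add[OF a(2) b(2)] K_subring(6,7)[OF a(1) b(1)] by (simp_all add: OK_iff)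
  qed
  show ?thesis
  proof (rule R.subfieldI')
    show "subring Kv res" unfolding Kv_eq by (rule p.img_is_subring[OF sub])
    fix k assume k: "k \<in> Kv - {\<zero>\<^bsub>res\<^esub>}"
    then obtain c where c: "c \<in> OK" "k = \<pi> c" unfolding Kv_eq by blast
    have cg: "c \<in> ge 0" "c \<in> K" using c(1) OK_iff by auto
    have "\<pi> c \<noteq> \<zero>\<^bsub>res\<^esub>" using k unfolding c(2) by blast
    then have "c \<notin> gt 0" using \<pi>_zero_iff[OF cg(1)] by blast
    then have nz: "c \<noteq> \<zero>" "v c = 0" using cg(1) by (auto simp: ge_def gt_def)
    note i = v_inv[OF ge_carrier[OF cg(1)] nz(1)]
    have ig: "inv c \<in> ge 0" using i nz(2) by (simp add: ge_def)
    have "\<pi> (inv c \<otimes>\<^bsub>OL\<^esub> c) = \<pi> (inv c) \<otimes>\<^bsub>res\<^esub> k"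
      unfolding c(2) using ig cg(1) OL_carrier by (intro p.hom_mult) auto
    moreover have "\<pi> (inv c \<otimes>\<^bsub>OL\<^esub> c) = \<one>\<^bsub>res\<^esub>" using p.hom_one by (simp add: i(4))
    ultimately have "\<pi> (inv c) \<otimes>\<^bsub>res\<^esub> k = \<one>\<^bsub>res\<^esub>" by (rule trans[OF sym])
    moreover have "\<pi> (inv c) \<in> carrier res" "k \<in> carrier res"
      unfolding \<pi>_surj c(2) using ig cg(1) by blast+
    ultimately have "inv\<^bsub>res\<^esub> k = \<pi> (inv c)"
      using R.comm_inv_char[of k "\<pi> (inv c)"] R.m_comm[of k "\<pi> (inv c)"] by simp
    moreover have "inv c \<in> OK" unfolding OK_iff using K_inv[OF cg(2) nz(1)] ig ..
    ultimately show "inv\<^bsub>res\<^esub> k \<in> Kv" unfolding Kv_eq by blast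
  qed
qed

text \<open>A linear relation between lifts can be normalised by dividing by a coefficient of least value;
  its reduction is then a nontrivial relation between the residues.\<close>

lemma lift_independent:
  assumes us: "set us \<subseteq> ge 0" and ind: "ring.independent res Kv (map \<pi> us)"
  shows "independent K us"
proof (rule ccontr)
  interpret R: field res by (rule residue_is_field)
  interpret p: ring_hom_ring OL res \<pi> by (rule \<pi>_hom)
  assume dep: "dependent K us"
  have usc: "set us \<subseteq> carrier L" using us ge_carrier by blast
  obtain Ks where Ks: "length Ks = length us" "combine Ks us = \<zero>" "set Ks \<subseteq> K" "set Ks \<noteq> {\<zero>}"
    by (rule dependent_imp_non_trivial_combine[OF K usc dep])
  have "us \<noteq> []" using dep by auto
  then have "set Ks \<noteq> {}" using Ks(1) by auto
  let ?S = "set Ks - {\<zero>}"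
  have S: "v ` ?S \<noteq> {}" "finite (v ` ?S)"
    using Ks(4) \<open>set Ks \<noteq> {}\<close> subset_singletonD[of "set Ks" \<zero>] by auto
  obtain k0 where k0S: "k0 \<in> ?S" "v k0 = Min (v ` ?S)" using Min_in[OF S(2,1)] by (metis imageE)
  have k0: "k0 \<in> set Ks" "k0 \<noteq> \<zero>" using k0S(1) by auto
  have k0_min: "v k0 \<le> v k" if "k \<in> set Ks" "k \<noteq> \<zero>" for k
    unfolding k0S(2) using that by (intro Min_le[OF S(2)]) blast
  have KL: "set Ks \<subseteq> carrier L" using Ks(3) K_carr by blast
  have k0c: "k0 \<in> carrier L" using k0(1) KL by blast
  note i = v_inv[OF k0c k0(2)]
  define Ls where "Ls = map ((\<otimes>) (inv k0)) Ks"
  have Ls: "set Ls \<subseteq> OK"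
  proof
    fix l assume "l \<in> set Ls"
    then obtain k where k: "k \<in> set Ks" "l = inv k0 \<otimes> k" unfolding Ls_def by auto
    have kc: "k \<in> carrier L" using k(1) KL by blast
    have "l \<in> K" unfolding k(2) using K_inv[OF _ k0(2)] k0(1) k(1) Ks(3) K_subring(6) by blast
    moreover have "l \<in> ge 0"
      unfolding k(2) using k0_min[OF k(1)] i kc v_mult[OF i(1) kc i(2)]
      by (cases "k = \<zero>") (auto simp: ge_def)
    ultimately show "l \<in> OK" using OK_iff by blast
  qed
  have LsO: "set Ls \<subseteq> carrier OL" and usO: "set us \<subseteq> carrier OL"
    unfolding OL_carrier using Ls OK_iff us by auto
  have "combine Ls us = \<zero>"
    unfolding Ls_def combine_r_distr[OF KL usc i(1), symmetric] using Ks(2) i(1) by simp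
  then have "ring.combine OL Ls us = \<zero>\<^bsub>OL\<^esub>"
    using subring_combine[OF val_ring_subring] by (simp add: val_ring_eq)
  then have "R.combine (map \<pi> Ls) (map \<pi> us) = \<zero>\<^bsub>res\<^esub>"
    using p.combine_hom[OF LsO usO] p.hom_zero by simp
  moreover have "set (map \<pi> Ls) \<subseteq> Kv" unfolding Kv_eq set_map by (rule image_mono[OF Ls])
  ultimately have "set (take (length (map \<pi> us)) (map \<pi> Ls)) \<subseteq> {\<zero>\<^bsub>res\<^esub>}"
    by (intro R.independent_imp_trivial_combine[OF Kv_subfield ind])
  moreover have take: "take (length (map \<pi> us)) (map \<pi> Ls) = map \<pi> Ls" using Ks(1) by (simp add: Ls_def)
  ultimately have sub: "set (map \<pi> Ls) \<subseteq> {\<zero>\<^bsub>res\<^esub>}" by (simp only: take)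
  have "inv k0 \<otimes> k0 \<in> set Ls" unfolding Ls_def using k0(1) by simp
  then have "\<pi> \<one> \<in> set (map \<pi> Ls)" unfolding i(4) by simp
  from subsetD[OF sub this] have "\<pi> \<one> = \<zero>\<^bsub>res\<^esub>" by (rule singletonD)
  moreover have "\<pi> \<one> = \<one>\<^bsub>res\<^esub>" using p.hom_one by simp
  ultimately have "\<one>\<^bsub>res\<^esub> = \<zero>\<^bsub>res\<^esub>" by (rule trans[OF sym, rotated])
  then show False using R.one_not_zero by (rule notE[rotated])
qed

text \<open>The dimension of \<open>Lv\<close> over \<open>Kv\<close> is a meaningful number only once it is known to be finite.\<close>

lemma residue_finite_dimension: "ring.finite_dimension res Kv (carrier res)"
proof -
  interpret R: field res by (rule residue_is_field)
  obtain n where n: "dimension n K (carrier L)" using finite_dim by blast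
  show ?thesis
  proof (rule R.finite_dimension_if_bounded[OF Kv_subfield, of n])
    fix ws assume ws: "R.independent Kv ws"
    have "set ws \<subseteq> \<pi> ` ge 0" using R.independent_in_carrier[OF ws] \<pi>_surj by simp
    then have "\<exists>us. set us \<subseteq> ge 0 \<and> map \<pi> us = ws"
    proof (induction ws)
      case (Cons w ws)
      then obtain us u where "set us \<subseteq> ge 0" "map \<pi> us = ws" "u \<in> ge 0" "w = \<pi> u" by auto
      then show ?case by (intro exI[of _ "u # us"]) simp
    qed simp
    then obtain us where us: "set us \<subseteq> ge 0" "map \<pi> us = ws" by blast
    have "independent K us" using lift_independent[OF us(1)] us(2) ws by simp
    then have "length us \<le> n"
      using independent_length_le_dimension[OF K n] us(1) ge_carrier by blast
    then show "length ws \<le> n" using us(2) by auto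
  qed
qed

text \<open>As \<open>vL = vK\<close>, some \<open>c \<in> K\<close> has the value of \<open>x\<close>; as \<open>Lv = Kv\<close>, some \<open>d \<in> K\<close> has the residue of
  \<open>x / c\<close>; and \<open>c d\<close> approximates \<open>x\<close>.\<close>

lemma immediate_if_degrees_one:
  assumes e: "ramification_index L v K = 1" and f: "inertia_degree L v K = 1"
    and x: "x \<in> carrier L" "x \<notin> K"
  shows "\<exists>c\<in>K. v x < v (x \<ominus> c)"
proof -
  interpret R: field res by (rule residue_is_field)
  have xz: "x \<noteq> \<zero>" using x(2) K_subring(2) by blast
  have "R.dimension 1 Kv (carrier res)"
    using R.finite_dimensionE[OF Kv_subfield residue_finite_dimension] f
    by (simp add: inertia_degree_def field_degree_def over_def)
  then have Kv: "carrier res = Kv" using R.dimension_one_eq[OF Kv_subfield] by simp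
  have KG: "convex_subgroup (value_group L v K) (value_group L v K)"
    unfolding convex_subgroup_def
  proof (intro conjI ballI)
    show "0 \<in> value_group L v K"
      using v_one K_subring(3) imageI[of \<one> "K - {\<zero>}" v] by (simp add: value_group_def)
    fix \<alpha> assume "\<alpha> \<in> value_group L v K"
    then obtain a where a: "a \<in> K" "a \<noteq> \<zero>" "\<alpha> = v a" by (auto simp: value_group_def)
    then show "- \<alpha> \<in> value_group L v K"
      using v_inv[of a] K_carr[of a] K_inv[of a] imageI[of "inv a" "K - {\<zero>}" v] by (simp add: value_group_def)
    fix \<beta> assume "\<beta> \<in> value_group L v K"
    then obtain b where b: "b \<in> K" "b \<noteq> \<zero>" "\<beta> = v b" by (auto simp: value_group_def)
    then show "\<alpha> + \<beta> \<in> value_group L v K"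
      using a v_mult[of a b] K_carr K_subring(6)[of a b] imageI[of "a \<otimes> b" "K - {\<zero>}" v]
      by (simp add: value_group_def integral_iff)
  qed auto
  have "v x \<in> value_group L v K"
  proof -
    obtain C where C: "coset_group \<Gamma> (value_group L v K) = {C}"
      using e unfolding ramification_index_def by (auto simp: card_1_singleton_iff)
    have "0 \<in> \<Gamma>" using value_groupI[of \<one>] v_one by simp
    then have "coset_of (value_group L v K) 0 = C" "coset_of (value_group L v K) (v x) = C"
      using C value_groupI[OF x(1) xz] unfolding coset_group_def by blast+
    then have "coset_of (value_group L v K) (v x) = value_group L v K"
      using coset_of_eq_subgroup_iff[OF KG, of 0] convex_subgroupD(2)[OF KG] by simp
    then show ?thesis using coset_of_eq_subgroup_iff[OF KG] by blast
  qed
  then obtain c where "c \<in> K - {\<zero>}" "v x = v c" unfolding value_group_def by blast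
  then have c: "c \<in> K" "c \<noteq> \<zero>" "v c = v x" by auto
  have cc: "c \<in> carrier L" using K_carr c(1) by blast
  note i = v_inv[OF cc c(2)]
  have u: "x \<otimes> inv c \<in> ge 0" using v_div[OF x(1) cc xz c(2)] c(3) x(1) i by (simp add: ge_def)
  then have "\<pi> (x \<otimes> inv c) \<in> Kv" using Kv \<pi>_surj by blast
  then obtain d where d: "d \<in> OK" "\<pi> (x \<otimes> inv c) = \<pi> d" unfolding Kv_eq by blast
  have dg: "d \<in> K" "d \<in> ge 0" "d \<in> carrier L" using d(1) OK_iff K_carr by auto
  have "x \<otimes> inv c \<ominus> d \<in> gt 0" using d(2) \<pi>_eq_iff[OF u dg(2)] by blast
  from gt_mult[OF self_ge[OF cc] this] have "c \<otimes> (x \<otimes> inv c \<ominus> d) \<in> gt (v c)" by simp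
  moreover have "c \<otimes> (x \<otimes> inv c \<ominus> d) = x \<ominus> c \<otimes> d"
  proof -
    have "c \<otimes> (x \<otimes> inv c) = x" using x(1) cc i m_lcomm[of c x "inv c"] by simp
    then show ?thesis using x(1) cc dg(3) i(1) by (simp add: a_minus_def r_distr r_minus)
  qed
  moreover have cd: "c \<otimes> d \<in> K" using c dg K_subring(6) by blast
  moreover have "x \<ominus> c \<otimes> d \<noteq> \<zero>" using r_right_minus_eq[OF x(1) K_carr[OF cd]] cd x(2) by auto
  ultimately show ?thesis using c(3) by (auto simp: gt_def)
qed

lemma of_nat_residue:
  fixes n :: nat
  shows "[n] \<cdot> \<one> \<in> K \<and> [n] \<cdot> \<one> \<in> ge 0 \<and>
    pow (add_monoid (res\<lparr>carrier := Kv\<rparr>)) \<one>\<^bsub>res\<^esub> n = \<pi> ([n] \<cdot> \<one>)"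
proof (induction n)
  case 0
  interpret p: ring_hom_ring OL res \<pi> by (rule \<pi>_hom)
  show ?case using p.hom_zero by (simp add: nat_pow_def zero_ge K_subring(2))
next
  case (Suc n)
  interpret p: ring_hom_ring OL res \<pi> by (rule \<pi>_hom)
  have c: "[n] \<cdot> \<one> \<in> carrier OL" "\<one> \<in> carrier OL" unfolding OL_carrier using Suc one_ge by auto
  have "\<pi> ([n] \<cdot> \<one> \<oplus> \<one>) = \<pi> ([n] \<cdot> \<one>) \<oplus>\<^bsub>res\<^esub> \<one>\<^bsub>res\<^esub>"
    using p.hom_add[OF c] p.hom_one by simp
  then show ?case using Suc ge_add[OF _ one_ge] K_subring(3,7) by (simp add: nat_pow_def)
qed

lemma residue_char_dvd_iff: "residue_char L v K dvd n \<longleftrightarrow> [n] \<cdot> \<one> \<in> gt 0"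
proof -
  interpret R: field res by (rule residue_is_field)
  interpret Kv: field "res\<lparr>carrier := Kv\<rparr>" using R.subfield_iff(2)[OF Kv_subfield] .
  have "residue_char L v K dvd n \<longleftrightarrow> pow (add_monoid (res\<lparr>carrier := Kv\<rparr>)) \<one>\<^bsub>res\<^esub> n = \<zero>\<^bsub>res\<^esub>"
    unfolding residue_char_def ring_char_def
    using group.pow_eq_id[OF Kv.add.group_axioms, of "\<one>\<^bsub>res\<^esub>" n] Kv.one_closed by simp
  then show ?thesis using of_nat_residue[of n] \<pi>_zero_iff by simp
qed

lemma ring_char_dvd_iff: "ring_char (L\<lparr>carrier := K\<rparr>) dvd n \<longleftrightarrow> [n] \<cdot> \<one> = \<zero>"
proof -
  interpret K: field "L\<lparr>carrier := K\<rparr>" using subfield_iff(2)[OF K] .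
  have "pow (add_monoid (L\<lparr>carrier := K\<rparr>)) \<one> n = [n] \<cdot> \<one>" by (simp add: add_pow_def nat_pow_def)
  then show ?thesis
    unfolding ring_char_def
    using group.pow_eq_id[OF K.add.group_axioms, of \<one> n] K.one_closed by simp
qed

text \<open>If \<open>n = char K > 0\<close>, then \<open>n\<close> vanishes in the residue field, so \<open>n = p m\<close>; since \<open>m < n\<close> is nonzero in
  \<open>K\<close>, the other factor \<open>p\<close> is zero.\<close>

lemma char_zero_or_residue_char:
  assumes p: "residue_char L v K = p" "0 < p"
  shows "ring_char (L\<lparr>carrier := K\<rparr>) = 0 \<and> [p] \<cdot> \<one> \<noteq> \<zero> \<or>
    ring_char (L\<lparr>carrier := K\<rparr>) \<noteq> 0 \<and> [p] \<cdot> \<one> = \<zero>"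
proof (cases "ring_char (L\<lparr>carrier := K\<rparr>) = 0")
  case True
  then show ?thesis using ring_char_dvd_iff[of p] p(2) by simp
next
  case False
  let ?n = "ring_char (L\<lparr>carrier := K\<rparr>)"
  have "[?n] \<cdot> \<one> = \<zero>" using ring_char_dvd_iff[of ?n] by simp
  then have "p dvd ?n" using residue_char_dvd_iff[of ?n] p(1) zero_gt by simp
  then obtain m where m: "?n = p * m" by blast
  then have m0: "0 < m" using False by (cases m) auto
  have mn: "m < ?n" if "p \<noteq> 1" unfolding m using m0 p(2) that by (cases p) auto
  have pc: "[p] \<cdot> \<one> \<in> carrier L" "[m] \<cdot> \<one> \<in> carrier L" by auto
  have "[p] \<cdot> \<one> \<otimes> [m] \<cdot> \<one> = [p] \<cdot> ([m] \<cdot> \<one>)" using add_pow_ldistr[of \<one> "[m] \<cdot> \<one>" p] by simp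
  also have "\<dots> = [?n] \<cdot> \<one>" unfolding m using add.nat_pow_pow[of \<one> p m] by (simp add: mult.commute)
  finally have "[p] \<cdot> \<one> = \<zero> \<or> [m] \<cdot> \<one> = \<zero>" using \<open>[?n] \<cdot> \<one> = \<zero>\<close> pc by (simp add: integral_iff)
  moreover have "p \<noteq> 1" using residue_char_dvd_iff[of 1] p(1) v_one by (auto simp: gt_def)
  moreover have "\<not> ?n dvd m" if "p \<noteq> 1" using m0 mn[OF that] dvd_imp_le[of ?n m] by auto
  ultimately show ?thesis using ring_char_dvd_iff[of m] False by blast
qed

end

section \<open>The automorphism\<close>

context valued_extension
begin

text \<open>\<open>\<tau>\<^sup>-\<^sup>1(\<O>\<^sub>L)\<close> is a valuation ring of \<open>L\<close> above \<open>\<O>\<^sub>K\<close>, hence equal to \<open>\<O>\<^sub>L\<close>; as \<open>vL = vK\<close>, this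
  determines the values.\<close>

lemma unibranched_invariant:
  assumes uni: "unibranched L K v" and hom: "\<tau> \<in> ring_hom L L"
    and fixes_K: "\<And>c. c \<in> K \<Longrightarrow> \<tau> c = c"
    and imm: "\<And>x. x \<in> carrier L \<Longrightarrow> x \<notin> K \<Longrightarrow> \<exists>c\<in>K. v x < v (x \<ominus> c)"
    and x: "x \<in> carrier L" "x \<noteq> \<zero>"
  shows "v (\<tau> x) = v x"
proof -
  interpret s: ring_hom_cring L L \<tau>
    using hom by (intro ring_hom_cring.intro ring_hom_cring_axioms.intro is_cring)
  define R where "R = {x \<in> carrier L. \<tau> x \<in> ge 0}"
  have inv_hom: "\<tau> (inv y) = inv (\<tau> y)" "\<tau> y \<noteq> \<zero>" if "y \<in> carrier L" "y \<noteq> \<zero>" for y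
  proof -
    note i = v_inv[OF that]
    have "\<tau> y \<otimes> \<tau> (inv y) = \<one>" using s.hom_mult[OF that(1) i(1)] i(3) s.hom_one by simp
    moreover then show "\<tau> y \<noteq> \<zero>" using i(1) by (metis l_null one_not_zero s.hom_closed)
    ultimately show "\<tau> (inv y) = inv (\<tau> y)" using comm_inv_char[of "\<tau> y" "\<tau> (inv y)"] that(1) i(1) by simp
  qed
  have "subring R L"
  proof (rule subringI)
    show "R \<subseteq> carrier L" unfolding R_def by blast
    show "\<one> \<in> R" unfolding R_def using one_ge by simp
    fix a b assume "a \<in> R"
    then have a: "a \<in> carrier L" "\<tau> a \<in> ge 0" unfolding R_def by auto
    show "\<ominus> a \<in> R" unfolding R_def using a ge_neg by simp
    assume "b \<in> R"
    then have b: "b \<in> carrier L" "\<tau> b \<in> ge 0" unfolding R_def by auto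
    show "a \<otimes> b \<in> R" "a \<oplus> b \<in> R"
      unfolding R_def using a b ge_mult[OF a(2) b(2)] ge_add[OF a(2) b(2)] by simp_all
  qed
  moreover have "y \<in> R \<or> inv y \<in> R" if "y \<in> carrier L - {\<zero>}" for y
  proof -
    have y: "y \<in> carrier L" "y \<noteq> \<zero>" using that by auto
    have "\<tau> y \<in> ge 0 \<or> inv (\<tau> y) \<in> ge 0"
      using v_inv[of "\<tau> y"] inv_hom(2)[OF y] y(1) linear[of 0 "v (\<tau> y)"] by (auto simp: ge_def)
    then show ?thesis unfolding R_def using v_inv(1)[OF y] y(1) inv_hom(1)[OF y] by auto
  qed
  ultimately have "valuation_subring L R" unfolding valuation_subring_def by blast
  moreover have "R \<inter> K = OK"
  proof (intro subset_antisym subsetI)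
    fix c assume "c \<in> R \<inter> K"
    then show "c \<in> OK" unfolding OK_iff R_def using fixes_K[of c] by simp
  next
    fix c assume "c \<in> OK"
    then have "c \<in> K" "c \<in> ge 0" unfolding OK_iff by auto
    then show "c \<in> R \<inter> K" unfolding R_def using fixes_K[of c] K_carr by simp
  qed
  ultimately have "R = val_ring L v (carrier L)" using uni unfolding unibranched_def by blast
  then have ge_iff: "y \<in> ge 0 \<longleftrightarrow> \<tau> y \<in> ge 0" if "y \<in> carrier L" for y
    using that unfolding R_def val_ring_eq by blast
  obtain c where c: "c \<in> K" "c \<noteq> \<zero>" "v c = v x"
  proof (cases "x \<in> K")
    case False
    then obtain d where d: "d \<in> K" "v x < v (x \<ominus> d)" using imm x(1) by blast
    have dc: "d \<in> carrier L" using K_carr d(1) by blast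
    have "\<ominus> (x \<ominus> d) \<in> gt (v x)" using d(2) x dc by (intro gt_neg) (auto simp: gt_def)
    from v_add_eq[OF x this] have "x \<oplus> \<ominus> (x \<ominus> d) \<noteq> \<zero>" "v (x \<oplus> \<ominus> (x \<ominus> d)) = v x" by auto
    moreover have "x \<oplus> \<ominus> (x \<ominus> d) = d" using x(1) dc by algebra
    ultimately show ?thesis using that d(1) by auto
  qed (use that x in blast)
  have cc: "c \<in> carrier L" using K_carr c(1) by blast
  have sx: "\<tau> x \<in> carrier L" "\<tau> x \<noteq> \<zero>" using x inv_hom(2) by auto
  have ic: "inv c \<in> K" "inv c \<in> carrier L" "inv c \<noteq> \<zero>" "v (inv c) = - v c"
    using K_inv[OF c(1,2)] v_inv[OF cc c(2)] by auto
  have ix: "inv x \<in> carrier L" "inv x \<noteq> \<zero>" "v (inv x) = - v x" using v_inv[OF x] by auto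
  have "x \<otimes> inv c \<in> ge 0" using v_mult[OF x(1) ic(2) x(2) ic(3)] ic c(3) x by (auto simp: ge_def)
  then have "\<tau> x \<otimes> inv c \<in> ge 0" using ge_iff[of "x \<otimes> inv c"] x(1) ic fixes_K by simp
  moreover have "\<tau> x \<otimes> inv c \<noteq> \<zero>" using sx ic by (simp add: integral_iff)
  ultimately have 1: "v c \<le> v (\<tau> x)" using v_mult[OF sx(1) ic(2) sx(2) ic(3)] ic(4) by (simp add: ge_def)
  have "inv x \<otimes> c \<in> ge 0" using v_mult[OF ix(1) cc ix(2) c(2)] ix c(3) cc by (auto simp: ge_def)
  then have "inv (\<tau> x) \<otimes> c \<in> ge 0" using ge_iff[of "inv x \<otimes> c"] ix(1) cc fixes_K[OF c(1)] inv_hom(1)[OF x] by simp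
  moreover have "inv (\<tau> x) \<otimes> c \<noteq> \<zero>" using v_inv[OF sx] cc c(2) by (simp add: integral_iff)
  ultimately have 2: "v (\<tau> x) \<le> v c" using v_mult[OF v_inv(1)[OF sx] cc v_inv(2)[OF sx] c(2)] v_inv(5)[OF sx] by (simp add: ge_def)
  from 1 2 show ?thesis using c(3) by simp
qed

text \<open>An extension of prime degree has no intermediate fields, so the fixed field of a nontrivial
  automorphism is the base field.\<close>

lemma prime_degree_fixed_field:
  assumes deg: "field_degree L K = p" and p: "Factorial_Ring.prime p"
    and hom: "\<tau> \<in> ring_hom L L" and fixes_K: "\<And>c. c \<in> K \<Longrightarrow> \<tau> c = c"
    and moved: "z \<in> carrier L" "\<tau> z \<noteq> z" and x: "x \<in> carrier L"
  shows "\<tau> x = x \<longleftrightarrow> x \<in> K"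
proof -
  interpret s: ring_hom_cring L L \<tau>
    using hom by (intro ring_hom_cring.intro ring_hom_cring_axioms.intro is_cring)
  define E where "E = {x \<in> carrier L. \<tau> x = x}"
  have EL: "E \<subseteq> carrier L" unfolding E_def by blast
  have KE: "K \<subseteq> E" unfolding E_def using K_carr fixes_K by blast
  have ring: "subring E L"
  proof (rule subringI)
    show "E \<subseteq> carrier L" by (rule EL)
    show "\<one> \<in> E" using KE K_subring(3) by blast
  qed (auto simp: E_def)
  have E: "subfield E L"
  proof (rule subfieldI'[OF ring])
    fix k assume k: "k \<in> E - {\<zero>}"
    then have kk: "k \<in> carrier L" "k \<noteq> \<zero>" "\<tau> k = k" unfolding E_def by auto
    note i = v_inv[OF kk(1,2)]
    have "k \<otimes> \<tau> (inv k) = \<one>" using s.hom_mult[OF kk(1) i(1)] i(3) s.hom_one kk(3) by simp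
    then have "inv k = \<tau> (inv k)" using comm_inv_char[of k "\<tau> (inv k)"] kk i(1) by simp
    then show "inv k \<in> E" unfolding E_def using i(1) by simp
  qed
  have "subalgebra K E L"
    unfolding subalgebra_def subalgebra_axioms_def
    using subring.axioms(1)[OF ring] subringE(6)[OF ring] KE by blast
  then have fin1: "finite_dimension K E"
    by (rule subalbegra_incl_imp_finite_dimension[OF K finite_dim _ EL])
  obtain n where "dimension n K (carrier L)" using finite_dim by blast
  then obtain us where us: "set us \<subseteq> carrier L" "Span K us = carrier L" using exists_base[OF K] by blast
  have "subalgebra K (Span E us) L"
    using Span_is_subalgebra[OF E us(1)] KE unfolding subalgebra_def subalgebra_axioms_def by blast
  then have "Span K us \<subseteq> Span E us" using subalgebra_Span_incl[OF K] Span_base_incl[OF E us(1)] by blast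
  then have "Span E us = carrier L" using us(2) Span_in_carrier[OF EL us(1)] by blast
  then have fin2: "finite_dimension E (carrier L)" using Span_finite_dimension[OF E us(1)] by simp
  have "p = dim K E * dim E (carrier L)"
    using telescopic_base_dim(2)[OF K E fin1 fin2] deg by (simp add: field_degree_def over_def)
  then have "dim K E = 1 \<or> dim E (carrier L) = 1" using p by (metis prime_product)
  then have "E = K"
  proof
    assume "dim K E = 1"
    then have "dimension 1 K E" using finite_dimensionE[OF K fin1] by (simp add: over_def)
    then show ?thesis using dimension_one_eq[OF K] KE K_subring(3) by blast
  next
    assume "dim E (carrier L) = 1"
    then have "dimension 1 E (carrier L)" using finite_dimensionE[OF E fin2] by (simp add: over_def)
    then have "carrier L = E" using dimension_one_eq[OF E] one_closed by blast
    then show ?thesis using moved unfolding E_def by blast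
  qed
  then show ?thesis using x unfolding E_def by blast
qed

end

lemma card_set_mset_le_size: "card (set_mset M) \<le> size M"
  by (induction M) (auto simp: card_insert_if)

locale prime_degree_automorphism = immediate_automorphism +
  assumes finite_dim: "finite_dimension K (carrier L)" and degree: "field_degree L K = p"
begin

text \<open>Otherwise the \<open>p + 1\<close> elements \<open>\<sigma>\<^sup>k x\<close> with \<open>k \<le> p\<close> would be distinct roots of the minimal
  polynomial of \<open>x\<close>, whose degree is at most \<open>p\<close>.\<close>

lemma automorphism_order:
  assumes x: "x \<in> carrier L"
  shows "s p x = x"
proof (rule ccontr)
  assume ne: "s p x \<noteq> x"
  then have xK: "x \<notin> K" using s_fixes by blast
  have inj: "a = b" if eq: "s k a = s k b" and c: "a \<in> carrier L" "b \<in> carrier L" for k a b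
  proof -
    have "s k (a \<ominus> b) = \<zero>" using s_minus[OF c, of k] eq c by (simp add: a_minus_def r_neg)
    then have "a \<ominus> b = \<zero>" using s_nonzero[of "a \<ominus> b" k] c by blast
    then show ?thesis using r_right_minus_eq[OF c] by blast
  qed
  have moved: "s k x \<noteq> x" if "0 < k" "k \<le> p" for k
  proof (cases "k = p")
    case False
    then have "s k x \<ominus> x \<noteq> \<zero>" using v_s_minus_self(1)[OF x xK] that by simp
    then show ?thesis using x by (auto simp: a_minus_def r_neg)
  qed (use ne in simp)
  have lt: "s i x \<noteq> s j x" if "i < j" "j \<le> p" for i j
  proof
    assume eq: "s i x = s j x"
    have "s j x = s i (s (j - i) x)" using that(1) by (metis comp_apply funpow_add le_add_diff_inverse less_imp_le)
    then have "s i x = s i (s (j - i) x)" using eq by simp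
    then have "x = s (j - i) x" by (rule inj[OF _ x s_closed[OF x]])
    moreover have "0 < j - i" "j - i \<le> p" using that by auto
    ultimately show False using moved[of "j - i"] by metis
  qed
  have "inj_on (\<lambda>k. s k x) {..p}"
  proof (rule inj_onI)
    fix i j assume ij: "i \<in> {..p}" "j \<in> {..p}" "s i x = s j x"
    then show "i = j" using lt[of i j] lt[of j i] by (cases i j rule: linorder_cases) simp_all
  qed
  then have card: "card ((\<lambda>k. s k x) ` {..p}) = Suc p" by (simp only: card_image card_atMost)
  have alg: "(algebraic over K) x"
    using finite_dimension_imp_algebraic[OF K carrier_is_subring finite_dim x] .
  let ?m = "Irr K x"
  have m: "?m \<in> carrier (K[X])" "pirreducible K ?m" "eval ?m x = \<zero>" using IrrE[OF K x alg] by auto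
  have mK: "set ?m \<subseteq> K" using m(1) unfolding univ_poly_carrier[symmetric] polynomial_def by auto
  have mL: "set ?m \<subseteq> carrier L" using mK K_carr by blast
  have mP: "?m \<in> carrier (poly_ring L)"
    using carrier_polynomial[OF subfieldE(1)[OF K]] m(1) unfolding univ_poly_carrier[symmetric] by blast
  have "dimension p K (carrier L)"
    using finite_dimensionE[OF K finite_dim] degree by (simp add: field_degree_def over_def)
  then have "length (exp_base x (degree ?m)) \<le> p"
    using independent_length_le_dimension[OF K _ exp_base_independent[OF K x alg]]
      independent_in_carrier[OF exp_base_independent[OF K x alg]] by blast
  then have deg: "degree ?m \<le> p" by (simp add: exp_base_def)
  have m0: "?m \<noteq> []" using pirreducible_degree[OF K m(1,2)] by auto
  have "(\<lambda>k. s k x) ` {..p} \<subseteq> set_mset (roots ?m)"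
  proof
    fix y assume "y \<in> (\<lambda>k. s k x) ` {..p}"
    then obtain k where y: "y = s k x" by blast
    interpret h: ring_hom_ring L L "s k"
      by (rule ring_hom_ringI2[OF ring_axioms ring_axioms s_hom])
    have "map (s k) ?m = ?m" using mK s_fixes by (intro map_idI) blast
    then have "eval ?m y = s k (eval ?m x)" using h.eval_hom'[OF x mL] y by simp
    then have "eval ?m y = \<zero>" using m(3) s_zero by simp
    then have "is_root ?m y" unfolding is_root_def using x y m0 by simp
    then show "y \<in> set_mset (roots ?m)" using roots_mem_iff_is_root[OF mP] by simp
  qed
  then have "Suc p \<le> card (set_mset (roots ?m))" unfolding card[symmetric] by (rule card_mono[OF finite_set_mset])
  also have "\<dots> \<le> size (roots ?m)" by (rule card_set_mset_le_size)
  also have "\<dots> \<le> p" using size_roots_le_degree[OF mP] deg by simp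
  finally show False by simp
qed

end

sublocale prime_degree_automorphism \<subseteq> immediate_cyclic
  by unfold_locales (rule automorphism_order)

section \<open>The value of \<open>p\<close>\<close>

context immediate_cyclic
begin

text \<open>For a nontrivial \<open>p\<close>-th root of unity \<open>\<omega> \<in> K\<close> some Lagrange resolvent
  \<open>r = \<Sum> \<omega>\<^sup>k \<sigma>\<^sup>k z\<close> is nonzero by the Galois coordinates, and \<open>\<sigma> r = \<omega>\<^sup>-\<^sup>1 r\<close>, so \<open>v (1 - \<omega>) \<in> \<Sigma>\<close>.  Moreover
  \<open>p = \<Sum> (1 - \<omega>\<^sup>k)\<close> is divisible by \<open>1 - \<omega>\<close>.\<close>

lemma v_p_in_Sigma:
  assumes w: "w \<in> K" "w [^] p = \<one>" "w \<noteq> \<one>" and p0: "[p] \<cdot> \<one> \<noteq> \<zero>"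
  shows "v ([p] \<cdot> \<one>) \<in> Sig"
proof -
  have wc: "w \<in> carrier L" using K_carr w(1) by blast
  have wz: "w \<noteq> \<zero>" using w(2) p_gt_1 by (auto simp: nat_pow_zero)
  have pow: "w [^] n \<noteq> \<zero> \<and> v (w [^] n) = nmul n (v w)" for n :: nat
    using wc wz by (induction n) (auto simp: v_one v_mult integral_iff add.commute)
  have vw: "v w = 0"
  proof -
    have "nmul p (v w) = 0" using pow[of p] w(2) v_one by simp
    moreover have "nmul p (v w) < 0" if "v w < 0"
      using nmul_strict_mono[OF that, of p] p_gt_1 by (simp add: nmul_zero)
    moreover have "0 < nmul p (v w)" if "0 < v w"
      using nmul_strict_mono[OF that, of p] p_gt_1 by (simp add: nmul_zero)
    ultimately show ?thesis using less_linear[of "v w" 0] by auto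
  qed
  let ?d = "\<one> \<ominus> w"
  have d: "?d \<in> carrier L" "?d \<noteq> \<zero>" using wc w(3) by (auto simp: r_right_minus_eq)
  have w0: "w \<in> ge 0" using wc vw by (simp add: ge_def)
  define r where "r z = (\<Oplus>k\<in>{..<p}. w [^] k \<otimes> s k z)" for z
  have rc: "r z \<in> carrier L" if "z \<in> carrier L" for z
    unfolding r_def using that wc by (intro finsum_closed) auto
  have "w \<otimes> \<sigma> (r z) = r z" if z: "z \<in> carrier L" for z
  proof -
    have "\<sigma> (r z) = (\<Oplus>k\<in>{..<p}. \<sigma> (w [^] k \<otimes> s k z))"
      unfolding r_def using s_finsum[of "\<lambda>k. w [^] k \<otimes> s k z" "{..<p}" 1] z wc by simp
    also have "\<dots> = (\<Oplus>k\<in>{..<p}. w [^] k \<otimes> s (Suc k) z)"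
      using z wc s_pow[OF wc, of 1] sigma_eqs(4)[OF w(1)]
      by (intro finsum_cong') (auto simp: sigma_eqs(2))
    finally have "w \<otimes> \<sigma> (r z) = (\<Oplus>k\<in>{..<p}. w \<otimes> (w [^] k \<otimes> s (Suc k) z))"
      using z wc by (simp add: finsum_rdistr del: funpow.simps)
    also have "\<dots> = (\<Oplus>k\<in>{..<p}. w [^] Suc k \<otimes> s (Suc k) z)"
      using z wc by (intro finsum_cong') (auto simp: m_ac simp del: funpow.simps)
    also have "\<dots> = r z"
      unfolding r_def using z wc w(2) sigma_order[OF z]
      by (intro cyclic_shift[of "\<lambda>k. w [^] k \<otimes> s k z"]) auto
    finally show ?thesis .
  qed
  then have Dr: "w \<otimes> D (r z) = ?d \<otimes> r z" if "z \<in> carrier L" for z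
    using that rc[OF that] wc by (simp add: a_minus_def r_distr l_distr r_minus l_minus)
  obtain x where x: "x \<in> ge 0" "x \<notin> K" using Sigma_nonempty Sigma_iff by blast
  have xc: "x \<in> carrier L" using ge_carrier x(1) by blast
  obtain a where a: "\<And>j. a j \<in> ge (- nmul (p - 1) (v (D x)))"
    "\<And>k. k < p \<Longrightarrow> (\<Oplus>j\<in>{..<p}. a j \<otimes> s k (x [^] j)) = (if k = 0 then \<one> else \<zero>)"
    using galois_coordinates[OF x] by blast
  have ac: "a j \<in> carrier L" for j using a(1) ge_carrier by blast
  have "\<exists>j. r (x [^] (j::nat)) \<noteq> \<zero>"
  proof (rule ccontr)
    assume "\<nexists>j. r (x [^] (j::nat)) \<noteq> \<zero>"
    then have "(\<Oplus>j\<in>{..<p}. a j \<otimes> r (x [^] j)) = (\<Oplus>j\<in>{..<p}. \<zero>)"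
      using ac by (intro finsum_cong') auto
    then have "\<zero> = (\<Oplus>j\<in>{..<p}. a j \<otimes> r (x [^] j))" by simp
    also have "\<dots> = (\<Oplus>j\<in>{..<p}. \<Oplus>k\<in>{..<p}. w [^] k \<otimes> (a j \<otimes> s k (x [^] j)))"
      using ac xc wc unfolding r_def
      by (intro finsum_cong') (auto simp: finsum_rdistr m_lcomm intro!: finsum_closed finsum_cong')
    also have "\<dots> = (\<Oplus>k\<in>{..<p}. \<Oplus>j\<in>{..<p}. w [^] k \<otimes> (a j \<otimes> s k (x [^] j)))"
      using ac xc wc by (intro finsum_swap) auto
    also have "\<dots> = (\<Oplus>k\<in>{..<p}. w [^] k \<otimes> (\<Oplus>j\<in>{..<p}. a j \<otimes> s k (x [^] j)))"
      using ac xc wc by (intro finsum_cong' refl finsum_rdistr[symmetric]) (auto intro!: finsum_closed)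
    also have "\<dots> = (\<Oplus>k\<in>{..<p}. if 0 = k then \<one> else \<zero>)"
      using a(2) wc by (intro finsum_cong') auto
    also have "\<dots> = \<one>" using p_gt_1 by (intro finsum_singleton) auto
    finally show False by simp
  qed
  then obtain j where j: "r (x [^] (j::nat)) \<noteq> \<zero>" by blast
  define y where "y = r (x [^] j)"
  have y: "y \<in> carrier L" "y \<noteq> \<zero>" unfolding y_def using j rc xc by auto
  have wD: "w \<otimes> D y = ?d \<otimes> y" unfolding y_def using Dr xc by simp
  have Dy: "D y \<in> carrier L" "D y \<noteq> \<zero>"
  proof -
    show Dc: "D y \<in> carrier L" using y by simp
    show "D y \<noteq> \<zero>"
    proof
      assume "D y = \<zero>"
      then have "?d \<otimes> y = \<zero>" unfolding wD[symmetric] using wc by (simp only: r_null)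
      then show False using d y by (simp add: integral_iff)
    qed
  qed
  have "v (D y) = v ?d + v y" using v_mult[OF wc Dy(1) wz Dy(2)] v_mult[OF d(1) y(1) d(2) y(2)] wD vw by simp
  then have "v (D y \<otimes> inv y) = v ?d" using v_div[OF Dy(1) y(1) Dy(2) y(2)] by simp
  moreover have "\<sigma> y \<noteq> y" using Dy(2) y(1) by (auto simp: a_minus_def r_neg)
  ultimately have dS: "v ?d \<in> Sig" unfolding Sigma_set_def using y by force
  have one_minus: "\<one> \<ominus> w [^] n \<in> ge (v ?d)" for n :: nat
  proof (induction n)
    case 0
    show ?case by (simp add: a_minus_def r_neg zero_ge)
  next
    case (Suc n)
    have "w [^] n \<otimes> ?d \<in> ge (v ?d)" using ge_mult[OF ge_pow[OF w0] self_ge[OF d(1)], of n] by simp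
    then have "(\<one> \<ominus> w [^] n) \<oplus> w [^] n \<otimes> ?d \<in> ge (v ?d)" using Suc by (intro ge_add)
    moreover have "(\<one> \<ominus> w [^] n) \<oplus> w [^] n \<otimes> ?d = \<one> \<ominus> w [^] n \<otimes> w"
      using wc nat_pow_closed[OF wc, of n] by algebra
    ultimately show ?case by simp
  qed
  have geom: "?d \<otimes> (\<Oplus>k\<in>{..<n}. w [^] k) = \<one> \<ominus> w [^] n \<and>
    [n] \<cdot> \<one> \<ominus> (\<Oplus>k\<in>{..<n}. w [^] k) \<in> ge (v ?d)" for n :: nat
  proof (induction n)
    case 0
    show ?case using d by (simp add: a_minus_def r_neg zero_ge)
  next
    case (Suc n)
    let ?G = "\<Oplus>k\<in>{..<n}. w [^] k"
    have G: "?G \<in> carrier L" "w [^] n \<in> carrier L" "[n] \<cdot> \<one> \<in> carrier L" using wc by (auto intro!: finsum_closed)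
    have GS: "(\<Oplus>k\<in>{..<Suc n}. w [^] k) = w [^] n \<oplus> ?G"
      unfolding lessThan_Suc using wc by (intro finsum_insert) auto
    have "?d \<otimes> (w [^] n \<oplus> ?G) = w [^] n \<otimes> ?d \<oplus> ?d \<otimes> ?G" using G d(1) by (simp add: r_distr m_comm)
    also have "\<dots> = w [^] n \<otimes> ?d \<oplus> (\<one> \<ominus> w [^] n)" using Suc by simp
    also have "\<dots> = \<one> \<ominus> w [^] n \<otimes> w" using wc G(2) by algebra
    finally have 1: "?d \<otimes> (w [^] n \<oplus> ?G) = \<one> \<ominus> w [^] n \<otimes> w" .
    have "([n] \<cdot> \<one> \<ominus> ?G) \<oplus> (\<one> \<ominus> w [^] n) \<in> ge (v ?d)" using Suc one_minus by (intro ge_add) auto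
    moreover have "([n] \<cdot> \<one> \<ominus> ?G) \<oplus> (\<one> \<ominus> w [^] n) = ([n] \<cdot> \<one> \<oplus> \<one>) \<ominus> (w [^] n \<oplus> ?G)"
      using G by (simp add: a_minus_def minus_add a_ac)
    ultimately show ?case unfolding GS using 1 by simp
  qed
  have G: "(\<Oplus>k\<in>{..<p}. w [^] k) \<in> carrier L" using wc by (intro finsum_closed) auto
  have "?d \<otimes> (\<Oplus>k\<in>{..<p}. w [^] k) = \<zero>" using geom[of p] w(2) by (simp add: a_minus_def r_neg)
  then have "(\<Oplus>k\<in>{..<p}. w [^] k) = \<zero>" using d G by (simp add: integral_iff)
  then have "[p] \<cdot> \<one> \<in> ge (v ?d)" using geom[of p] by (simp add: a_minus_def)
  then show ?thesis
    using p0 Sigma_up[OF dS] value_groupI[of "[p] \<cdot> \<one>"] by (auto simp: ge_def)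
qed

end

section \<open>The equivalences\<close>



text \<open>In \<open>p = p\<^sup>\<nu> e f\<close> with \<open>\<nu> > 0\<close> there is no room for \<open>e\<close> or \<open>f\<close>.\<close>

lemma defect_extension_prime_degrees:
  assumes "defect_extension L K v" "field_degree L K = p" "residue_char L v K = p" "Factorial_Ring.prime p"
  shows "ramification_index L v K = 1" "inertia_degree L v K = 1"
proof -
  have pos: "0 < p" using assms(4) by (rule prime_gt_0_nat)
  then have "char_exponent L v K = p" using assms(3) by (simp add: char_exponent_def)
  then obtain \<nu> where \<nu>: "p = p ^ \<nu> * ramification_index L v K * inertia_degree L v K" "p ^ \<nu> > 1"
    using assms(1,2) unfolding defect_extension_def by auto
  then have "\<nu> \<noteq> 0" by (cases \<nu>) auto
  then obtain m where m: "\<nu> = Suc m" by (cases \<nu>) auto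
  have "p * (p ^ m * (ramification_index L v K * inertia_degree L v K)) = p * 1"
    using \<nu>(1) unfolding m by (simp add: ac_simps)
  then have "p ^ m * (ramification_index L v K * inertia_degree L v K) = 1" using pos by simp
  then show "ramification_index L v K = 1" "inertia_degree L v K = 1" by simp_all
qed

lemma galois_defect_extension_immediate_cyclic:
  fixes L :: "('a, 'm) ring_scheme" (structure)
    and v :: "'a \<Rightarrow> 'g::linordered_ab_group_add"
  assumes ext: "galois_defect_extension L K v p"
    and roots: "ring_char (L\<lparr>carrier := K\<rparr>) = 0 \<Longrightarrow> card {\<zeta> \<in> K. \<zeta> [^] p = \<one>} = p"
    and sigma: "\<sigma> \<in> Gal L K" "\<sigma> \<noteq> (\<lambda>x\<in>carrier L. x)"
  shows "immediate_cyclic_trace L v K p \<sigma>" "valued_extension L v K"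
    "ring_char (L\<lparr>carrier := K\<rparr>) = 0 \<Longrightarrow> v ([p] \<cdot> \<one>) \<in> Sigma_set L v \<sigma>"
proof -
  have defect: "defect_extension L K v" and gal: "galois_extension L K" and p: "Factorial_Ring.prime p"
    and deg: "field_degree L K = p" and rc: "residue_char L v K = p"
    using ext by (auto simp: galois_defect_extension_def)
  have L: "field L" and K: "subfield K L" and val: "krull_valuation L v"
    and fin: "ring.finite_dimension L K (carrier L)" and uni: "unibranched L K v"
    using defect by (auto simp: defect_extension_def)
  interpret L: field L by (rule L)
  interpret valued_extension L v K
    using L val K fin by (intro valued_extension.intro valued_field.intro valued_field_axioms.intro valued_extension_axioms.intro)
  show ve: "valued_extension L v K" by unfold_locales
  have ef: "ramification_index L v K = 1" "inertia_degree L v K = 1"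
    using defect_extension_prime_degrees[OF defect deg rc p] by auto
  have imm: "\<exists>c\<in>K. v x < v (x \<ominus> c)" if "x \<in> carrier L" "x \<notin> K" for x
    using immediate_if_degrees_one[OF ef that] .
  have hom: "\<sigma> \<in> ring_hom L L" and ext_s: "\<sigma> \<in> extensional (carrier L)" and fixK: "\<And>c. c \<in> K \<Longrightarrow> \<sigma> c = c"
    using sigma(1) by (auto simp: Gal_def ring_iso_def)
  obtain z where z: "z \<in> carrier L" "\<sigma> z \<noteq> z"
  proof (rule ccontr)
    assume "\<not> thesis"
    then have "\<sigma> z = z" if "z \<in> carrier L" for z using that \<open>\<And>z. z \<in> carrier L \<Longrightarrow> \<sigma> z \<noteq> z \<Longrightarrow> thesis\<close> by blast
    then have "\<sigma> = (\<lambda>x\<in>carrier L. x)" by (intro extensionalityI[OF ext_s]) auto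
    then show False using sigma(2) by simp
  qed
  have "v ([i] \<cdot> \<one>) = 0 \<and> [i] \<cdot> \<one> \<noteq> \<zero>" if i: "0 < i" "i < p" for i :: nat
  proof -
    have "\<not> p dvd i" using i by (auto dest: dvd_imp_le)
    then have "[i] \<cdot> \<one> \<notin> gt 0" using residue_char_dvd_iff[of i] rc by simp
    moreover have "[i] \<cdot> \<one> \<in> ge 0" using of_nat_residue[of i] by blast
    ultimately show ?thesis by (auto simp: ge_def gt_def)
  qed
  then have units: "\<And>i::nat. 0 < i \<Longrightarrow> i < p \<Longrightarrow> [i] \<cdot> \<one> \<noteq> \<zero> \<and> v ([i] \<cdot> \<one>) = 0" by blast
  have aut: "prime_degree_automorphism L v K p \<sigma>"
  proof (intro prime_degree_automorphism.intro immediate_automorphism.intro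
      immediate_automorphism_axioms.intro prime_degree_automorphism_axioms.intro)
    show "valued_field L v" by unfold_locales
    show "\<sigma> x = x \<longleftrightarrow> x \<in> K" if "x \<in> carrier L" for x
      by (rule prime_degree_fixed_field[OF deg p hom fixK z that])
    show "v (\<sigma> x) = v x" if "x \<in> carrier L" "x \<noteq> \<zero>" for x
      by (rule unibranched_invariant[OF uni hom fixK imm that])
    show "\<exists>x\<in>carrier L. x \<notin> K" using z fixK by blast
  qed (fact K p hom imm units fin deg)+
  interpret A: prime_degree_automorphism L v K p \<sigma> by (rule aut)
  show v_p: "v ([p] \<cdot> \<one>) \<in> Sigma_set L v \<sigma>" if char0: "ring_char (L\<lparr>carrier := K\<rparr>) = 0"
  proof -
    have "card {\<zeta> \<in> K. \<zeta> [^] p = \<one>} > 1" using roots[OF char0] prime_gt_1_nat[OF p] by simp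
    then have "\<not> {\<zeta> \<in> K. \<zeta> [^] p = \<one>} \<subseteq> {\<one>}"
      using card_mono[of "{\<one>}" "{\<zeta> \<in> K. \<zeta> [^] p = \<one>}"] by auto
    then obtain w where w: "w \<in> K" "w [^] p = \<one>" "w \<noteq> \<one>" by blast
    have "[p] \<cdot> \<one> \<noteq> \<zero>"
      using char_zero_or_residue_char[OF rc prime_gt_0_nat[OF p]] char0 by blast
    from A.v_p_in_Sigma[OF w this] show ?thesis .
  qed
  have "[p] \<cdot> \<one> = \<zero> \<or> v ([p] \<cdot> \<one>) \<in> Sigma_set L v \<sigma>"
    using char_zero_or_residue_char[OF rc prime_gt_0_nat[OF p]] v_p by blast
  then show "immediate_cyclic_trace L v K p \<sigma>"
    using fin A.immediate_cyclic_axioms by (intro immediate_cyclic_trace.intro immediate_cyclic_trace_axioms.intro)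
qed

theorem theorem1p4:
  fixes L :: "('a, 'm) ring_scheme" (structure)
    and K :: "'a set"
    and v :: "'a \<Rightarrow> 'g::linordered_ab_group_add"
    and p :: nat
    and \<sigma> :: "'a \<Rightarrow> 'a"
  assumes ext: "galois_defect_extension L K v p"
    and roots: "ring_char (L\<lparr>carrier := K\<rparr>) = 0 \<Longrightarrow> card {\<zeta> \<in> K. \<zeta> [^] p = \<one>} = p"
    and sigma: "\<sigma> \<in> Gal L K" "\<sigma> \<noteq> (\<lambda>x\<in>carrier L. x)"
  shows
    "(independent_defect L v \<sigma> \<longleftrightarrow>
        (\<exists>H. strongly_convex (value_group L v (carrier L)) H \<and>
             ramification_ideal L v \<sigma> = coarse_val_ideal L v H)) \<and>
     (independent_defect L v \<sigma> \<longleftrightarrow>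
        ramification_ideal L v \<sigma> [^]\<^bsub>ideals_set (val_ring_of L v)\<^esub> p = ramification_ideal L v \<sigma>) \<and>
     (independent_defect L v \<sigma> \<longleftrightarrow>
        carrier (kaehler (val_ring_of L v) (val_ring L v K)) =
          {\<zero>\<^bsub>kaehler (val_ring_of L v) (val_ring L v K)\<^esub>}) \<and>
     (independent_defect L v \<sigma> \<longleftrightarrow>
        (\<exists>H. strongly_convex (value_group L v K) H \<and>
             field_trace L K ` val_ideal L v (carrier L) = coarse_val_ideal L v H \<inter> K)) \<and>
     (\<forall>H. (strongly_convex (value_group L v (carrier L)) H \<and>
             ramification_ideal L v \<sigma> = coarse_val_ideal L v H) \<or>
           (strongly_convex (value_group L v K) H \<and>
             field_trace L K ` val_ideal L v (carrier L) = coarse_val_ideal L v H \<inter> K) \<longrightarrow>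
        H = defect_subgroup L v \<sigma> \<and>
        primeideal (ramification_ideal L v \<sigma>) (val_ring_of L v) \<and>
        coarse_val_ring L v H =
          localization_at L (val_ring L v (carrier L)) (ramification_ideal L v \<sigma>) \<and>
        \<not> has_least_positive (coarse_value_group L v H) H) \<and>
     (archimedean_group (value_group L v K) \<or> archimedean_group (vp_subgroup L K v p) \<longrightarrow>
        (independent_defect L v \<sigma> \<longrightarrow> defect_subgroup L v \<sigma> = {0}) \<and>
        (primeideal (ramification_ideal L v \<sigma>) (val_ring_of L v) \<longrightarrow>
           ramification_ideal L v \<sigma> = val_ideal L v (carrier L))) \<and>
     ((\<forall>a\<in>val_ideal L v (carrier L).
         \<forall>\<omega>\<in>carrier (kaehler (val_ring_of L v) (val_ring L v K)).
           a \<odot>\<^bsub>kaehler (val_ring_of L v) (val_ring L v K)\<^esub> \<omega> =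
             \<zero>\<^bsub>kaehler (val_ring_of L v) (val_ring L v K)\<^esub>) \<longrightarrow>
        carrier (kaehler (val_ring_of L v) (val_ring L v K)) =
          {\<zero>\<^bsub>kaehler (val_ring_of L v) (val_ring L v K)\<^esub>})"
proof -
  interpret immediate_cyclic_trace L v K p \<sigma>
    by (rule galois_defect_extension_immediate_cyclic(1)[OF ext roots sigma])
  have indep_iff: "independent_defect L v \<sigma> \<longleftrightarrow> (\<exists>H. strongly_convex \<Gamma> H \<and> Sig = {\<alpha> \<in> \<Gamma>. \<forall>h\<in>H. \<alpha> > h})"
    unfolding independent_defect_def indep_defect_witness_def ..
  have trace_iff: "Tr ` gt 0 = coarse_val_ideal L v H \<inter> K \<longleftrightarrow> Sig = {\<alpha> \<in> \<Gamma>. \<forall>h\<in>H. \<alpha> > h}"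
    if H: "strongly_convex \<Gamma> H" for H
  proof
    assume "Tr ` gt 0 = coarse_val_ideal L v H \<inter> K"
    then show "Sig = {\<alpha> \<in> \<Gamma>. \<forall>h\<in>H. \<alpha> > h}" by (rule Sigma_if_trace_image[OF strongly_convexD[OF H]])
  next
    assume Sig: "Sig = {\<alpha> \<in> \<Gamma>. \<forall>h\<in>H. \<alpha> > h}"
    then have "halving Sig" using indep_iff independent_iff_halving H by blast
    then show "Tr ` gt 0 = coarse_val_ideal L v H \<inter> K" using Sig by (rule trace_image_if_independent)
  qed
  have b: "independent_defect L v \<sigma> \<longleftrightarrow> (\<exists>H. strongly_convex \<Gamma> H \<and> I = coarse_val_ideal L v H)"
    unfolding indep_iff ramification_ideal_eq_iff ..
  have c: "independent_defect L v \<sigma> \<longleftrightarrow> I [^]\<^bsub>ideals_set OL\<^esub> p = I"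
    unfolding independent_iff_halving ramification_ideal_pow_iff ..
  have d: "independent_defect L v \<sigma> \<longleftrightarrow> carrier \<Omega> = {\<zero>\<^bsub>\<Omega>\<^esub>}"
    unfolding independent_iff_halving kaehler_trivial_iff ..
  have e: "independent_defect L v \<sigma> \<longleftrightarrow> (\<exists>H. strongly_convex (value_group L v K) H \<and>
      field_trace L K ` val_ideal L v (carrier L) = coarse_val_ideal L v H \<inter> K)"
    unfolding indep_iff trace_image value_group_K using trace_iff by blast
  have f: "\<forall>H. (strongly_convex \<Gamma> H \<and> I = coarse_val_ideal L v H) \<or>
      (strongly_convex (value_group L v K) H \<and>
        field_trace L K ` val_ideal L v (carrier L) = coarse_val_ideal L v H \<inter> K) \<longrightarrow>
      H = defect_subgroup L v \<sigma> \<and> primeideal I OL \<and>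
      coarse_val_ring L v H = localization_at L (val_ring L v (carrier L)) I \<and>
      \<not> has_least_positive (coarse_value_group L v H) H"
  proof (intro allI impI)
    fix H
    assume "(strongly_convex \<Gamma> H \<and> I = coarse_val_ideal L v H) \<or>
      (strongly_convex (value_group L v K) H \<and>
        field_trace L K ` val_ideal L v (carrier L) = coarse_val_ideal L v H \<inter> K)"
    then have H: "strongly_convex \<Gamma> H" and Sig: "Sig = {\<alpha> \<in> \<Gamma>. \<forall>h\<in>H. \<alpha> > h}"
      unfolding trace_image value_group_K ramification_ideal_eq_iff using trace_iff by blast+
    have "\<not> has_least_positive (coarse_value_group L v H) H"
      using H unfolding coarse_value_group_eq strongly_convex_def by blast
    then show "H = defect_subgroup L v \<sigma> \<and> primeideal I OL \<and>
      coarse_val_ring L v H = localization_at L (val_ring L v (carrier L)) I \<and>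
      \<not> has_least_positive (coarse_value_group L v H) H"
      using defect_subgroup_eq[OF H Sig] primeideal_ramification_ideal[OF strongly_convexD[OF H] Sig]
        coarse_val_ring_localization[OF strongly_convexD[OF H] Sig] by simp
  qed
  have g: "archimedean_group (value_group L v K) \<or> archimedean_group (vp_subgroup L K v p) \<longrightarrow>
      (independent_defect L v \<sigma> \<longrightarrow> defect_subgroup L v \<sigma> = {0}) \<and>
      (primeideal I OL \<longrightarrow> I = val_ideal L v (carrier L))"
  proof
    assume "archimedean_group (value_group L v K) \<or> archimedean_group (vp_subgroup L K v p)"
    then have "\<exists>G \<gamma>. archimedean_group G \<and> convex_subgroup \<Gamma> G \<and> \<gamma> \<in> G \<and> \<gamma> \<in> Sig"
    proof
      assume "archimedean_group (value_group L v K)"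
      then show ?thesis
        unfolding value_group_K using value_group_convex Sigma_nonempty Sigma_subset by blast
    next
      assume arch: "archimedean_group (vp_subgroup L K v p)"
      show ?thesis
      proof (cases "ring_char (L\<lparr>carrier := K\<rparr>) = 0")
        case True
        let ?C = "{H. convex_subgroup \<Gamma> H \<and> v ([p] \<cdot> \<one>) \<in> H}"
        have vp: "v ([p] \<cdot> \<one>) \<in> Sig"
          by (rule galois_defect_extension_immediate_cyclic(3)[OF ext roots sigma True])
        have G: "vp_subgroup L K v p = \<Inter>?C" using True by (simp add: vp_subgroup_def value_group_K)
        have top: "\<Gamma> \<in> ?C" using value_group_convex vp Sigma_subset by blast
        have "convex_subgroup \<Gamma> (\<Inter>?C)" by (rule convex_subgroup_Inter) (use top in blast)+
        moreover have "v ([p] \<cdot> \<one>) \<in> \<Inter>?C" by blast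
        ultimately show ?thesis using arch vp unfolding G by blast
      next
        case False
        then have "vp_subgroup L K v p = \<Gamma>" by (simp add: vp_subgroup_def value_group_K)
        then show ?thesis using arch value_group_convex Sigma_nonempty Sigma_subset by auto
      qed
    qed
    then obtain G \<gamma> where G: "archimedean_group G" "convex_subgroup \<Gamma> G" "\<gamma> \<in> G" "\<gamma> \<in> Sig" by blast
    show "(independent_defect L v \<sigma> \<longrightarrow> defect_subgroup L v \<sigma> = {0}) \<and>
      (primeideal I OL \<longrightarrow> I = val_ideal L v (carrier L))"
      using archimedean_consequences[OF G] by blast
  qed
  have h: "(\<forall>a\<in>val_ideal L v (carrier L). \<forall>\<omega>\<in>carrier \<Omega>. a \<odot>\<^bsub>\<Omega>\<^esub> \<omega> = \<zero>\<^bsub>\<Omega>\<^esub>) \<longrightarrow> carrier \<Omega> = {\<zero>\<^bsub>\<Omega>\<^esub>}"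
    unfolding val_ideal_eq by (rule impI, rule kaehler_trivial_if_killed)
  from b c d e f g h show ?thesis by (intro conjI)
qed

end
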